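(* Let $F$ be a free group of finite rank $n>1$, let $\underline{w}$ be a multiword in $F$, and let $\mathcal{D}$ be the associated decomposition space. Then $\mathcal{D}$ is a circle (homeomorphic to $S^1$) if and only if all of the following are satisfied: (1) $\mathcal{D}$ is connected. (2) $\mathcal{D}$ has no cut points. (3) $\mathcal{D}$ has cut pairs. (4) Every cut pair in $\mathcal{D}$ is crossed by a cut pair.
   Context: A multiword $\underline{w}=\{w_1,\dots,w_k\}$ ($k\ge1$) in $F$ is a finite set of elements generating pairwise non-conjugate maximal cyclic subgroups of $F$. For nontrivial $f\in F$, $f^\infty$ and $f^{-\infty}=(f^{-1})^\infty$ are the attracting and repelling fixed points of $f$ on the Gromov boundary $\partial F$. The decomposition space $\mathcal{D}$ is the quotient of $\partial F$ obtained by identifying $w^\infty$ with $w^{-\infty}$ for each $w\in F$ with $\langle w\rangle$ conjugate to some $\langle w_i\rangle$. When $\mathcal{D}$ is connected: a cut point is a point $x$ such that $\mathcal{D}\setminus\{x\}$ is not connected; a cut pair is a pair of distinct points $\{x_0,x_1\}$, neither of which is a cut point, such that $\mathcal{D}\setminus\{x_0,x_1\}$ is not connected. A cut pair $\{y_0,y_1\}$ crosses a cut pair $\{x_0,x_1\}$ if $y_0$ and $y_1$ lie in different components of $\mathcal{D}\setminus\{x_0,x_1\}$. *)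

theory Defs
  imports "HOL-Algebra.Generated_Groups" "HOL-Analysis.Analysis"
begin

section \<open>Free groups\<close>

text \<open>A word over \<open>X\<close> is a list over \<open>X \<times> UNIV\<close>; \<open>(x, True)\<close> stands for \<open>x\<close> and
  \<open>(x, False)\<close> for its inverse.\<close>

definition letter_value :: "('a, 'b) monoid_scheme \<Rightarrow> 'a \<times> bool \<Rightarrow> 'a" where
  "letter_value F l = (if snd l then fst l else inv\<^bsub>F\<^esub> (fst l))"

definition word_value :: "('a, 'b) monoid_scheme \<Rightarrow> ('a \<times> bool) list \<Rightarrow> 'a" where
  "word_value F u = foldr (\<lambda>l g. letter_value F l \<otimes>\<^bsub>F\<^esub> g) u \<one>\<^bsub>F\<^esub>"

definition words :: "'a set \<Rightarrow> ('a \<times> bool) list set" where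
  "words X = lists (X \<times> UNIV)"

definition reduced_word :: "('a \<times> bool) list \<Rightarrow> bool" where
  "reduced_word u \<longleftrightarrow> successively (\<lambda>k l. \<not> (fst k = fst l \<and> snd k \<noteq> snd l)) u"

definition free_basis :: "('a, 'b) monoid_scheme \<Rightarrow> 'a set \<Rightarrow> bool" where
  "free_basis F X \<longleftrightarrow> X \<subseteq> carrier F \<and>
     (\<forall>g\<in>carrier F. \<exists>!u. u \<in> words X \<and> reduced_word u \<and> word_value F u = g)"

section \<open>The Gromov boundary\<close>

text \<open>Everything is based at the identity vertex of the Cayley graph of \<open>F\<close> with respect to
  the generating set \<open>X\<close>, in which the distance from \<open>g\<close> to \<open>h\<close> is the word length of
  \<open>inv g \<otimes> h\<close>.\<close>

definition word_length :: "('a, 'b) monoid_scheme \<Rightarrow> 'a set \<Rightarrow> 'a \<Rightarrow> nat" where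
  "word_length F X g = (LEAST n. \<exists>u\<in>words X. length u = n \<and> word_value F u = g)"

definition gromov_product :: "('a, 'b) monoid_scheme \<Rightarrow> 'a set \<Rightarrow> 'a \<Rightarrow> 'a \<Rightarrow> real" where
  "gromov_product F X g h =
     (real (word_length F X g) + real (word_length F X h)
       - real (word_length F X (inv\<^bsub>F\<^esub> g \<otimes>\<^bsub>F\<^esub> h))) / 2"

definition gromov_asymptotic ::
  "('a, 'b) monoid_scheme \<Rightarrow> 'a set \<Rightarrow> (nat \<Rightarrow> 'a) \<Rightarrow> (nat \<Rightarrow> 'a) \<Rightarrow> bool" where
  "gromov_asymptotic F X s t \<longleftrightarrow>
     filterlim (\<lambda>(i, j). gromov_product F X (s i) (t j)) at_top (sequentially \<times>\<^sub>F sequentially)"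

definition gromov_sequences :: "('a, 'b) monoid_scheme \<Rightarrow> 'a set \<Rightarrow> (nat \<Rightarrow> 'a) set" where
  "gromov_sequences F X = {s. range s \<subseteq> carrier F \<and> gromov_asymptotic F X s s}"

definition endpoint ::
  "('a, 'b) monoid_scheme \<Rightarrow> 'a set \<Rightarrow> (nat \<Rightarrow> 'a) \<Rightarrow> (nat \<Rightarrow> 'a) set" where
  "endpoint F X s = {t \<in> gromov_sequences F X. gromov_asymptotic F X s t}"

definition boundary_points :: "('a, 'b) monoid_scheme \<Rightarrow> 'a set \<Rightarrow> (nat \<Rightarrow> 'a) set set" where
  "boundary_points F X = endpoint F X ` gromov_sequences F X"

text \<open>The usual basic neighbourhoods: those \<open>q\<close> for which some sequences converging to \<open>p\<close>
  and \<open>q\<close> have \<open>liminf\<close> of Gromov products at least \<open>r\<close>.\<close>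

definition boundary_nbhd ::
  "('a, 'b) monoid_scheme \<Rightarrow> 'a set \<Rightarrow> (nat \<Rightarrow> 'a) set \<Rightarrow> real \<Rightarrow> (nat \<Rightarrow> 'a) set set" where
  "boundary_nbhd F X p r = {q \<in> boundary_points F X. \<exists>s\<in>p. \<exists>t\<in>q.
     ereal r \<le> Liminf (sequentially \<times>\<^sub>F sequentially)
                 (\<lambda>(i, j). ereal (gromov_product F X (s i) (t j)))}"

definition gromov_boundary ::
  "('a, 'b) monoid_scheme \<Rightarrow> 'a set \<Rightarrow> (nat \<Rightarrow> 'a) set topology" where
  "gromov_boundary F X = topology (\<lambda>U. U \<subseteq> boundary_points F X \<and>
     (\<forall>p\<in>U. \<exists>r. boundary_nbhd F X p r \<subseteq> U))"

lemma boundary_nbhd_antimono: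
  assumes "r \<le> r'" shows "boundary_nbhd F X p r' \<subseteq> boundary_nbhd F X p r"
proof -
  have "ereal r \<le> ereal r'" using assms by simp
  then show ?thesis unfolding boundary_nbhd_def using order_trans by blast
qed

lemma openin_gromov_boundary:
  "openin (gromov_boundary F X) U \<longleftrightarrow>
     U \<subseteq> boundary_points F X \<and> (\<forall>p\<in>U. \<exists>r. boundary_nbhd F X p r \<subseteq> U)"
proof -
  have "istopology (\<lambda>U. U \<subseteq> boundary_points F X \<and> (\<forall>p\<in>U. \<exists>r. boundary_nbhd F X p r \<subseteq> U))"
    unfolding istopology_def
  proof (intro conjI allI impI)
    fix S T
    assume S: "S \<subseteq> boundary_points F X \<and> (\<forall>p\<in>S. \<exists>r. boundary_nbhd F X p r \<subseteq> S)"
      and T: "T \<subseteq> boundary_points F X \<and> (\<forall>p\<in>T. \<exists>r. boundary_nbhd F X p r \<subseteq> T)"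
    show "S \<inter> T \<subseteq> boundary_points F X" using S by blast
    show "\<forall>p\<in>S \<inter> T. \<exists>r. boundary_nbhd F X p r \<subseteq> S \<inter> T"
    proof
      fix p assume "p \<in> S \<inter> T"
      then obtain r r' where "boundary_nbhd F X p r \<subseteq> S" "boundary_nbhd F X p r' \<subseteq> T"
        using S T by blast
      then have "boundary_nbhd F X p (max r r') \<subseteq> S \<inter> T"
        using boundary_nbhd_antimono[of r "max r r'" F X p]
          boundary_nbhd_antimono[of r' "max r r'" F X p] by auto
      then show "\<exists>r. boundary_nbhd F X p r \<subseteq> S \<inter> T" ..
    qed
  next
    fix K
    assume K: "\<forall>U\<in>K. U \<subseteq> boundary_points F X \<and> (\<forall>p\<in>U. \<exists>r. boundary_nbhd F X p r \<subseteq> U)"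
    show "\<Union>K \<subseteq> boundary_points F X" using K by blast
    show "\<forall>p\<in>\<Union>K. \<exists>r. boundary_nbhd F X p r \<subseteq> \<Union>K"
    proof
      fix p assume "p \<in> \<Union>K"
      then obtain U where U: "U \<in> K" "p \<in> U" by blast
      then obtain r where "boundary_nbhd F X p r \<subseteq> U" using K by blast
      then show "\<exists>r. boundary_nbhd F X p r \<subseteq> \<Union>K" using U(1) by blast
    qed
  qed
  then show ?thesis by (simp add: gromov_boundary_def topology_inverse')
qed

lemma topspace_gromov_boundary: "topspace (gromov_boundary F X) = boundary_points F X"
proof -
  have "openin (gromov_boundary F X) (boundary_points F X)"
    by (auto simp: openin_gromov_boundary boundary_nbhd_def)
  then show ?thesis by (auto simp: topspace_def openin_gromov_boundary)
qed

text \<open>The attracting fixed point of \<open>f\<close> is the limit of its powers.\<close>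

definition attracting_point ::
  "('a, 'b) monoid_scheme \<Rightarrow> 'a set \<Rightarrow> 'a \<Rightarrow> (nat \<Rightarrow> 'a) set" where
  "attracting_point F X f = endpoint F X (\<lambda>n. f [^]\<^bsub>F\<^esub> n)"

definition repelling_point ::
  "('a, 'b) monoid_scheme \<Rightarrow> 'a set \<Rightarrow> 'a \<Rightarrow> (nat \<Rightarrow> 'a) set" where
  "repelling_point F X f = attracting_point F X (inv\<^bsub>F\<^esub> f)"

section \<open>Multiwords and the decomposition space\<close>

definition conjugate_subgroups :: "('a, 'b) monoid_scheme \<Rightarrow> 'a set \<Rightarrow> 'a set \<Rightarrow> bool" where
  "conjugate_subgroups F H K \<longleftrightarrow>
     (\<exists>g\<in>carrier F. K = (\<lambda>h. g \<otimes>\<^bsub>F\<^esub> h \<otimes>\<^bsub>F\<^esub> inv\<^bsub>F\<^esub> g) ` H)"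

definition maximal_cyclic_subgroup :: "('a, 'b) monoid_scheme \<Rightarrow> 'a set \<Rightarrow> bool" where
  "maximal_cyclic_subgroup F H \<longleftrightarrow>
     (\<exists>f\<in>carrier F. H = generate F {f}) \<and>
     (\<forall>g\<in>carrier F. H \<subseteq> generate F {g} \<longrightarrow> H = generate F {g})"

definition multiword :: "('a, 'b) monoid_scheme \<Rightarrow> 'a set \<Rightarrow> bool" where
  "multiword F W \<longleftrightarrow> finite W \<and> W \<noteq> {} \<and> W \<subseteq> carrier F \<and>
     (\<forall>w\<in>W. maximal_cyclic_subgroup F (generate F {w})) \<and>
     (\<forall>v\<in>W. \<forall>w\<in>W. v \<noteq> w \<longrightarrow> \<not> conjugate_subgroups F (generate F {v}) (generate F {w}))"

definition identified ::
  "('a, 'b) monoid_scheme \<Rightarrow> 'a set \<Rightarrow> 'a set \<Rightarrow> (nat \<Rightarrow> 'a) set \<Rightarrow> (nat \<Rightarrow> 'a) set \<Rightarrow> bool" where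
  "identified F X W p q \<longleftrightarrow>
     (\<exists>w\<in>carrier F. (\<exists>v\<in>W. conjugate_subgroups F (generate F {w}) (generate F {v})) \<and>
        p = attracting_point F X w \<and> q = repelling_point F X w)"

definition decomposition_map ::
  "('a, 'b) monoid_scheme \<Rightarrow> 'a set \<Rightarrow> 'a set \<Rightarrow> (nat \<Rightarrow> 'a) set \<Rightarrow> (nat \<Rightarrow> 'a) set set" where
  "decomposition_map F X W p = {q \<in> boundary_points F X. equivclp (identified F X W) p q}"

definition decomposition_space ::
  "('a, 'b) monoid_scheme \<Rightarrow> 'a set \<Rightarrow> 'a set \<Rightarrow> (nat \<Rightarrow> 'a) set set topology" where
  "decomposition_space F X W = topology (\<lambda>U.
     U \<subseteq> decomposition_map F X W ` boundary_points F X \<and>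
     openin (gromov_boundary F X) {p \<in> boundary_points F X. decomposition_map F X W p \<in> U})"

lemma openin_decomposition_space:
  "openin (decomposition_space F X W) U \<longleftrightarrow>
     U \<subseteq> decomposition_map F X W ` boundary_points F X \<and>
     openin (gromov_boundary F X) {p \<in> boundary_points F X. decomposition_map F X W p \<in> U}"
proof -
  let ?B = "boundary_points F X" and ?d = "decomposition_map F X W"
  have "istopology (\<lambda>U. U \<subseteq> ?d ` ?B \<and> openin (gromov_boundary F X) {p \<in> ?B. ?d p \<in> U})"
    unfolding istopology_def
  proof (intro conjI allI impI)
    fix S T
    assume S: "S \<subseteq> ?d ` ?B \<and> openin (gromov_boundary F X) {p \<in> ?B. ?d p \<in> S}"
      and T: "T \<subseteq> ?d ` ?B \<and> openin (gromov_boundary F X) {p \<in> ?B. ?d p \<in> T}"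
    show "S \<inter> T \<subseteq> ?d ` ?B" using S by blast
    have "{p \<in> ?B. ?d p \<in> S \<inter> T} = {p \<in> ?B. ?d p \<in> S} \<inter> {p \<in> ?B. ?d p \<in> T}" by blast
    then show "openin (gromov_boundary F X) {p \<in> ?B. ?d p \<in> S \<inter> T}"
      using S T by (simp add: openin_Int)
  next
    fix K
    assume K: "\<forall>U\<in>K. U \<subseteq> ?d ` ?B \<and> openin (gromov_boundary F X) {p \<in> ?B. ?d p \<in> U}"
    show "\<Union>K \<subseteq> ?d ` ?B" using K by blast
    have *: "{p \<in> ?B. ?d p \<in> \<Union>K} = \<Union>((\<lambda>U. {p \<in> ?B. ?d p \<in> U}) ` K)" by blast
    show "openin (gromov_boundary F X) {p \<in> ?B. ?d p \<in> \<Union>K}"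
      unfolding * by (rule openin_Union) (use K in fast)
  qed
  then show ?thesis by (simp add: decomposition_space_def topology_inverse')
qed

lemma quotient_map_decomposition_map:
  "quotient_map (gromov_boundary F X) (decomposition_space F X W) (decomposition_map F X W)"
proof -
  let ?B = "boundary_points F X" and ?d = "decomposition_map F X W"
  have "{p \<in> ?B. ?d p \<in> ?d ` ?B} = ?B" by blast
  then have "openin (decomposition_space F X W) (?d ` ?B)"
    using openin_topspace[of "gromov_boundary F X"]
    by (simp add: openin_decomposition_space topspace_gromov_boundary)
  then have top: "topspace (decomposition_space F X W) = ?d ` ?B"
    by (auto simp: topspace_def openin_decomposition_space)
  show ?thesis
    unfolding quotient_map_def top topspace_gromov_boundary
    by (auto simp: openin_decomposition_space)
qed

section \<open>Cut points and cut pairs\<close>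

definition cut_point :: "'p topology \<Rightarrow> 'p \<Rightarrow> bool" where
  "cut_point D x \<longleftrightarrow> x \<in> topspace D \<and>
     \<not> connected_space (subtopology D (topspace D - {x}))"

definition cut_pair :: "'p topology \<Rightarrow> 'p set \<Rightarrow> bool" where
  "cut_pair D P \<longleftrightarrow> (\<exists>x0\<in>topspace D. \<exists>x1\<in>topspace D.
     P = {x0, x1} \<and> x0 \<noteq> x1 \<and> \<not> cut_point D x0 \<and> \<not> cut_point D x1 \<and>
     \<not> connected_space (subtopology D (topspace D - {x0, x1})))"

definition crosses :: "'p topology \<Rightarrow> 'p set \<Rightarrow> 'p set \<Rightarrow> bool" where
  "crosses D Q P \<longleftrightarrow> (\<exists>y0 y1. Q = {y0, y1} \<and>
     (\<exists>C0\<in>connected_components_of (subtopology D (topspace D - P)).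
      \<exists>C1\<in>connected_components_of (subtopology D (topspace D - P)).
        C0 \<noteq> C1 \<and> y0 \<in> C0 \<and> y1 \<in> C1))"

end

theory Submission imports Defs begin

text \<open>
  On a circle a point does not separate and two points do, and a pair of points on the two sides of a
  chord crosses the pair of its ends. So the four conditions are necessary, by
  \<open>circle_imp_crossed_cut_pairs\<close>.

  For sufficiency, the group enters only through general properties of the decomposition space \<open>D\<close>.
  For \<open>g\<close> in \<open>F\<close> and \<open>v\<close> in \<open>W\<close> the points \<open>g v^i\<close> converge to two boundary points as \<open>i\<close> tends to plus or minus
  infinity; call them the ends of a line. Then \<open>D\<close> identifies the two ends of each line. Lines with a
  common end have both ends in common (\<open>attracting_determines_repelling\<close>), because the corresponding
  conjugates of elements of \<open>W\<close> have a common power. Only finitely many lines have ends on different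
  sides of a given edge of the Cayley tree (\<open>finitely_many_split_lines\<close>), because a line stays almost
  as far away from the identity as the shortest of its points \<open>g v^i\<close>. Since the
  shadows of edges form a base of clopen sets of the compact boundary, it follows that the
  identification is closed, so that \<open>D\<close> is compact and Hausdorff. The image of a shadow in a connected
  \<open>D\<close> can only fall apart into pieces that contain one of the finitely many lines that cross it; hence
  \<open>D\<close>, if connected, is locally connected (\<open>crossing_quotient_locally_connected\<close>). It is also
  separable.

  The rest is topology (\<open>circle_of_crossed_cut_pairs\<close>). Let \<open>{a, b}\<close> be a cut pair, so that \<open>D\<close> is a
  union of two closed sets \<open>A\<close> and \<open>B\<close> that meet in \<open>a\<close> and \<open>b\<close>. It suffices that \<open>A\<close> is an arc from
  \<open>a\<close> to \<open>b\<close>; then \<open>B\<close> is one too, by symmetry. Points of \<open>A\<close> that separate \<open>a\<close> from \<open>b\<close> in \<open>A\<close> are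
  linearly ordered, and local connectedness provides suprema and infima (\<open>last_cut_before\<close>). If some
  point \<open>x\<close> of \<open>A\<close> did not separate \<open>a\<close> from \<open>b\<close>, then the last separating point \<open>u\<close> before \<open>x\<close> and
  the first one \<open>v\<close> after \<open>x\<close> would bound a gap, and \<open>{u, v}\<close> would be a cut pair. A cut pair that
  crosses it has a point in the gap, and this point separates \<open>a\<close> from \<open>b\<close> as well: a contradiction
  (\<open>every_point_cuts\<close>). So \<open>A\<close> is a linearly ordered continuum, and as it is separable it carries a
  continuous strictly increasing real function (\<open>strictly_increasing_function\<close>), which identifies it
  with an interval.
\<close>

section \<open>Quotients in which clopen sets cross few fibres\<close>

text \<open>The saturation of a closed set \<open>K\<close> is closed: if the fibre of \<open>p\<close> misses \<open>K\<close>, take \<open>C \<in> \<C>\<close> around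
  \<open>p\<close> that misses \<open>K\<close>. A point of \<open>C\<close> is equivalent to a point of \<open>K\<close> only if its fibre leaves \<open>C\<close>, and
  removing the finitely many such points from \<open>C\<close>, except \<open>p\<close> itself, leaves a neighbourhood of \<open>p\<close>.\<close>
lemma clopen_crossing_closed_map:
  assumes q: "quotient_map Z D q"
    and T1: "t1_space Z"
    and base: "\<And>z U. \<lbrakk>openin Z U; z \<in> U\<rbrakk> \<Longrightarrow> \<exists>C\<in>\<C>. z \<in> C \<and> C \<subseteq> U"
    and clopen: "\<And>C. C \<in> \<C> \<Longrightarrow> openin Z C"
    and crossing: "\<And>C. C \<in> \<C> \<Longrightarrow> finite {z \<in> C. \<exists>z'\<in>topspace Z - C. q z = q z'}"
  shows "closed_map Z D q"
  unfolding closed_map_def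
proof (intro allI impI)
  fix K assume K: "closedin Z K"
  have KZ: "K \<subseteq> topspace Z" using K closedin_subset by blast
  let ?S = "{z \<in> topspace Z. q z \<in> q ` K}"
  have "openin Z (topspace Z - ?S)"
  proof (subst openin_subopen, intro ballI)
    fix p assume p: "p \<in> topspace Z - ?S"
    then have "p \<in> topspace Z - K" by blast
    moreover have "openin Z (topspace Z - K)" using K by blast
    ultimately obtain C where C: "C \<in> \<C>" "p \<in> C" "C \<subseteq> topspace Z - K" using base by blast
    define E where "E = {z \<in> C. \<exists>z'\<in>topspace Z - C. q z = q z'} - {p}"
    have "finite E" using crossing[OF C(1)] by (simp add: E_def)
    moreover have "E \<subseteq> topspace Z" using C(3) E_def by auto
    ultimately have "closedin Z E" using T1 t1_space_closedin_finite by blast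
    then have "openin Z (C - E)" using clopen[OF C(1)] by blast
    moreover have "p \<in> C - E" using C(2) by (simp add: E_def)
    moreover have "C - E \<subseteq> topspace Z - ?S"
    proof
      fix z assume z: "z \<in> C - E"
      have "z \<notin> ?S"
      proof
        assume s: "z \<in> ?S"
        then obtain k where k: "k \<in> K" "q z = q k" by auto
        have "k \<in> topspace Z - C" using C(3) k KZ by blast
        then show False using z k(2) p s by (auto simp: E_def)
      qed
      then show "z \<in> topspace Z - ?S" using z C(3) by blast
    qed
    ultimately show "\<exists>T. openin Z T \<and> p \<in> T \<and> T \<subseteq> topspace Z - ?S" by blast
  qed
  then have "closedin Z ?S" by (simp add: closedin_def subset_iff)
  moreover have "q ` K \<subseteq> topspace D" using q KZ quotient_imp_surjective_map by blast
  ultimately show "closedin D (q ` K)" using q by (auto simp: quotient_map_closedin)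
qed

lemma closed_quotient_Hausdorff:
  assumes q: "quotient_map Z D q" and c: "closed_map Z D q"
    and Z: "compact_space Z" "Hausdorff_space Z"
  shows "compact_space D" "Hausdorff_space D"
proof -
  note cont = quotient_imp_continuous_map[OF q] and surj = quotient_imp_surjective_map[OF q]
  show "compact_space D"
    using image_compactin[OF _ cont] Z(1) surj by (metis compact_space_def)
  have "normal_space D"
    using normal_space_continuous_closed_map_image[OF _ cont c surj] Z
      compact_Hausdorff_or_regular_imp_normal_space by blast
  moreover have "t1_space D"
    unfolding t1_space_closedin_singleton
  proof
    fix x assume "x \<in> topspace D"
    then obtain z where "z \<in> topspace Z" "x = q z" using surj by auto
    moreover have "closedin Z {z}" if "z \<in> topspace Z" for z
      using Z(2) that by (simp add: closedin_Hausdorff_singleton)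
    ultimately show "closedin D {x}" using c unfolding closed_map_def by fastforce
  qed
  ultimately show "Hausdorff_space D" using normal_t1_imp_Hausdorff_space by blast
qed

text \<open>Take the clopen neighbourhood of \<open>x\<close> with the fewest points of \<open>\<Phi>\<close>. If it split, the part without
  \<open>x\<close> would contain a point of \<open>\<Phi>\<close>, so the part with \<open>x\<close> would have fewer.\<close>
lemma connected_clopen_of_finite_meeting:
  assumes fin: "finite \<Phi>" and x: "x \<in> topspace Y"
    and meet: "\<And>E. \<lbrakk>openin Y E; closedin Y E; E \<noteq> {}; E \<noteq> topspace Y\<rbrakk> \<Longrightarrow> E \<inter> \<Phi> \<noteq> {}"
  obtains E where "openin Y E" "closedin Y E" "x \<in> E" "connectedin Y E"
proof -
  let ?P = "\<lambda>E. openin Y E \<and> closedin Y E \<and> x \<in> E"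
  have "?P (topspace Y)" using x by simp
  then obtain E where E: "?P E" and mn: "\<And>E'. ?P E' \<Longrightarrow> card (E \<inter> \<Phi>) \<le> card (E' \<inter> \<Phi>)"
    using ex_has_least_nat[of ?P "topspace Y" "\<lambda>E. card (E \<inter> \<Phi>)"] by blast
  have sub: "E \<subseteq> topspace Y" using E openin_subset by blast
  have "E1 = {} \<or> E2 = {}" if E12: "openin Y E1" "openin Y E2" "E1 \<inter> E2 = {}" "E1 \<union> E2 = E" for E1 E2
  proof -
    have *: "E2 = {}" if xE: "x \<in> E1" and o: "openin Y E1" "openin Y E2" "E1 \<inter> E2 = {}" "E1 \<union> E2 = E" for E1 E2
    proof (rule ccontr)
      assume ne: "E2 \<noteq> {}"
      have "E1 = E - E2" "E2 = E - E1" using o(3,4) by blast+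
      then have cl: "closedin Y E1" "closedin Y E2" using E o(1,2) by (metis closedin_diff)+
      have "E2 \<noteq> topspace Y" using xE o(3) x by blast
      then have "E2 \<inter> \<Phi> \<noteq> {}" using meet o(2) cl(2) ne by blast
      then have "E1 \<inter> \<Phi> \<subset> E \<inter> \<Phi>" using o(3,4) by blast
      then have "card (E1 \<inter> \<Phi>) < card (E \<inter> \<Phi>)" using fin by (simp add: psubset_card_mono)
      moreover have "?P E1" using o(1) cl(1) xE by blast
      ultimately show False using mn[of E1] by linarith
    qed
    have "x \<in> E1 \<or> x \<in> E2" using E E12(4) by blast
    then show ?thesis using *[OF _ E12(1,2,3,4)] *[OF _ E12(2,1)] E12(3,4) by blast
  qed
  moreover have "topspace (subtopology Y E) = E" using sub by auto
  ultimately have "connectedin Y E"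
    using E sub unfolding connectedin_def connected_space_eq
    by (metis openin_open_subtopology)
  then show thesis using that E by blast
qed

text \<open>A neighbourhood of the fibre of \<open>x\<close> contains a clopen set \<open>C\<close> around the fibre that is a finite union
  of members of \<open>\<C>\<close>, so only finitely many points \<open>E0\<close> of \<open>C\<close> are equivalent to points outside. Their
  images are not interior points of \<open>q ` C\<close> in general, but all other points of \<open>q ` C\<close> are; so a clopen
  part of \<open>q ` C\<close> that avoids \<open>q ` E0\<close> is clopen in \<open>D\<close>. Since \<open>D\<close> is connected, the preceding lemma
  applies to \<open>q ` C\<close>.\<close>
lemma crossing_quotient_locally_connected:
  assumes q: "quotient_map Z D q" and closed: "closed_map Z D q"
    and Z: "compact_space Z" "t1_space Z" and D: "connected_space D" "t1_space D"
    and base: "\<And>z U. \<lbrakk>openin Z U; z \<in> U\<rbrakk> \<Longrightarrow> \<exists>C\<in>\<C>. z \<in> C \<and> C \<subseteq> U"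
    and clopen: "\<And>C. C \<in> \<C> \<Longrightarrow> openin Z C \<and> closedin Z C"
    and crossing: "\<And>C. C \<in> \<C> \<Longrightarrow> finite {z \<in> C. \<exists>z'\<in>topspace Z - C. q z = q z'}"
  shows "locally_connected_space D"
  unfolding locally_connected_space_def neighbourhood_base_of
proof (intro allI impI)
  note cont = quotient_imp_continuous_map[OF q] and surj = quotient_imp_surjective_map[OF q]
  fix W x assume "openin D W \<and> x \<in> W"
  then have W: "openin D W" "x \<in> W" by auto
  then have xD: "x \<in> topspace D" using openin_subset by blast
  let ?f = "{z \<in> topspace Z. q z \<in> {x}}"
  have "closedin D {x}" using D(2) xD by (simp add: t1_space_closedin_singleton)
  then have "closedin Z ?f" by (rule closedin_continuous_map_preimage[OF cont])
  then have cf: "compactin Z ?f" using Z(1) closedin_compact_space by blast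
  have oW: "openin Z {z \<in> topspace Z. q z \<in> W}" by (rule openin_continuous_map_preimage[OF cont W(1)])
  let ?\<U> = "{C \<in> \<C>. C \<subseteq> {z \<in> topspace Z. q z \<in> W}}"
  have "?f \<subseteq> \<Union>?\<U>"
  proof
    fix z assume "z \<in> ?f"
    then have "z \<in> {z \<in> topspace Z. q z \<in> W}" using W(2) by auto
    then show "z \<in> \<Union>?\<U>" using base[OF oW] by blast
  qed
  moreover have "\<forall>U\<in>?\<U>. openin Z U" using clopen by blast
  ultimately obtain \<F> where \<F>: "finite \<F>" "\<F> \<subseteq> ?\<U>" "?f \<subseteq> \<Union>\<F>"
    using cf unfolding compactin_def by meson
  define C where "C = \<Union>\<F>"
  have oC: "openin Z C" using \<F>(2) clopen unfolding C_def by blast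
  have cC: "closedin Z C" using \<F>(1,2) clopen unfolding C_def by (blast intro: closedin_Union)
  have CZ: "C \<subseteq> topspace Z" using oC openin_subset by blast
  define E0 where "E0 = {z \<in> C. \<exists>z'\<in>topspace Z - C. q z = q z'}"
  have "E0 \<subseteq> (\<Union>B\<in>\<F>. {z \<in> B. \<exists>z'\<in>topspace Z - B. q z = q z'})"
    unfolding E0_def C_def by blast
  moreover have "finite (\<Union>B\<in>\<F>. {z \<in> B. \<exists>z'\<in>topspace Z - B. q z = q z'})"
    using \<F>(1,2) crossing by blast
  ultimately have finE: "finite E0" using finite_subset by blast
  have "E0 \<subseteq> topspace Z" using CZ E0_def by blast
  then have "closedin Z E0" using Z(2) finE t1_space_closedin_finite by blast
  then have oO: "openin Z (C - E0)" using oC by blast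
  have "{z \<in> topspace Z. q z \<in> q ` (C - E0)} \<subseteq> C - E0"
  proof
    fix z assume "z \<in> {z \<in> topspace Z. q z \<in> q ` (C - E0)}"
    then obtain y where z: "z \<in> topspace Z" and y: "y \<in> C" "y \<notin> E0" "q z = q y" by auto
    have zC: "z \<in> C"
    proof (rule ccontr)
      assume "z \<notin> C"
      then have "\<exists>z'\<in>topspace Z - C. q y = q z'" using z y(3) by (intro bexI[of _ z]) auto
      then show False using y(1,2) by (simp add: E0_def)
    qed
    moreover have "z \<notin> E0"
    proof
      assume "z \<in> E0"
      then obtain z' where "z' \<in> topspace Z - C" "q z = q z'" using E0_def by auto
      then show False using y E0_def by auto
    qed
    ultimately show "z \<in> C - E0" by blast
  qed
  moreover have "\<forall>U. openin Z U \<and> {x \<in> topspace Z. q x \<in> q ` U} \<subseteq> U \<longrightarrow> openin D (q ` U)"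
    using q unfolding quotient_map_saturated_open by (elim conjE)
  ultimately have oqO: "openin D (q ` (C - E0))" using oO by blast
  have cqC: "closedin D (q ` C)" using closed cC by (simp add: closed_map_def)
  obtain z0 where z0: "z0 \<in> topspace Z" "x = q z0" using surj xD by auto
  have z0C: "z0 \<in> C" using \<F>(3) z0 unfolding C_def by blast
  have "z0 \<notin> E0"
  proof
    assume "z0 \<in> E0"
    then obtain z' where "z' \<in> topspace Z - C" "q z0 = q z'" using E0_def by auto
    then have "z' \<in> ?f" using z0(2) by simp
    then show False using \<F>(3) \<open>z' \<in> topspace Z - C\<close> unfolding C_def by blast
  qed
  then have xO: "x \<in> q ` (C - E0)" using z0 z0C by blast
  let ?Y = "subtopology D (q ` C)"
  have qCD: "q ` C \<subseteq> topspace D" using cqC closedin_subset by blast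
  have topY: "topspace ?Y = q ` C" using qCD by auto
  have meet: "E \<inter> q ` E0 \<noteq> {}" if E: "openin ?Y E" "closedin ?Y E" "E \<noteq> {}" "E \<noteq> topspace ?Y" for E
  proof
    assume d: "E \<inter> q ` E0 = {}"
    have "E \<subseteq> q ` C" using E(1) openin_subset topY by blast
    then have "E \<subseteq> q ` (C - E0)" using d by blast
    moreover obtain T where "openin D T" "E = T \<inter> q ` C" using E(1) by (auto simp: openin_subtopology)
    ultimately have "E = T \<inter> q ` (C - E0)" by blast
    then have "openin D E" using oqO \<open>openin D T\<close> by blast
    moreover have "closedin D E" using closedin_trans_full[OF E(2) cqC] .
    ultimately have "E = topspace D" using D(1) E(3) by (auto simp: connected_space_clopen_in)
    then show False using E(4) \<open>E \<subseteq> q ` C\<close> qCD topY by blast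
  qed
  have "finite (q ` E0)" using finE by blast
  moreover have "x \<in> topspace ?Y" using xO topY by blast
  ultimately obtain E where E: "openin ?Y E" "closedin ?Y E" "x \<in> E" "connectedin ?Y E"
    using meet by (rule connected_clopen_of_finite_meeting)
  obtain T where T: "openin D T" "E = T \<inter> q ` C" using E(1) by (auto simp: openin_subtopology)
  have "openin D (T \<inter> q ` (C - E0))" using T(1) oqO by blast
  moreover have "x \<in> T \<inter> q ` (C - E0)" using E(3) T(2) xO by blast
  moreover have "T \<inter> q ` (C - E0) \<subseteq> E" using T(2) by blast
  moreover have "connectedin D E" using E(4) connectedin_subtopology by blast
  moreover have "E \<subseteq> W"
  proof -
    have "q ` C \<subseteq> W" using \<F>(2) unfolding C_def by blast
    then show ?thesis using T(2) by blast
  qed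
  ultimately show "\<exists>U V. openin D U \<and> connectedin D V \<and> x \<in> U \<and> U \<subseteq> V \<and> V \<subseteq> W" by blast
qed

section \<open>Cuts of a side of a cut pair\<close>

locale space_without_cut_points =
  fixes D :: "'p topology"
  assumes T1: "t1_space D"
    and no_cut_points: "\<nexists>x. cut_point D x"
begin

text \<open>The set \<open>K - {s}\<close> is clopen in the complement of \<open>s\<close>, which is connected.\<close>
lemma pinched_at_point_trivial:
  assumes K: "openin D K" "closedin D (insert s K)"
  shows "K \<subseteq> {s} \<or> topspace D \<subseteq> insert s K"
proof -
  have s: "s \<in> topspace D" using closedin_subset[OF K(2)] by blast
  let ?Y = "subtopology D (topspace D - {s})"
  have KX: "K \<subseteq> topspace D" using K(1) openin_subset by blast
  have con: "connected_space ?Y" using no_cut_points s by (auto simp: cut_point_def)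
  have "openin ?Y (K - {s})"
    unfolding openin_subtopology using K(1) KX by (intro exI[of _ K]) auto
  moreover have "closedin ?Y (K - {s})"
    unfolding closedin_subtopology using K(2) KX by (intro exI[of _ "insert s K"]) auto
  ultimately have "K - {s} = {} \<or> K - {s} = topspace ?Y"
    using con by (auto simp: connected_space_clopen_in)
  then show ?thesis by auto
qed

end

text \<open>The sets \<open>A\<close> and \<open>B\<close> arise from a separation of the complement of \<open>{a, b}\<close> by adding \<open>a\<close> and \<open>b\<close> to both
  halves. The roles of \<open>a\<close> and \<open>b\<close>, and those of \<open>A\<close> and \<open>B\<close>, can be exchanged.\<close>
locale two_sides = space_without_cut_points +
  fixes A B :: "'p set" and a b :: 'p
  assumes closedA: "closedin D A" and closedB: "closedin D B"
    and cover: "A \<union> B = topspace D" and meet: "A \<inter> B = {a, b}"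
    and ab: "a \<noteq> b" and neA: "A \<noteq> {a, b}" and neB: "B \<noteq> {a, b}"
begin

lemma swap_ends: "two_sides D A B b a"
  using closedA closedB cover meet ab neA neB by unfold_locales auto

lemma swap_sides: "two_sides D B A a b"
  using closedA closedB cover meet ab neA neB by unfold_locales auto

lemma ends_in: "a \<in> A" "b \<in> A" "a \<in> B" "b \<in> B" using meet by blast+

lemma closed_singleton: "x \<in> topspace D \<Longrightarrow> closedin D {x}"
  using T1 by (simp add: t1_space_closedin_singleton)

lemma AX: "A \<subseteq> topspace D" using cover by blast

text \<open>As \<open>B\<close> meets \<open>A\<close> only in \<open>a\<close> and \<open>b\<close>, a part of \<open>A - {a, b}\<close> that is attached to the rest of \<open>A\<close> only at
  \<open>s\<close> is attached to the rest of the space only at \<open>s\<close>.\<close>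
lemma inner_clopen_trivial:
  assumes K: "K \<subseteq> A - {a, b}" "closedin D (A - K)" "closedin D (insert s K)"
  shows "K \<subseteq> {s}"
proof -
  have "topspace D - (B \<union> (A - K)) = K" using K(1) cover meet by blast
  then have "openin D K" using closedB K(2) by (metis closedin_Un openin_diff openin_topspace)
  moreover have "\<not> topspace D \<subseteq> insert s K" using K(1) ab ends_in AX by blast
  ultimately show ?thesis using pinched_at_point_trivial K(3) by blast
qed

text \<open>If both ends are in \<open>E1\<close>, then \<open>E2\<close> is an inner clopen set. If \<open>b\<close> is in \<open>E2\<close>, then \<open>E1 - {a}\<close> and
  \<open>E2 - {b}\<close> are inner clopen sets, and \<open>A\<close> would consist of the two ends only.\<close>
lemma side_connected_aux:
  assumes E: "closedin D E1" "closedin D E2" "E1 \<union> E2 = A" "E1 \<inter> E2 = {}" "a \<in> E1"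
  shows "E2 = {}"
proof -
  interpret sw: two_sides D A B b a by (rule swap_ends)
  show ?thesis
  proof (cases "b \<in> E1")
    case True
    have aX: "a \<in> topspace D" using ends_in AX by blast
    have "E2 \<subseteq> {a}"
    proof (rule inner_clopen_trivial)
      show "E2 \<subseteq> A - {a, b}" using E True by blast
      have "A - E2 = E1" using E by blast
      then show "closedin D (A - E2)" using E by simp
      have "closedin D ({a} \<union> E2)" using closed_singleton[OF aX] E(2) by (rule closedin_Un)
      then show "closedin D (insert a E2)" by simp
    qed
    then show ?thesis using E by blast
  next
    case False
    then have b: "b \<in> E2" using E ends_in by blast
    have "E1 - {a} \<subseteq> {a}"
    proof (rule inner_clopen_trivial)
      show "E1 - {a} \<subseteq> A - {a, b}" using E False by blast
      have "A - (E1 - {a}) = {a} \<union> E2" using E ends_in by blast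
      then show "closedin D (A - (E1 - {a}))"
        using closed_singleton[of a] AX ends_in E(2) by (metis closedin_Un subsetD)
      show "closedin D (insert a (E1 - {a}))" using E(1,5) by (simp add: insert_absorb)
    qed
    moreover have "E2 - {b} \<subseteq> {b}"
    proof (rule inner_clopen_trivial)
      show "E2 - {b} \<subseteq> A - {a, b}" using E by blast
      have "A - (E2 - {b}) = {b} \<union> E1" using E ends_in by blast
      then show "closedin D (A - (E2 - {b}))"
        using closed_singleton[of b] AX ends_in E(1) by (metis closedin_Un subsetD)
      show "closedin D (insert b (E2 - {b}))" using E(2) b by (simp add: insert_absorb)
    qed
    ultimately have "A = {a, b}" using E ends_in by blast
    then show ?thesis using neA by blast
  qed
qed

lemma side_connected:
  assumes E: "closedin D E1" "closedin D E2" "E1 \<union> E2 = A" "E1 \<inter> E2 = {}"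
  shows "E1 = {} \<or> E2 = {}"
proof -
  have "a \<in> E1 \<or> a \<in> E2" using E(3) ends_in by blast
  then show ?thesis
    using side_connected_aux[OF E] side_connected_aux[OF E(2,1)] E(3,4) by (auto simp: Un_commute Int_commute)
qed

lemma connectedin_side: "connectedin D A"
  unfolding connectedin_closedin
proof (intro conjI AX notI)
  assume "\<exists>E1 E2. closedin D E1 \<and> closedin D E2 \<and> A \<subseteq> E1 \<union> E2 \<and> E1 \<inter> E2 \<inter> A = {} \<and> E1 \<inter> A \<noteq> {} \<and> E2 \<inter> A \<noteq> {}"
  then obtain E1 E2 where E: "closedin D E1" "closedin D E2" "A \<subseteq> E1 \<union> E2" "E1 \<inter> E2 \<inter> A = {}"
    "E1 \<inter> A \<noteq> {}" "E2 \<inter> A \<noteq> {}" by blast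
  have "closedin D (E1 \<inter> A)" "closedin D (E2 \<inter> A)" using E(1,2) closedA by (auto intro: closedin_Int)
  moreover have "(E1 \<inter> A) \<union> (E2 \<inter> A) = A" "(E1 \<inter> A) \<inter> (E2 \<inter> A) = {}" using E(3,4) by blast+
  ultimately show False using side_connected[of "E1 \<inter> A" "E2 \<inter> A"] E(5,6) by blast
qed

end

text \<open>For \<open>s\<close> different from \<open>a\<close> and \<open>b\<close> this says that \<open>s\<close> separates \<open>a\<close> from \<open>b\<close> in \<open>A\<close>; the point \<open>s\<close>
  belongs to both parts so that they are closed. In this form the ends are cuts too, with a one-point
  part, and need no separate treatment.\<close>
definition cuts_between :: "'p topology \<Rightarrow> 'p set \<Rightarrow> 'p \<Rightarrow> 'p \<Rightarrow> 'p \<Rightarrow> 'p set \<Rightarrow> 'p set \<Rightarrow> bool" where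
  "cuts_between D A a b s P Q \<longleftrightarrow> closedin D P \<and> closedin D Q \<and> P \<union> Q = A \<and> P \<inter> Q = {s} \<and> a \<in> P \<and> b \<in> Q"

lemma cuts_between_swap: "cuts_between D A a b s P Q \<longleftrightarrow> cuts_between D A b a s Q P"
  by (auto simp: cuts_between_def)

lemma cuts_betweenD:
  assumes "cuts_between D A a b s P Q"
  shows "closedin D P" "closedin D Q" "P \<union> Q = A" "P \<inter> Q = {s}" "a \<in> P" "b \<in> Q" "s \<in> P" "s \<in> Q" "s \<in> A"
    "\<And>z. \<lbrakk>z \<in> P; z \<in> Q\<rbrakk> \<Longrightarrow> z = s" "Q = insert s (A - P)" "P = insert s (A - Q)"
  using assms by (auto simp: cuts_between_def)

context two_sides
begin

abbreviation cut where "cut \<equiv> cuts_between D A a b"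

lemma cut_first: "cut a {a} A"
  using closed_singleton closedA ends_in AX by (auto simp: cuts_between_def)

lemma cut_last: "cut b A {b}"
  using closed_singleton closedA ends_in AX by (auto simp: cuts_between_def)

text \<open>The set \<open>P \<inter> Q'\<close> of points before \<open>s\<close> and after \<open>t\<close> is attached to the rest of \<open>A\<close> at most at \<open>s\<close>, since
  \<open>t\<close> is not in \<open>P\<close>. So it contains at most \<open>s\<close>, and it does not contain \<open>s\<close> because otherwise \<open>s\<close> would be
  the only point of \<open>P\<close> outside \<open>P'\<close>, and \<open>A\<close> would be disconnected.\<close>
lemma cut_less:
  assumes s: "cut s P Q" and t: "cut t P' Q'" and st: "s \<noteq> t" "t \<in> Q"
  shows "P \<subseteq> P' - {t}" "Q' \<subseteq> Q - {s}"
proof -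
  note s = cuts_betweenD[OF s] and t = cuts_betweenD[OF t]
  have tP: "t \<notin> P" using s(10) st by blast
  have K: "P \<inter> Q' - {s} \<subseteq> {s}"
  proof (rule inner_clopen_trivial)
    have "a \<notin> Q'" using t(5) t(10)[of a] s(5) tP by auto
    moreover have "b \<notin> P - {s}" using s(6,10) by blast
    ultimately show "P \<inter> Q' - {s} \<subseteq> A - {a, b}" using s(3) by blast
    have "A - (P \<inter> Q' - {s}) = insert s (A - P) \<union> insert t (A - Q')"
      using s(9) t(9) tP by auto
    then have "A - (P \<inter> Q' - {s}) = Q \<union> P'" using s(11) t(12) by simp
    then show "closedin D (A - (P \<inter> Q' - {s}))" using s(2) t(1) closedin_Un by metis
    show "closedin D (insert s (P \<inter> Q' - {s}))"
    proof (cases "s \<in> Q'")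
      case True
      then have "insert s (P \<inter> Q' - {s}) = P \<inter> Q'" using s(7) by blast
      then show ?thesis using s(1) t(2) closedin_Int by metis
    next
      case False
      then have "insert s (P \<inter> Q' - {s}) = {s} \<union> (P \<inter> Q')" by blast
      moreover have "closedin D {s}" using closed_singleton s(9) AX by blast
      ultimately show ?thesis using s(1) t(2) closedin_Int closedin_Un by metis
    qed
  qed
  have "s \<notin> Q'"
  proof
    assume sQ: "s \<in> Q'"
    have "closedin D (P \<inter> P')" using s(1) t(1) by (rule closedin_Int)
    moreover have "closedin D (Q \<union> Q')" using s(2) t(2) by (rule closedin_Un)
    moreover have "P \<inter> P' \<union> (Q \<union> Q') = A" using s(3) t(3) by auto
    moreover have "s \<notin> P'" using sQ t(10)[of s] st by blast
    then have "P \<inter> P' \<inter> (Q \<union> Q') = {}"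
      by (subst s(11), subst t(11)) (use tP in auto)
    moreover have "a \<in> P \<inter> P'" "b \<in> Q \<union> Q'" using s(5,6) t(5) by auto
    ultimately show False using side_connected[of "P \<inter> P'" "Q \<union> Q'"] by blast
  qed
  then have "P \<inter> Q' = {}" using K by blast
  then show "P \<subseteq> P' - {t}" "Q' \<subseteq> Q - {s}" using s(3) t(3) tP \<open>s \<notin> Q'\<close> by blast+
qed

lemma cut_greater:
  assumes "cut s P Q" "cut t P' Q'" "s \<noteq> t" "t \<in> P"
  shows "Q \<subseteq> Q' - {t}" "P' \<subseteq> P - {s}"
proof -
  interpret sw: two_sides D A B b a by (rule swap_ends)
  show "Q \<subseteq> Q' - {t}" "P' \<subseteq> P - {s}"
    using sw.cut_less assms cuts_between_swap by metis+
qed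

lemma cut_unique:
  assumes s: "cut s P Q" and t: "cut s P' Q'"
  shows "P \<subseteq> P'" "Q \<subseteq> Q'"
proof -
  have *: "P \<subseteq> P'" if s: "cut s P Q" and t: "cut s P' Q'" for P Q P' Q'
  proof -
    note s = cuts_betweenD[OF s] and t = cuts_betweenD[OF t]
    have "P \<inter> Q' - {s} \<subseteq> {s}"
    proof (rule inner_clopen_trivial)
      have "a \<notin> Q' - {s}" using t(5,10) by auto
      moreover have "b \<notin> P - {s}" using s(6,10) by auto
      ultimately show "P \<inter> Q' - {s} \<subseteq> A - {a, b}" using s(3) by blast
      have "A - (P \<inter> Q' - {s}) = insert s (A - P) \<union> insert s (A - Q')"
        using s(9) by auto
      then have "A - (P \<inter> Q' - {s}) = Q \<union> P'" using s(11) t(12) by simp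
      then show "closedin D (A - (P \<inter> Q' - {s}))" using s(2) t(1) closedin_Un by metis
      have "insert s (P \<inter> Q' - {s}) = P \<inter> Q'" using s(7) t(8) by blast
      then show "closedin D (insert s (P \<inter> Q' - {s}))" using s(1) t(2) closedin_Int by metis
    qed
    moreover have "P \<subseteq> P' \<union> Q'" using s(3) t(3) by auto
    ultimately show "P \<subseteq> P'" using t(7) by blast
  qed
  show "P \<subseteq> P'" using *[OF s t] .
  have "P' \<subseteq> P" using *[OF t s] .
  then have "insert s (A - P) \<subseteq> insert s (A - P')" by blast
  then show "Q \<subseteq> Q'" using cuts_betweenD(11)[OF s] cuts_betweenD(11)[OF t] by simp
qed

text \<open>The part \<open>P\<close> touches the rest of the space only in \<open>s\<close> and \<open>a\<close>.\<close>
lemma connected_through_cut: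
  assumes N: "connectedin D N" and s: "cut s P Q" and m: "N \<inter> P \<noteq> {}" "\<not> N \<subseteq> P" and a: "a \<notin> N"
  shows "s \<in> N"
proof (rule ccontr)
  note s = cuts_betweenD[OF s]
  assume "s \<notin> N"
  then have "P \<inter> Q \<inter> N = {}" using s(4) by simp
  moreover have "P \<inter> B \<inter> N = {}"
  proof -
    have "P \<inter> B \<subseteq> {a, b}" using s(3) meet by blast
    moreover have "b \<in> P \<Longrightarrow> b = s" using s(6,10) by blast
    ultimately show ?thesis using \<open>s \<notin> N\<close> a by auto
  qed
  ultimately have "P \<inter> (Q \<union> B) \<inter> N = {}" by blast
  moreover have "N \<subseteq> P \<union> (Q \<union> B)"
    using connectedin_subset_topspace[OF N] s(3) cover by blast
  moreover have "closedin D (Q \<union> B)" using s(2) closedB by (rule closedin_Un)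
  moreover have "(Q \<union> B) \<inter> N \<noteq> {}" using calculation(2) m(2) by blast
  moreover have "P \<inter> N \<noteq> {}" using m by blast
  ultimately show False using N s(1) unfolding connectedin_closedin by blast
qed

text \<open>The first parts of the cuts before \<open>x\<close> form a chain. If it has no largest member, then its union
  \<open>U\<close> is open in the connected set \<open>A\<close>, so \<open>U\<close> has a limit point outside. There is only one: disjoint
  connected neighbourhoods of two of them would both contain the cut points of all late members of
  the chain. So closing \<open>U\<close> adds a single point, which is the last cut.\<close>
lemma last_cut_before:
  assumes haus: "Hausdorff_space D" and lc: "locally_connected_space D"
    and x: "x \<in> A" and nocut: "\<nexists>P Q. cut x P Q"
  obtains u P Q where "cut u P Q" "x \<in> Q" "\<And>s P' Q'. \<lbrakk>cut s P' Q'; x \<in> Q'\<rbrakk> \<Longrightarrow> P' \<subseteq> P"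
proof (cases "\<exists>u P Q. cut u P Q \<and> x \<in> Q \<and> (\<forall>s P' Q'. cut s P' Q' \<longrightarrow> x \<in> Q' \<longrightarrow> P' \<subseteq> P)")
  case True
  then show thesis using that by blast
next
  case nomax: False
  define I where "I = {(s, P, Q). cut s P Q \<and> x \<in> Q}"
  define U where "U = (\<Union>(s, P, Q)\<in>I. P)"
  have Id: "(s, P, Q) \<in> I \<longleftrightarrow> cut s P Q \<and> x \<in> Q" for s P Q by (simp add: I_def)
  have linear: "P \<subseteq> P' - {t} \<or> P' \<subseteq> P" if "(s, P, Q) \<in> I" "(t, P', Q') \<in> I" for s t P P' Q Q'
  proof -
    have c: "cut s P Q" "cut t P' Q'" using that Id by auto
    show ?thesis
    proof (cases "s = t")
      case True
      then show ?thesis using cut_unique(1)[of t P' Q' P Q] c by simp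
    next
      case False
      have "t \<in> P \<or> t \<in> Q" using cuts_betweenD(3)[OF c(1)] cuts_betweenD(9)[OF c(2)] by auto
      then show ?thesis using cut_less(1)[OF c False] cut_greater(2)[OF c False] by auto
    qed
  qed
  have step: "\<exists>t P' Q'. (t, P', Q') \<in> I \<and> P \<subseteq> P' - {t}" if "(s, P, Q) \<in> I" for s P Q
  proof -
    have "cut s P Q" "x \<in> Q" using that Id by auto
    then obtain t P' Q' where t: "cut t P' Q'" "x \<in> Q'" "\<not> P' \<subseteq> P" using nomax by meson
    then have "(t, P', Q') \<in> I" using Id by simp
    then show ?thesis using linear[OF that] t(3) by meson
  qed
  have I0: "(a, {a}, A) \<in> I" using cut_first x Id by simp
  have aU: "a \<in> U" using I0 unfolding U_def by blast
  have IA: "P \<union> Q = A" if "(s, P, Q) \<in> I" for s P Q using that Id cuts_betweenD(3) by meson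
  have UA: "U \<subseteq> A" unfolding U_def using IA by blast
  have xU: "x \<notin> U"
  proof
    assume "x \<in> U"
    then obtain s P Q where "cut s P Q" "x \<in> Q" "x \<in> P" unfolding U_def using Id by auto
    then have "x = s" using cuts_betweenD(10) by meson
    then show False using nocut \<open>cut s P Q\<close> by blast
  qed
  \<comment> \<open>No cut is the last one, so each cut point lies in a later first part and no point is in all second parts and in the union.\<close>
  have compl: "A - U = (\<Inter>(s, P, Q)\<in>I. Q)"
  proof
    show "A - U \<subseteq> (\<Inter>(s, P, Q)\<in>I. Q)" unfolding U_def using IA by blast
    show "(\<Inter>(s, P, Q)\<in>I. Q) \<subseteq> A - U"
    proof
      fix y assume y: "y \<in> (\<Inter>(s, P, Q)\<in>I. Q)"
      then have "y \<in> A" using I0 by blast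
      moreover have "y \<notin> U"
      proof
        assume "y \<in> U"
        then obtain s P Q where s: "(s, P, Q) \<in> I" "y \<in> P" unfolding U_def by blast
        then obtain t P' Q' where t: "(t, P', Q') \<in> I" "P \<subseteq> P' - {t}" using step by blast
        then have "y \<in> Q'" "y \<in> P' - {t}" using y s by blast+
        moreover have "cut t P' Q'" using t(1) Id by simp
        ultimately show False using cuts_betweenD(10)[of D A a b t P' Q' y] by blast
      qed
      ultimately show "y \<in> A - U" by blast
    qed
  qed
  have "closedin D Q" if "(s, P, Q) \<in> I" for s P Q using that Id cuts_betweenD(2) by meson
  then have clAU: "closedin D (A - U)"
    unfolding compl using I0 by (intro closedin_Inter) auto
  have clsub: "D closure_of U \<subseteq> A" using UA closedA closure_of_minimal by blast
  have "\<not> closedin D U"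
  proof
    assume "closedin D U"
    then have "U = {} \<or> A - U = {}" using side_connected[of U "A - U"] clAU UA by blast
    then show False using aU xU x by blast
  qed
  then obtain u where u: "u \<in> D closure_of U" "u \<notin> U"
    using closure_of_subset_eq[of U D] UA AX by blast
  \<comment> \<open>A neighbourhood of a limit point of the union contains all cut points from some stage on.\<close>
  have catch: "\<exists>P0 s0 Q0. (s0, P0, Q0) \<in> I \<and> (\<forall>s P Q. (s, P, Q) \<in> I \<longrightarrow> P0 \<subseteq> P \<longrightarrow> s \<in> V)"
    if w: "w \<in> D closure_of U" "w \<notin> U" and V: "openin D V" "w \<in> V" for w V
  proof -
    have "closedin D {a}" using closed_singleton[of a] ends_in(1) AX by blast
    then have "openin D (V - {a})" using V(1) by (rule openin_diff[rotated])
    moreover have "w \<in> V - {a}" using V w aU by blast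
    ultimately obtain N O' where N: "openin D O'" "connectedin D N" "w \<in> O'" "O' \<subseteq> N" "N \<subseteq> V - {a}"
      using lc unfolding locally_connected_space_def neighbourhood_base_of by meson
    then have "O' \<inter> U \<noteq> {}" using w(1) by (auto simp: in_closure_of)
    then obtain s0 P0 Q0 where s0: "(s0, P0, Q0) \<in> I" "O' \<inter> P0 \<noteq> {}" unfolding U_def by blast
    have "s \<in> V" if s: "(s, P, Q) \<in> I" "P0 \<subseteq> P" for s P Q
    proof -
      have "w \<notin> P" using w(2) s(1) unfolding U_def by blast
      have "cut s P Q" using s(1) Id by simp
      moreover have "N \<inter> P \<noteq> {}" using s0(2) s(2) N(4) by blast
      moreover have "\<not> N \<subseteq> P" using \<open>w \<notin> P\<close> N(3,4) by blast
      moreover have "a \<notin> N" using N(5) by blast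
      ultimately have "s \<in> N" using connected_through_cut[OF N(2)] by blast
      then show ?thesis using N(5) by blast
    qed
    then show ?thesis using s0(1) by blast
  qed
  have uniq: "w = u" if w: "w \<in> D closure_of U" "w \<notin> U" for w
  proof (rule ccontr)
    assume "w \<noteq> u"
    moreover have "w \<in> topspace D" "u \<in> topspace D" using w u clsub AX by blast+
    ultimately obtain V V' where V: "openin D V" "openin D V'" "w \<in> V" "u \<in> V'" "V \<inter> V' = {}"
      using haus unfolding Hausdorff_space_def disjnt_def by metis
    obtain s P Q where s: "(s, P, Q) \<in> I" "\<forall>t P' Q'. (t, P', Q') \<in> I \<longrightarrow> P \<subseteq> P' \<longrightarrow> t \<in> V"
      using catch[OF w V(1,3)] by metis
    obtain s' P' Q' where s': "(s', P', Q') \<in> I" "\<forall>t P Q. (t, P, Q) \<in> I \<longrightarrow> P' \<subseteq> P \<longrightarrow> t \<in> V'"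
      using catch[OF u V(2,4)] by metis
    have "P \<subseteq> P' \<or> P' \<subseteq> P" using linear[OF s(1) s'(1)] by blast
    moreover have "s \<in> V" using s(2)[rule_format, OF s(1)] by simp
    moreover have "s' \<in> V'" using s'(2)[rule_format, OF s'(1)] by simp
    moreover have "s' \<in> V" if "P \<subseteq> P'" using s(2)[rule_format, OF s'(1) that] .
    moreover have "s \<in> V'" if "P' \<subseteq> P" using s'(2)[rule_format, OF s(1) that] .
    ultimately have "s \<in> V \<inter> V' \<or> s' \<in> V \<inter> V'" by blast
    then show False using V(5) by blast
  qed
  have "U \<subseteq> D closure_of U" using UA AX closure_of_subset by (metis subset_trans)
  then have "D closure_of U = insert u U" using uniq u by blast
  then have "closedin D (insert u U)" by (metis closedin_closure_of)
  moreover have "b \<notin> U"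
  proof
    assume "b \<in> U"
    then obtain s P Q where s: "cut s P Q" "x \<in> Q" "b \<in> P" unfolding U_def using Id by auto
    then have "s = b" using cuts_betweenD(6,10)[OF s(1)] by blast
    then have "Q \<subseteq> {b}" using cut_unique(2)[OF _ cut_last] s(1) by simp
    then have "x = b" using s(2) by blast
    then show False using nocut cut_last by blast
  qed
  ultimately have "cut u (insert u U) (A - U)"
    using clAU aU UA u clsub ends_in by (auto simp: cuts_between_def)
  moreover have "x \<in> A - U" using x xU by blast
  moreover have "P' \<subseteq> insert u U" if "cut s P' Q'" "x \<in> Q'" for s P' Q'
  proof -
    have "(s, P', Q') \<in> I" using that Id by simp
    then show ?thesis unfolding U_def by blast
  qed
  ultimately show thesis using that by meson
qed

end

section \<open>Crossed cut pairs\<close>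

context space_without_cut_points
begin

text \<open>If \<open>u\<close> and \<open>v\<close> were both in \<open>M\<close>, then the part of \<open>N\<close> in \<open>G\<close> would be attached to the rest only at \<open>c\<close>,
  and the part of \<open>N\<close> outside only at \<open>d\<close>. Without cut points both parts are empty.\<close>
lemma crossing_separates_ends:
  assumes G: "openin D G" "closedin D (G \<union> {u, v})" "u \<notin> G" "v \<notin> G"
    and c: "c \<in> G" and d: "d \<in> topspace D" "d \<notin> G \<union> {u, v}"
    and MN: "openin D M" "openin D N" "M \<union> N = topspace D - {c, d}" "M \<inter> N = {}" "N \<noteq> {}"
    and uv: "u \<in> M" "v \<in> M"
  shows False
proof -
  have cX: "c \<in> topspace D" using c G(1) openin_subset by blast
  have cl: "closedin D (topspace D - M)" using MN(1) by blast
  have XM: "topspace D - M = N \<union> {c, d}" using MN(3,4) cX d(1) by blast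
  have ne: "u \<noteq> c" "u \<noteq> d" "v \<noteq> c" "v \<noteq> d" "c \<noteq> d" using G(3,4) c d by auto
  have uN: "u \<notin> N" "v \<notin> N" using MN(4) uv by auto
  have uX: "u \<in> topspace D" using uv(1) MN(1) openin_subset by blast
  have "openin D (N \<inter> G)" using MN(2) G(1) by blast
  moreover have "insert c (N \<inter> G) = (N \<union> {c, d}) \<inter> (G \<union> {u, v})"
    using uN ne c d(2) by auto
  then have "closedin D (insert c (N \<inter> G))" using cl G(2) XM by (metis closedin_Int)
  ultimately have "N \<inter> G \<subseteq> {c}" using pinched_at_point_trivial uX uN ne by blast
  then have 1: "N \<inter> G = {}" using MN(3) by blast
  have "openin D (topspace D - (G \<union> {u, v}))" using G(2) by blast
  then have "openin D (N \<inter> (topspace D - (G \<union> {u, v})))" using MN(2) by blast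
  moreover have "N \<inter> (topspace D - (G \<union> {u, v})) = N" using 1 uN MN(3) by blast
  ultimately have "openin D N" by simp
  moreover have "closedin D ((N \<union> {c, d}) \<inter> (topspace D - G))" using cl G(1) XM by (metis closedin_Int openin_closedin_eq)
  moreover have "insert d N = (N \<union> {c, d}) \<inter> (topspace D - G)" using 1 c d MN(3) by blast
  ultimately have "closedin D (insert d N)" by argo
  then have "N \<subseteq> {d}" using pinched_at_point_trivial[OF MN(2)] uX uN ne by blast
  then show False using MN(3,5) by blast
qed

lemma cut_pair_separation:
  assumes "cut_pair D P"
  obtains x0 x1 M N where "P = {x0, x1}" "x0 \<noteq> x1" "x0 \<in> topspace D" "x1 \<in> topspace D"
    "openin D M" "openin D N" "M \<union> N = topspace D - {x0, x1}" "M \<inter> N = {}" "M \<noteq> {}" "N \<noteq> {}"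
proof -
  obtain x0 x1 where x: "P = {x0, x1}" "x0 \<noteq> x1" "x0 \<in> topspace D" "x1 \<in> topspace D"
      "\<not> connected_space (subtopology D (topspace D - {x0, x1}))"
    using assms unfolding cut_pair_def by blast
  have o: "openin D (topspace D - {x0, x1})"
    using T1 x(3,4) t1_space_closedin_finite[of D] by (intro openin_diff) auto
  have tY: "topspace (subtopology D (topspace D - {x0, x1})) = topspace D - {x0, x1}" by auto
  obtain M N where "openin D M" "openin D N" "M \<union> N = topspace D - {x0, x1}" "M \<inter> N = {}" "M \<noteq> {}" "N \<noteq> {}"
    using x(5) unfolding connected_space_eq tY openin_open_subtopology[OF o] by blast
  then show thesis using that x by blast
qed

text \<open>Let the crossing pair be \<open>{y0, y1}\<close>, with \<open>y0\<close> in the component \<open>C0\<close> and \<open>y1\<close> outside. By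
  \<open>crossing_separates_ends\<close>, applied to \<open>C0\<close>, the pair separates \<open>u\<close> from \<open>v\<close>. The set \<open>G\<close> need not be
  related to \<open>C0\<close>. But \<open>G \<union> {u, v}\<close> and the complement of \<open>G\<close> are connected and contain \<open>u\<close> and \<open>v\<close>, so
  each of them contains a point of the pair.\<close>
lemma crossing_cut_pair:
  assumes lc: "locally_connected_space D"
    and Q: "cut_pair D Q" "crosses D Q {u, v}" and uvX: "u \<in> topspace D" "v \<in> topspace D" "u \<noteq> v"
    and G: "openin D G" "closedin D (G \<union> {u, v})" "u \<notin> G" "v \<notin> G" "G \<noteq> {}" "topspace D - G \<noteq> {u, v}"
  obtains c d M N where "c \<in> G" "d \<in> topspace D" "d \<notin> G \<union> {u, v}"
    "openin D M" "openin D N" "M \<union> N = topspace D - {c, d}" "M \<inter> N = {}" "u \<in> M" "v \<in> N"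
proof -
  let ?Y = "subtopology D (topspace D - {u, v})"
  obtain x0 x1 M N where MN: "Q = {x0, x1}" "x0 \<noteq> x1" "x0 \<in> topspace D" "x1 \<in> topspace D"
    "openin D M" "openin D N" "M \<union> N = topspace D - {x0, x1}" "M \<inter> N = {}" "M \<noteq> {}" "N \<noteq> {}"
    using cut_pair_separation[OF Q(1)] by metis
  obtain y0 y1 C0 C1 where y: "Q = {y0, y1}" and C: "C0 \<in> connected_components_of ?Y"
      "C1 \<in> connected_components_of ?Y" "C0 \<noteq> C1" "y0 \<in> C0" "y1 \<in> C1"
    using Q(2) unfolding crosses_def by blast
  have y01: "{x0, x1} = {y0, y1}" using y MN(1) by simp
  \<comment> \<open>By local connectedness a component and the union of the other components are both open.\<close>
  have Co: "openin D C0" "closedin D (C0 \<union> {u, v})" "C0 \<subseteq> topspace D - {u, v}"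
  proof -
    have o: "openin D (topspace D - {u, v})"
      using T1 uvX t1_space_closedin_finite[of D] by (intro openin_diff) auto
    then have lY: "locally_connected_space ?Y" using lc locally_connected_space_open_subset by blast
    then have oY: "openin ?Y C" if "C \<in> connected_components_of ?Y" for C
      using that openin_connected_components_of_locally_connected_space by blast
    then show "openin D C0" using C(1) o openin_open_subtopology by blast
    have tY: "topspace ?Y = topspace D - {u, v}" by auto
    show sub: "C0 \<subseteq> topspace D - {u, v}" using connected_components_of_subset[OF C(1)] tY by simp
    have "openin ?Y (\<Union>(connected_components_of ?Y - {C0}))" using oY by blast
    then have "openin D (\<Union>(connected_components_of ?Y - {C0}))" using o openin_open_subtopology by blast
    moreover have "\<Union>(connected_components_of ?Y - {C0}) = topspace D - (C0 \<union> {u, v})"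
    proof -
      have "\<Union>(connected_components_of ?Y) = topspace D - {u, v}" using Union_connected_components_of tY by metis
      moreover have "C \<inter> C0 = {}" if "C \<in> connected_components_of ?Y" "C \<noteq> C0" for C
        using that C(1) pairwise_disjoint_connected_components_of[of ?Y]
        by (auto simp: pairwise_def disjnt_def)
      then have "\<Union>(connected_components_of ?Y - {C0}) = \<Union>(connected_components_of ?Y) - C0"
        using C(1) by blast
      ultimately show ?thesis by auto
    qed
    ultimately have "openin D (topspace D - (C0 \<union> {u, v}))" by simp
    then show "closedin D (C0 \<union> {u, v})" using sub uvX by (auto simp: closedin_def)
  qed
  have C1: "C1 \<subseteq> topspace D - {u, v}" using connected_components_of_subset[OF C(2)] by auto
  have y1C: "y1 \<notin> C0 \<union> {u, v}"
  proof -
    have "C0 \<inter> C1 = {}" using C pairwise_disjoint_connected_components_of[of ?Y]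
      by (auto simp: pairwise_def disjnt_def)
    then show ?thesis using C(5) C1 by blast
  qed
  have y1X: "y1 \<in> topspace D" using C(5) C1 by blast
  have MNy: "M \<union> N = topspace D - {y0, y1}" using MN(7) y01 by simp
  have "u \<in> M \<union> N" "v \<in> M \<union> N" using uvX MNy C(4) Co(3) y1C by blast+
  moreover have "u \<notin> C0" "v \<notin> C0" using Co(3) by auto
  note cross = crossing_separates_ends[OF Co(1,2) this C(4) y1X y1C]
  have "\<not> (u \<in> M \<and> v \<in> M)" using cross[OF MN(5,6) MNy MN(8,10)] by blast
  moreover have "\<not> (u \<in> N \<and> v \<in> N)"
  proof -
    have "N \<union> M = topspace D - {y0, y1}" "N \<inter> M = {}" using MNy MN(8) by auto
    then show ?thesis using cross[OF MN(6,5) _ _ MN(9)] by blast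
  qed
  ultimately have "\<exists>M N. openin D M \<and> openin D N \<and> M \<union> N = topspace D - {y0, y1} \<and> M \<inter> N = {} \<and> u \<in> M \<and> v \<in> N"
    using MN(5,6,8) MNy by (metis Int_commute Un_commute UnE)
  then obtain M N where S: "openin D M" "openin D N" "M \<union> N = topspace D - {y0, y1}" "M \<inter> N = {}" "u \<in> M" "v \<in> N"
    by blast
  have GX: "G \<subseteq> topspace D" using G(1) openin_subset by blast
  have conn: "A \<inter> {y0, y1} \<noteq> {}"
    if A: "two_sides D A B u v" for A B
  proof
    assume e: "A \<inter> {y0, y1} = {}"
    interpret A: two_sides D A B u v by (rule A)
    have "A \<subseteq> M \<union> N" using A.AX e S(3) by blast
    then have "M \<inter> A = {} \<or> N \<inter> A = {}"
      using A.connectedin_side S(1,2,4) unfolding connectedin by blast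
    then show False using S(5,6) A.ends_in by blast
  qed
  have ts: "two_sides D (G \<union> {u, v}) (topspace D - G) u v"
  proof unfold_locales
    show "closedin D (topspace D - G)" using G(1) by blast
    show "G \<union> {u, v} \<union> (topspace D - G) = topspace D" using GX uvX by blast
    show "(G \<union> {u, v}) \<inter> (topspace D - G) = {u, v}" using uvX G(3,4) by blast
    show "G \<union> {u, v} \<noteq> {u, v}" using G(3-5) by auto
  qed (use G uvX in auto)
  have i1: "(G \<union> {u, v}) \<inter> {y0, y1} \<noteq> {}" using conn[OF ts] .
  have i2: "(topspace D - G) \<inter> {y0, y1} \<noteq> {}" using conn[OF two_sides.swap_sides[OF ts]] .
  have "y0 \<notin> {u, v}" "y1 \<notin> {u, v}" using C(4) Co(3) y1C by auto
  then consider "y0 \<in> G" "y1 \<notin> G \<union> {u, v}" | "y1 \<in> G" "y0 \<notin> G \<union> {u, v}" using i1 i2 by blast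
  then show thesis
  proof cases
    case 1
    then show thesis using that S y1X by blast
  next
    case 2
    have "y0 \<in> topspace D" using C(4) Co(3) by blast
    moreover have "M \<union> N = topspace D - {y1, y0}" using S(3) by blast
    ultimately show thesis using that 2 S(1,2,4,5,6) by blast
  qed
qed

end

context two_sides
begin

lemma first_cut_after:
  assumes haus: "Hausdorff_space D" and lc: "locally_connected_space D"
    and x: "x \<in> A" and nocut: "\<nexists>P Q. cut x P Q"
  obtains v P Q where "cut v P Q" "x \<in> P" "\<And>s P' Q'. \<lbrakk>cut s P' Q'; x \<in> P'\<rbrakk> \<Longrightarrow> Q' \<subseteq> Q"
proof -
  interpret sw: two_sides D A B b a by (rule swap_ends)
  have "\<nexists>P Q. sw.cut x P Q" using nocut cuts_between_swap by metis
  from sw.last_cut_before[OF haus lc x this] show thesis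
    using that cuts_between_swap by metis
qed

text \<open>If \<open>x\<close> is not a cut, let \<open>u\<close> be the last cut before \<open>x\<close>, let \<open>v\<close> be the first cut after \<open>x\<close>, and let \<open>G\<close> be the gap
  between them. Then \<open>{u, v}\<close> is a cut pair with \<open>G\<close> as one half of the complement. A crossing pair has a
  point \<open>c\<close> in \<open>G\<close>, which is again a cut. Being before or after \<open>x\<close>, it contradicts the choice of \<open>u\<close>
  or \<open>v\<close>.\<close>
lemma every_point_cuts:
  assumes haus: "Hausdorff_space D" and lc: "locally_connected_space D"
    and crossed: "\<And>P. cut_pair D P \<Longrightarrow> \<exists>Q. cut_pair D Q \<and> crosses D Q P"
    and x: "x \<in> A"
  shows "\<exists>P Q. cut x P Q"
proof (rule ccontr)
  assume nocut: "\<nexists>P Q. cut x P Q"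
  obtain u Pu Qu where u: "cut u Pu Qu" "x \<in> Qu" and maxu: "\<And>s P' Q'. \<lbrakk>cut s P' Q'; x \<in> Q'\<rbrakk> \<Longrightarrow> P' \<subseteq> Pu"
    using last_cut_before[OF haus lc x nocut] by metis
  obtain v Pv Qv where v: "cut v Pv Qv" "x \<in> Pv" and minv: "\<And>s P' Q'. \<lbrakk>cut s P' Q'; x \<in> P'\<rbrakk> \<Longrightarrow> Q' \<subseteq> Qv"
    using first_cut_after[OF haus lc x nocut] by metis
  note ud = cuts_betweenD[OF u(1)] and vd = cuts_betweenD[OF v(1)]
  have xu: "x \<noteq> u" "x \<noteq> v" using nocut u(1) v(1) by auto
  then have xPu: "x \<notin> Pu" "x \<notin> Qv" using ud(10) vd(10) u(2) v(2) by auto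
  have uv: "u \<noteq> v" using u(2) v(2) xPu cut_unique[of u Pu Qu Pv Qv] u(1) v(1) by auto
  have vQ: "v \<in> Qu"
  proof (rule ccontr)
    assume "v \<notin> Qu"
    then have "v \<in> Pu" using ud(3) vd(9) by blast
    then have "Pv \<subseteq> Pu" using cut_greater(2)[OF u(1) v(1) uv] by blast
    then show False using v(2) xPu by blast
  qed
  have less: "Pu \<subseteq> Pv - {v}" "Qv \<subseteq> Qu - {u}" using cut_less[OF u(1) v(1) uv vQ] .
  have disj: "Pu \<inter> Qv = {}"
  proof -
    have "z = v" if "z \<in> Pu" "z \<in> Qv" for z using that less vd(10) by blast
    then show ?thesis using less by blast
  qed
  define G where "G = A - (Pu \<union> Qv)"
  have GX: "topspace D - G = B \<union> (Pu \<union> Qv)"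
  proof -
    have "Pu \<union> Qv \<subseteq> A" using ud(3) vd(3) by blast
    moreover have "B \<inter> A \<subseteq> Pu \<union> Qv" using meet ud(5) vd(6) by auto
    ultimately show ?thesis unfolding G_def using cover by blast
  qed
  have "closedin D (B \<union> (Pu \<union> Qv))" using closedB ud(1) vd(2) by (intro closedin_Un)
  then have oG: "openin D G" using GX AX G_def by (metis Diff_subset openin_closedin_eq subset_trans)
  have Guv: "G \<union> {u, v} = Qu \<inter> Pv"
  proof
    show "G \<union> {u, v} \<subseteq> Qu \<inter> Pv" unfolding G_def using ud(3,7,8) vd(3,7,8) vQ less by blast
    show "Qu \<inter> Pv \<subseteq> G \<union> {u, v}" unfolding G_def using ud(3,10) vd(10) by blast
  qed
  have cG: "closedin D (G \<union> {u, v})" unfolding Guv using ud(2) vd(1) by (rule closedin_Int)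
  have nG: "u \<notin> G" "v \<notin> G" unfolding G_def using ud(7) vd(8) by auto
  have xG: "x \<in> G" unfolding G_def using x xPu by blast
  have uvX: "u \<in> topspace D" "v \<in> topspace D" using ud(9) vd(9) AX by auto
  obtain z where z: "z \<in> B" "z \<notin> {a, b}" using neB ends_in by blast
  have zA: "z \<notin> A" using z meet by blast
  have zG: "z \<in> topspace D - (G \<union> {u, v})" using z(1) zA cover ud(9) vd(9) unfolding G_def by blast
  have "\<not> connected_space (subtopology D (topspace D - {u, v}))"
  proof -
    have 1: "openin D (topspace D - (G \<union> {u, v}))" using cG by blast
    have "G \<subseteq> topspace D" using oG openin_subset by blast
    then have "G \<union> (topspace D - (G \<union> {u, v})) = topspace D - {u, v}" using nG by blast
    moreover have "openin D (topspace D - {u, v})"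
      using T1 uvX t1_space_closedin_finite[of D] by (intro openin_diff) auto
    moreover have "topspace (subtopology D (topspace D - {u, v})) = topspace D - {u, v}" by auto
    moreover have "openin (subtopology D (topspace D - {u, v})) G"
      "openin (subtopology D (topspace D - {u, v})) (topspace D - (G \<union> {u, v}))"
      using oG 1 calculation(1) by (simp_all only: openin_open_subtopology[OF calculation(2)]) auto
    moreover have "G \<inter> (topspace D - (G \<union> {u, v})) = {}" by blast
    ultimately show ?thesis
      unfolding connected_space_eq using xG zG by (metis empty_iff)
  qed
  then have "cut_pair D {u, v}" unfolding cut_pair_def using uvX uv no_cut_points by blast
  then obtain Q where Q: "cut_pair D Q" "crosses D Q {u, v}" using crossed by blast
  have "topspace D - G \<noteq> {u, v}" using zG by blast
  moreover have "G \<noteq> {}" using xG by blast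
  ultimately obtain c d M N where cd: "c \<in> G" "d \<in> topspace D" "d \<notin> G \<union> {u, v}"
    and MN: "openin D M" "openin D N" "M \<union> N = topspace D - {c, d}" "M \<inter> N = {}" "u \<in> M" "v \<in> N"
    using crossing_cut_pair[OF lc Q uvX uv oG cG nG] by metis
  \<comment> \<open>The crossing pair splits the gap into a part at \<open>u\<close>, which is joined to what comes before \<open>u\<close>, and a part at \<open>v\<close>.\<close>
  define Pc where "Pc = Pu \<union> ((topspace D - N) \<inter> (G \<union> {u, v}))"
  define Qc where "Qc = Qv \<union> ((topspace D - M) \<inter> (G \<union> {u, v}))"
  have "cut c Pc Qc"
    unfolding cuts_between_def
  proof (intro conjI)
    have "closedin D (topspace D - N)" "closedin D (topspace D - M)" using MN by auto
    then show "closedin D Pc" "closedin D Qc" unfolding Pc_def Qc_def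
      using ud(1) vd(2) cG by (auto intro!: closedin_Un closedin_Int)
    show "a \<in> Pc" "b \<in> Qc" using ud(5) vd(6) Pc_def Qc_def by auto
    have PQA: "Pu \<subseteq> A" "Qv \<subseteq> A" "u \<in> A" "v \<in> A" using ud vd by blast+
    then show "Pc \<union> Qc = A"
      unfolding Pc_def Qc_def using MN(4) AX by (auto simp: G_def)
    have uv_in: "Pu \<inter> (G \<union> {u, v}) \<subseteq> {u}" "Qv \<inter> (G \<union> {u, v}) \<subseteq> {v}"
      using less unfolding G_def by blast+
    have "(topspace D - N) \<inter> (topspace D - M) = {c, d}" using MN(3) cd oG openin_subset by blast
    then have "((topspace D - N) \<inter> (G \<union> {u, v})) \<inter> ((topspace D - M) \<inter> (G \<union> {u, v})) = {c}"
      using cd by blast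
    moreover have "Pu \<inter> ((topspace D - M) \<inter> (G \<union> {u, v})) = {}" using uv_in(1) MN(5) by blast
    moreover have "Qv \<inter> ((topspace D - N) \<inter> (G \<union> {u, v})) = {}" using uv_in(2) MN(6) by blast
    ultimately show "Pc \<inter> Qc = {c}" unfolding Pc_def Qc_def using disj by blast
  qed
  note c = this cuts_betweenD[OF this]
  have "x \<in> Pc \<or> x \<in> Qc" using x c(4) by blast
  then show False
  proof
    assume "x \<in> Qc"
    then have "c \<in> Pu" using maxu[OF c(1)] c(8) by blast
    then show False using cd(1) unfolding G_def by blast
  next
    assume "x \<in> Pc"
    then have "c \<in> Qv" using minv[OF c(1)] c(9) by blast
    then show False using cd(1) unfolding G_def by blast
  qed
qed

end

section \<open>Parametrizing a side as an arc\<close>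

lemma continuous_map_real_nbhd:
  fixes f :: "'p \<Rightarrow> real"
  assumes "\<And>x e. \<lbrakk>x \<in> topspace X; e > 0\<rbrakk> \<Longrightarrow> \<exists>U. openin X U \<and> x \<in> U \<and> (\<forall>y\<in>U. \<bar>f y - f x\<bar> < e)"
  shows "continuous_map X euclideanreal f"
proof -
  have "continuous_map X Met_TC.mtopology f"
    unfolding Met_TC.continuous_map_to_metric
    using assms by (fastforce simp: dist_real_def)
  then show ?thesis by simp
qed

text \<open>Every point of \<open>A\<close> is a cut, and \<open>lo x\<close> and \<open>hi x\<close> are the sets of the points up to \<open>x\<close> and from \<open>x\<close> on.
  The order itself is expressed by \<open>y \<in> hi x\<close>.\<close>
locale ordered_side = two_sides +
  fixes lo hi :: "'a \<Rightarrow> 'a set"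
  assumes cut: "x \<in> A \<Longrightarrow> cut x (lo x) (hi x)"
    and compact: "compact_space D" and haus: "Hausdorff_space D"
    and lc: "locally_connected_space D"
begin

lemmas cutD = cuts_betweenD[OF cut]

lemma lo_sub: "x \<in> A \<Longrightarrow> lo x \<subseteq> A" using cutD(3) by blast

lemma total: "\<lbrakk>x \<in> A; y \<in> A\<rbrakk> \<Longrightarrow> y \<in> hi x \<or> x \<in> hi y"
  using cutD(3)[of x] cut_greater(1)[OF cut cut, of x y] cutD(8)[of x] by (cases "x = y") auto

lemma lo_less: "\<lbrakk>x \<in> A; y \<in> A; x \<noteq> y; y \<in> hi x\<rbrakk> \<Longrightarrow> lo x \<subseteq> lo y - {y}"
  using cut_less(1)[OF cut cut] by blast

lemma lo_mono: "\<lbrakk>x \<in> A; y \<in> A; y \<in> hi x\<rbrakk> \<Longrightarrow> lo x \<subseteq> lo y"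
  using lo_less by (cases "x = y") auto

lemma in_lo_imp: "\<lbrakk>x \<in> A; y \<in> lo x\<rbrakk> \<Longrightarrow> x \<in> hi y"
proof -
  assume x: "x \<in> A" and y: "y \<in> lo x"
  then have yA: "y \<in> A" using lo_sub by blast
  show "x \<in> hi y"
  proof (rule ccontr)
    assume n: "x \<notin> hi y"
    then have "x \<noteq> y" using cutD(8)[OF yA] by auto
    moreover have "y \<in> hi x" using total[OF x yA] n by blast
    ultimately show False using cutD(10)[OF x y] by auto
  qed
qed

text \<open>A connected set that misses one of the ends cannot go round through \<open>B\<close>.\<close>
lemma connected_contains_between:
  assumes N: "connectedin D N" "x \<in> N" "x' \<in> N" "a \<notin> N \<or> b \<notin> N"
    and x: "x \<in> A" "x' \<in> A" and y: "y \<in> lo x" "y \<notin> lo x'"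
  shows "y \<in> N"
proof (cases "y = x")
  case False
  interpret sw: two_sides D A B b a by (rule swap_ends)
  have yA: "y \<in> A" using lo_sub x(1) y(1) by blast
  have xy: "x \<in> hi y" using in_lo_imp[OF x(1) y(1)] .
  then have x_notin: "x \<notin> lo y" using cutD(10)[OF yA] False by auto
  have yx': "y \<noteq> x'" using y(2) cutD(7)[OF x(2)] by auto
  have "y \<in> hi x'" using y(2) yA cutD(3)[OF x(2)] by auto
  then have "lo x' \<subseteq> lo y - {y}" using lo_less x(2) yA yx' by auto
  then have x'y: "x' \<in> lo y" using cutD(7)[OF x(2)] by blast
  then have x'_notin: "x' \<notin> hi y" using cutD(10)[OF yA] yx' by auto
  show ?thesis
    using N(4)
  proof
    assume "a \<notin> N"
    then show ?thesis using connected_through_cut[OF N(1) cut[OF yA]] N(2,3) x_notin x'y by blast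
  next
    assume "b \<notin> N"
    moreover have "sw.cut y (hi y) (lo y)" using cut[OF yA] cuts_between_swap by metis
    ultimately show ?thesis using sw.connected_through_cut[OF N(1)] N(2,3) xy x'_notin by blast
  qed
qed (use N in auto)

text \<open>For \<open>x\<close> in a small connected neighbourhood \<open>N\<close> of \<open>x0\<close>, the sets \<open>lo x\<close> and \<open>lo x0\<close> differ only by points
  of \<open>N\<close>, where \<open>g\<close> is almost constant.\<close>
lemma continuous_Sup_lo:
  assumes g: "continuous_map D euclideanreal g" and bd: "\<And>z. z \<in> topspace D \<Longrightarrow> g z \<le> 1"
  shows "continuous_map (subtopology D A) euclideanreal (\<lambda>x. Sup (g ` lo x))"
proof (rule continuous_map_real_nbhd)
  fix x0 and e :: real assume x0: "x0 \<in> topspace (subtopology D A)" and e: "e > 0"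
  then have x0A: "x0 \<in> A" and x0X: "x0 \<in> topspace D" by auto
  \<comment> \<open>An end different from \<open>x0\<close>: keeping it out of the neighbourhood blocks the way through \<open>B\<close>.\<close>
  define w where "w = (if x0 = a then b else a)"
  have w: "w \<in> {a, b}" "w \<noteq> x0" using ab by (auto simp: w_def)
  then have wX: "w \<in> topspace D" using ends_in AX by blast
  define V where "V = {z \<in> topspace D. g z \<in> {g x0 - e / 4 <..< g x0 + e / 4}}"
  have "openin D V" unfolding V_def using g by (rule openin_continuous_map_preimage) simp
  then have "openin D (V - {w})" using closed_singleton[OF wX] by (rule openin_diff)
  moreover have "x0 \<in> V - {w}" using w x0X e by (auto simp: V_def)
  ultimately obtain O' N where N: "openin D O'" "connectedin D N" "x0 \<in> O'" "O' \<subseteq> N" "N \<subseteq> V - {w}"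
    using lc unfolding locally_connected_space_def neighbourhood_base_of by meson
  have ends: "a \<notin> N \<or> b \<notin> N" using w(1) N(5) by auto
  have bdd: "bdd_above (g ` lo x)" if "x \<in> A" for x
    using bd lo_sub[OF that] AX by (intro bdd_aboveI[of _ 1]) blast
  have close: "\<bar>g z - g x0\<bar> < e / 4" if "z \<in> N" for z
  proof -
    have "z \<in> V" using that N(5) by blast
    then have "g x0 - e / 4 < g z" "g z < g x0 + e / 4" unfolding V_def by auto
    then show ?thesis by linarith
  qed
  have le: "Sup (g ` lo x) \<le> Sup (g ` lo x') + e / 2"
    if x: "x \<in> A" "x' \<in> A" "x \<in> N" "x' \<in> N" for x x'
  proof (rule cSup_least)
    show "g ` lo x \<noteq> {}" using cutD(7)[OF x(1)] by blast
    fix t assume "t \<in> g ` lo x"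
    then obtain y where y: "y \<in> lo x" "t = g y" by blast
    show "t \<le> Sup (g ` lo x') + e / 2"
    proof (cases "y \<in> lo x'")
      case True
      then have "g y \<le> Sup (g ` lo x')" using bdd[OF x(2)] by (intro cSup_upper) auto
      then show ?thesis using y e by simp
    next
      case False
      then have "y \<in> N" using connected_contains_between[OF N(2) x(3,4) ends x(1,2) y(1)] by blast
      moreover have "g x' \<le> Sup (g ` lo x')" using bdd[OF x(2)] cutD(7)[OF x(2)] by (intro cSup_upper) auto
      ultimately show ?thesis using close[of y] close[OF x(4)] y(2) by linarith
    qed
  qed
  show "\<exists>U. openin (subtopology D A) U \<and> x0 \<in> U \<and> (\<forall>y\<in>U. \<bar>Sup (g ` lo y) - Sup (g ` lo x0)\<bar> < e)"
  proof (intro exI[of _ "O' \<inter> A"] conjI ballI)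
    show "openin (subtopology D A) (O' \<inter> A)" using N(1) by (auto simp: openin_subtopology)
    show "x0 \<in> O' \<inter> A" using N(3) x0A by blast
    fix y assume "y \<in> O' \<inter> A"
    then have "y \<in> A" "y \<in> N" using N(4) by auto
    moreover have "x0 \<in> N" using N(3,4) by blast
    ultimately have "Sup (g ` lo y) \<le> Sup (g ` lo x0) + e / 2" "Sup (g ` lo x0) \<le> Sup (g ` lo y) + e / 2"
      using le x0A by auto
    then show "\<bar>Sup (g ` lo y) - Sup (g ` lo x0)\<bar> < e" using e by linarith
  qed
qed

lemma dense_between:
  assumes E: "D closure_of E = topspace D" and xy: "x \<in> A" "y \<in> A" "x \<noteq> y" "y \<in> hi x"
  obtains u where "u \<in> E" "u \<in> A" "u \<noteq> x" "u \<in> hi x" "u \<noteq> y" "y \<in> hi u" "u \<in> lo y"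
proof -
  have disj: "lo x \<inter> hi y = {}"
  proof -
    have "z = y" if "z \<in> lo x" "z \<in> hi y" for z using that lo_mono xy cutD(10)[OF xy(2)] by blast
    moreover have "y \<notin> lo x" using lo_less xy by blast
    ultimately show ?thesis by blast
  qed
  have ne: "lo x \<union> hi y \<noteq> A"
  proof
    assume "lo x \<union> hi y = A"
    then have "lo x = {} \<or> hi y = {}" using side_connected disj cutD(1)[OF xy(1)] cutD(2)[OF xy(2)] by metis
    then show False using cutD(7)[OF xy(1)] cutD(8)[OF xy(2)] by auto
  qed
  moreover have "lo x \<union> hi y \<subseteq> A" using cutD(3)[OF xy(1)] cutD(3)[OF xy(2)] by blast
  ultimately obtain z where z: "z \<in> A" "z \<notin> lo x" "z \<notin> hi y" by blast
  have "z \<noteq> a" "z \<noteq> b" using z(2,3) cutD(5)[OF xy(1)] cutD(6)[OF xy(2)] by auto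
  then have "z \<notin> B" using meet z(1) by blast
  define O' where "O' = topspace D - (B \<union> (lo x \<union> hi y))"
  have "closedin D (B \<union> (lo x \<union> hi y))"
    using closedB cutD(1)[OF xy(1)] cutD(2)[OF xy(2)] by (intro closedin_Un)
  then have "openin D O'" unfolding O'_def by blast
  moreover have "z \<in> O'" using z \<open>z \<notin> B\<close> AX unfolding O'_def by blast
  moreover have "z \<in> D closure_of E" using E z AX by blast
  ultimately obtain u where u: "u \<in> E" "u \<in> O'" by (auto simp: in_closure_of)
  then have uA: "u \<in> A" and uo: "u \<notin> lo x" "u \<notin> hi y" using cover unfolding O'_def by blast+
  have "u \<in> hi x" "u \<in> lo y" using uo uA cutD(3)[OF xy(1)] cutD(3)[OF xy(2)] by blast+
  moreover have "u \<noteq> x" "u \<noteq> y" using uo cutD(7)[OF xy(1)] cutD(8)[OF xy(2)] by auto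
  moreover have "y \<in> hi u" using in_lo_imp[OF xy(2)] calculation(2) by blast
  ultimately show thesis using that u(1) uA by blast
qed

text \<open>Urysohn functions for the disjoint closed sets \<open>lo u\<close> and \<open>hi v\<close>, where \<open>u < v\<close> run through a countable
  dense set.\<close>
lemma separating_functions:
  assumes E: "countable E" "D closure_of E = topspace D"
  obtains g :: "nat \<Rightarrow> 'a \<Rightarrow> real" where
    "\<And>k. continuous_map D euclideanreal (g k)" "\<And>k z. z \<in> topspace D \<Longrightarrow> 0 \<le> g k z \<and> g k z \<le> 1"
    "\<And>x y. \<lbrakk>x \<in> A; y \<in> A; x \<noteq> y; y \<in> hi x\<rbrakk> \<Longrightarrow> \<exists>k. (\<forall>z\<in>lo x. g k z = 0) \<and> (\<exists>z\<in>lo y. g k z = 1)"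
proof -
  define S where "S = (E \<inter> A) \<times> (E \<inter> A)"
  have "normal_space D" using compact haus compact_Hausdorff_or_regular_imp_normal_space by blast
  have "\<exists>f. continuous_map D euclideanreal f \<and> (\<forall>z\<in>topspace D. 0 \<le> f z \<and> f z \<le> 1) \<and>
      (u \<noteq> v \<longrightarrow> v \<in> hi u \<longrightarrow> (\<forall>z\<in>lo u. f z = 0) \<and> (\<forall>z\<in>hi v. f z = (1::real)))"
    if uv: "u \<in> A" "v \<in> A" for u v
  proof (cases "u \<noteq> v \<and> v \<in> hi u")
    case True
    have "lo u \<inter> hi v = {}"
    proof -
      have "z = v" if "z \<in> lo u" "z \<in> hi v" for z using that lo_mono uv True cutD(10)[OF uv(2)] by blast
      moreover have "v \<notin> lo u" using lo_less uv True by blast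
      ultimately show ?thesis by blast
    qed
    then obtain f where f: "continuous_map D (top_of_set {0..1::real}) f" "f ` lo u \<subseteq> {0}" "f ` hi v \<subseteq> {1}"
      using Urysohn_lemma[OF \<open>normal_space D\<close> cutD(1)[OF uv(1)] cutD(2)[OF uv(2)], of 0 1]
      unfolding disjnt_def by auto
    then have "continuous_map D euclideanreal f" "\<And>z. z \<in> topspace D \<Longrightarrow> f z \<in> {0..1}"
      by (auto simp: continuous_map_in_subtopology)
    then show ?thesis using f(2,3) by (intro exI[of _ f]) auto
  qed (intro exI[of _ "\<lambda>_. 0"], auto)
  then obtain G where G: "\<And>u v. \<lbrakk>u \<in> A; v \<in> A\<rbrakk> \<Longrightarrow> continuous_map D euclideanreal (G u v) \<and> (\<forall>z\<in>topspace D. 0 \<le> G u v z \<and> G u v z \<le> 1) \<and>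
      (u \<noteq> v \<longrightarrow> v \<in> hi u \<longrightarrow> (\<forall>z\<in>lo u. G u v z = 0) \<and> (\<forall>z\<in>hi v. G u v z = (1::real)))"
    by metis
  have pair: "\<exists>u v. (u, v) \<in> S \<and> u \<noteq> v \<and> v \<in> hi u \<and> lo x \<subseteq> lo u \<and> v \<in> lo y"
    if xy: "x \<in> A" "y \<in> A" "x \<noteq> y" "y \<in> hi x" for x y
  proof -
    obtain u where u: "u \<in> E" "u \<in> A" "u \<noteq> x" "u \<in> hi x" "u \<noteq> y" "y \<in> hi u"
      using dense_between[OF E(2) xy] by metis
    obtain v where v: "v \<in> E" "v \<in> A" "v \<noteq> u" "v \<in> hi u" "v \<in> lo y"
      using dense_between[OF E(2) u(2) xy(2) u(5,6)] by metis
    have "lo x \<subseteq> lo u" using lo_mono xy(1) u(2,4) by blast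
    then show ?thesis unfolding S_def using u v by blast
  qed
  have "S \<noteq> {}"
  proof -
    have "b \<in> hi a" using cutD(6) ends_in by blast
    then show ?thesis using pair[of a b] ab ends_in by blast
  qed
  have cS: "countable S" using E(1) by (auto simp: S_def)
  define g where "g k = (case from_nat_into S k of (u, v) \<Rightarrow> G u v)" for k
  have gG: "\<exists>u\<in>A. \<exists>v\<in>A. g k = G u v" for k
  proof -
    obtain u v where uv: "from_nat_into S k = (u, v)" by fastforce
    then have "(u, v) \<in> S" using from_nat_into[OF \<open>S \<noteq> {}\<close>, of k] by simp
    then show ?thesis unfolding g_def uv by (auto simp: S_def)
  qed
  show thesis
  proof
    show "continuous_map D euclideanreal (g k)" for k using gG[of k] G by metis
    show "0 \<le> g k z \<and> g k z \<le> 1" if "z \<in> topspace D" for k z using gG[of k] G that by metis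
    fix x y assume "x \<in> A" "y \<in> A" "x \<noteq> y" "y \<in> hi x"
    then obtain u v where uv: "(u, v) \<in> S" "u \<noteq> v" "v \<in> hi u" "lo x \<subseteq> lo u" "v \<in> lo y" using pair by metis
    obtain k where "from_nat_into S k = (u, v)" using from_nat_into_surj[OF cS uv(1)] by blast
    then have "g k = G u v" by (simp add: g_def)
    moreover have uvA: "u \<in> A" "v \<in> A" using uv(1) S_def by auto
    moreover have "v \<in> hi v" using cutD(8) uvA by blast
    ultimately show "\<exists>k. (\<forall>z\<in>lo x. g k z = 0) \<and> (\<exists>z\<in>lo y. g k z = 1)"
      using G[OF uvA] uv(2-5) by (intro exI[of _ k]) auto
  qed
qed

text \<open>For each \<open>g\<close> of a separating sequence the function that maps \<open>x\<close> to the supremum of \<open>g\<close> up to \<open>x\<close> is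
  continuous and increasing, and between two given points one of them increases strictly. A convergent
  positive combination is strictly increasing.\<close>
lemma strictly_increasing_function:
  assumes E: "countable E" "D closure_of E = topspace D"
  obtains F :: "'a \<Rightarrow> real" where "continuous_map (subtopology D A) euclideanreal F"
    "\<And>x y. \<lbrakk>x \<in> A; y \<in> A; x \<noteq> y; y \<in> hi x\<rbrakk> \<Longrightarrow> F x < F y"
proof -
  obtain g :: "nat \<Rightarrow> 'a \<Rightarrow> real" where g: "\<And>k. continuous_map D euclideanreal (g k)"
    and g01: "\<And>k z. z \<in> topspace D \<Longrightarrow> 0 \<le> g k z \<and> g k z \<le> 1"
    and gsep: "\<And>x y. \<lbrakk>x \<in> A; y \<in> A; x \<noteq> y; y \<in> hi x\<rbrakk> \<Longrightarrow> \<exists>k. (\<forall>z\<in>lo x. g k z = 0) \<and> (\<exists>z\<in>lo y. g k z = 1)"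
    using separating_functions[OF E] by metis
  define h where "h k x = Sup (g k ` lo x)" for k x
  have loX: "lo x \<subseteq> topspace D" if "x \<in> A" for x using lo_sub[OF that] AX by blast
  have bdd: "bdd_above (g k ` lo x)" if "x \<in> A" for k x
    using g01 loX[OF that] by (intro bdd_aboveI[of _ 1]) blast
  have ne: "lo x \<noteq> {}" if "x \<in> A" for x using cutD(7)[OF that] by blast
  have h1: "h k x \<le> 1" if "x \<in> A" for k x
    unfolding h_def using ne[OF that] g01 loX[OF that] by (intro cSup_least) auto
  have hge: "g k z \<le> h k x" if "x \<in> A" "z \<in> lo x" for k x z
    unfolding h_def using that bdd by (intro cSup_upper) auto
  have h0: "0 \<le> h k x" if "x \<in> A" for k x
    using hge[OF that cutD(7)[OF that], of k] g01[of x k] that AX by force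
  have hmono: "h k x \<le> h k y" if "x \<in> A" "y \<in> A" "y \<in> hi x" for k x y
    unfolding h_def using lo_mono[OF that] bdd[OF that(2)] ne[OF that(1)] by (intro cSup_subset_mono) auto
  have hcont: "continuous_map (subtopology D A) euclideanreal (h k)" for k
    unfolding h_def using g g01 by (intro continuous_Sup_lo) auto
  define F where "F x = (\<Sum>k. (1/2)^k * h k x)" for x
  have bound: "norm ((1/2)^k * h k x) \<le> (1/2)^k" if "x \<in> A" for k x
    using h0[OF that, of k] h1[OF that, of k] by (simp add: abs_mult mult_left_le)
  have geo: "summable (\<lambda>k. (1/2::real)^k)" by (simp add: summable_geometric)
  have sm: "summable (\<lambda>k. (1/2)^k * h k x)" if "x \<in> A" for x
    by (rule summable_comparison_test'[OF geo, of 0]) (rule bound[OF that])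
  have ul: "uniform_limit A (\<lambda>n x. \<Sum>k<n. (1/2)^k * h k x) F sequentially"
    unfolding F_def using bound geo by (intro Weierstrass_m_test) auto
  have "continuous_map (subtopology D A) Met_TC.mtopology F"
  proof (rule Met_TC.continuous_map_uniform_limit)
    show "\<forall>\<^sub>F n in sequentially. continuous_map (subtopology D A) Met_TC.mtopology (\<lambda>x. \<Sum>k<n. (1/2)^k * h k x)"
      using hcont by (auto intro!: always_eventually continuous_map_sum continuous_map_real_mult_left)
    show "\<forall>\<^sub>F n in sequentially. \<forall>x\<in>topspace (subtopology D A). F x \<in> UNIV \<and> dist (\<Sum>k<n. (1/2)^k * h k x) (F x) < e"
      if "e > 0" for e using uniform_limitD[OF ul that] by (rule eventually_mono) auto
  qed simp
  then have "continuous_map (subtopology D A) euclideanreal F" by simp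
  moreover have "F x < F y" if xy: "x \<in> A" "y \<in> A" "x \<noteq> y" "y \<in> hi x" for x y
  proof -
    obtain k z where k: "\<And>z. z \<in> lo x \<Longrightarrow> g k z = 0" "z \<in> lo y" "g k z = 1" using gsep[OF xy] by blast
    have "h k x \<le> 0" unfolding h_def using ne[OF xy(1)] k(1) by (intro cSup_least) auto
    moreover have "h k y \<ge> 1" using hge[OF xy(2) k(2)] k(3) by metis
    ultimately have k: "(1/2)^k * h k y - (1/2)^k * h k x > 0" by simp
    have nn: "(1/2)^i * h i y - (1/2)^i * h i x \<ge> 0" for i using hmono[OF xy(1,2,4), of i] by simp
    have "F y - F x = (\<Sum>i. (1/2)^i * h i y - (1/2)^i * h i x)"
      unfolding F_def using sm xy(1,2) by (simp add: suminf_diff)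
    also have "\<dots> > 0" using suminf_pos2[OF summable_diff[OF sm[OF xy(2)] sm[OF xy(1)]] nn k] .
    finally show ?thesis by simp
  qed
  ultimately show thesis using that by blast
qed

lemma arc_parametrization:
  assumes E: "countable E" "D closure_of E = topspace D"
  obtains f :: "'a \<Rightarrow> real" where "continuous_map (subtopology D A) euclideanreal f"
    "inj_on f A" "f ` A = {0..1}" "f a = 0" "f b = 1"
proof -
  obtain F :: "'a \<Rightarrow> real" where F: "continuous_map (subtopology D A) euclideanreal F"
    and less: "\<And>x y. \<lbrakk>x \<in> A; y \<in> A; x \<noteq> y; y \<in> hi x\<rbrakk> \<Longrightarrow> F x < F y"
    using strictly_increasing_function[OF E] by metis
  have ha: "x \<in> hi a" if "x \<in> A" for x
    using cut_unique(2)[OF cut_first cut[OF ends_in(1)]] that by blast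
  have hb: "b \<in> hi x" if "x \<in> A" for x using cutD(6)[OF that] .
  have lim: "F a \<le> F x" "F x \<le> F b" if "x \<in> A" for x
    using less[of a x] less[of x b] ha hb that ends_in by (metis order.refl less_imp_le)+
  have Fab: "F a < F b" using less[of a b] ends_in ab hb by blast
  have inj: "inj_on F A"
    using less total by (intro inj_onI) (metis less_irrefl)
  have "connectedin (subtopology D A) A" using connectedin_side by (simp add: connectedin_subtopology)
  then have "connectedin euclideanreal (F ` A)" using F connectedin_continuous_map_image by blast
  then have "connected (F ` A)" by simp
  then have "{F a..F b} \<subseteq> F ` A" using ends_in connected_contains_Icc by blast
  then have img: "F ` A = {F a..F b}" using lim by auto
  define f where "f x = (F x - F a) / (F b - F a)" for x
  have "f = (\<lambda>t. (t - F a) / (F b - F a)) \<circ> F" by (auto simp: f_def)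
  moreover have "continuous_map euclideanreal euclideanreal (\<lambda>t. (t - F a) / (F b - F a))"
    using Fab by (auto intro!: continuous_intros)
  ultimately have "continuous_map (subtopology D A) euclideanreal f" using continuous_map_compose[OF F] by metis
  moreover have "inj_on f A" using inj Fab by (auto simp: inj_on_def f_def)
  moreover have "f ` A = {0..1}"
  proof
    show "f ` A \<subseteq> {0..1}" using lim Fab by (auto simp: f_def)
    show "{0..1} \<subseteq> f ` A"
    proof
      fix t :: real assume t: "t \<in> {0..1}"
      then have "F a + t * (F b - F a) \<in> {F a..F b}" using Fab mult_left_le_one_le[of "F b - F a" t] mult_left_mono[of "F a" "F b" t]
        by (auto simp: algebra_simps)
      then obtain x where "x \<in> A" "F x = F a + t * (F b - F a)" using img by (metis imageE)
      then show "t \<in> f ` A" using Fab by (intro image_eqI[of _ _ x]) (auto simp: f_def)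
    qed
  qed
  moreover have "f a = 0" "f b = 1" using Fab by (auto simp: f_def)
  ultimately show thesis using that by blast
qed

end

section \<open>Gluing two arcs to a circle\<close>

lemma cis_arcs_cover_circle:
  fixes z :: complex
  assumes "norm z = 1"
  obtains t where "0 \<le> t" "t \<le> 1" "z = cis (pi * t) \<or> z = cis (- (pi * t))"
proof -
  have z: "z = cis (Arg z)" using assms by (metis rcis_cmod_Arg rcis_def mult_1 of_real_1)
  have A: "- pi < Arg z" "Arg z \<le> pi" using Arg_bounded by auto
  show thesis
  proof (cases "Arg z \<ge> 0")
    case True
    show ?thesis using that[of "Arg z / pi"] z A True by (auto simp: divide_le_eq)
  next
    case False
    show ?thesis using that[of "- Arg z / pi"] z A False by (auto simp: divide_le_eq field_simps)
  qed
qed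

text \<open>The cosine determines the parameter of the upper, or lower, half circle.\<close>
lemma cis_upper_lower:
  assumes t: "0 \<le> t" "t \<le> 1" and s: "0 \<le> s" "s \<le> 1"
  shows "cis (pi * t) = cis (pi * s) \<longleftrightarrow> t = s"
    and "cis (pi * t) = cis (- (pi * s)) \<longleftrightarrow> t = s \<and> (t = 0 \<or> t = 1)"
proof -
  have c: "cos (pi * t) = cos (pi * s) \<longleftrightarrow> t = s"
    using cos_inj_pi[of "pi * t" "pi * s"] t s by (auto simp: mult_left_le)
  then show "cis (pi * t) = cis (pi * s) \<longleftrightarrow> t = s" by (auto simp: cis.ctr complex_eq_iff)
  have "sin (pi * t) = 0 \<longleftrightarrow> t = 0 \<or> t = 1"
  proof
    assume "sin (pi * t) = 0"
    moreover have "sin (pi * t) > 0" if "0 < t" "t < 1" using that by (intro sin_gt_zero) auto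
    ultimately show "t = 0 \<or> t = 1" using t by force
  qed auto
  then show "cis (pi * t) = cis (- (pi * s)) \<longleftrightarrow> t = s \<and> (t = 0 \<or> t = 1)"
    using c by (auto simp: complex_eq_iff)
qed

text \<open>Both sides of a cut pair are arcs; they are mapped to the upper and the lower half of the circle.\<close>
theorem circle_of_crossed_cut_pairs:
  fixes D :: "'p topology"
  assumes compact: "compact_space D" and haus: "Hausdorff_space D"
    and lc: "locally_connected_space D"
    and E: "countable E" "D closure_of E = topspace D"
    and nocut: "\<nexists>x. cut_point D x" and pair: "\<exists>P. cut_pair D P"
    and crossed: "\<And>P. cut_pair D P \<Longrightarrow> \<exists>Q. cut_pair D Q \<and> crosses D Q P"
  shows "D homeomorphic_space top_of_set (sphere (0::complex) 1)"
proof -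
  interpret space_without_cut_points D
    using nocut haus Hausdorff_imp_t1_space by unfold_locales auto
  obtain a b M N where ab: "a \<noteq> b" "a \<in> topspace D" "b \<in> topspace D"
    and MN: "openin D M" "openin D N" "M \<union> N = topspace D - {a, b}" "M \<inter> N = {}" "M \<noteq> {}" "N \<noteq> {}"
    using pair cut_pair_separation by metis
  define A where "A = M \<union> {a, b}"
  define B where "B = N \<union> {a, b}"
  have mem: "x \<in> topspace D \<longleftrightarrow> x \<in> M \<or> x \<in> N \<or> x = a \<or> x = b" for x
    using MN(3) ab(2,3) by blast
  have out: "a \<notin> M" "b \<notin> M" "a \<notin> N" "b \<notin> N" using MN(3) by blast+
  have disjoint: "\<not> (x \<in> M \<and> x \<in> N)" for x using MN(4) by blast
  have "x \<in> A \<longleftrightarrow> x \<in> topspace D - N" for x using mem[of x] disjoint[of x] out unfolding A_def by auto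
  then have AN: "A = topspace D - N" by blast
  have "x \<in> B \<longleftrightarrow> x \<in> topspace D - M" for x using mem[of x] disjoint[of x] out unfolding B_def by auto
  then have BM: "B = topspace D - M" by blast
  have sides: "two_sides D A B a b"
  proof unfold_locales
    show "closedin D A" "closedin D B" unfolding AN BM using MN(1,2) by auto
    have "x \<in> A \<union> B \<longleftrightarrow> x \<in> topspace D" for x using mem[of x] unfolding A_def B_def by auto
    then show "A \<union> B = topspace D" by blast
    show "A \<inter> B = {a, b}" unfolding A_def B_def using MN(4) by blast
    obtain m n where "m \<in> M" "n \<in> N" using MN(5,6) by blast
    then have "m \<in> A - {a, b}" "n \<in> B - {a, b}" using out unfolding A_def B_def by auto
    then show "A \<noteq> {a, b}" "B \<noteq> {a, b}" by auto
  qed (rule ab(1))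
  have param: "\<exists>f :: 'p \<Rightarrow> real. continuous_map (subtopology D A) euclideanreal f \<and> inj_on f A \<and> f ` A = {0..1} \<and> f a = 0 \<and> f b = 1"
    if "two_sides D A B a b" for A B
  proof -
    interpret two_sides D A B a b by (rule that)
    have "\<forall>x\<in>A. \<exists>P Q. cuts_between D A a b x P Q" using every_point_cuts[OF haus lc crossed] by blast
    then obtain lo hi where "\<And>x. x \<in> A \<Longrightarrow> cuts_between D A a b x (lo x) (hi x)" by metis
    then interpret ordered_side D A B a b lo hi using compact haus lc by unfold_locales auto
    show ?thesis using arc_parametrization[OF E] by metis
  qed
  obtain f :: "'p \<Rightarrow> real" where f: "continuous_map (subtopology D A) euclideanreal f"
    "inj_on f A" "f ` A = {0..1}" "f a = 0" "f b = 1" using param[OF sides] by blast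
  obtain g :: "'p \<Rightarrow> real" where g: "continuous_map (subtopology D B) euclideanreal g"
    "inj_on g B" "g ` B = {0..1}" "g a = 0" "g b = 1" using param[OF two_sides.swap_sides[OF sides]] by blast
  interpret two_sides D A B a b by (rule sides)
  define h where "h x = (if x \<in> A then cis (pi * f x) else cis (- (pi * g x)))" for x
  have hA: "h x = cis (pi * f x)" if "x \<in> A" for x using that by (simp add: h_def)
  have hB: "h x = cis (- (pi * g x))" if "x \<in> B" for x
  proof (cases "x \<in> A")
    case True
    then have "x = a \<or> x = b" using meet that by blast
    then show ?thesis using f(4,5) g(4,5) ends_in by (auto simp: h_def complex_eq_iff)
  qed (simp add: h_def)
  have c: "continuous_map euclideanreal euclidean (\<lambda>t. cis (pi * t))" "continuous_map euclideanreal euclidean (\<lambda>t. cis (- (pi * t)))"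
    by (auto intro!: continuous_intros)
  have "continuous_map D euclidean h"
  proof (rule pasting_lemma_closed[where I = "{True, False}" and T = "\<lambda>i. if i then A else B"
        and f = "\<lambda>i x. if i then cis (pi * f x) else cis (- (pi * g x))"])
    show "closedin D (if i then A else B)" for i using closedA closedB by auto
    show "continuous_map (subtopology D (if i then A else B)) euclidean (\<lambda>x. if i then cis (pi * f x) else cis (- (pi * g x)))" for i
      using continuous_map_compose[OF f(1) c(1)] continuous_map_compose[OF g(1) c(2)] by (cases i) (auto simp: o_def)
    show "\<exists>j. j \<in> {True, False} \<and> x \<in> (if j then A else B) \<and> h x = (if j then cis (pi * f x) else cis (- (pi * g x)))"
      if "x \<in> topspace D" for x
    proof (cases "x \<in> A")
      case True
      then show ?thesis using hA[of x] by (intro exI[of _ True]) auto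
    next
      case False
      then have "x \<in> B" using that cover by blast
      then show ?thesis using hB[of x] by (intro exI[of _ False]) auto
    qed
    show "(if i then cis (pi * f x) else cis (- (pi * g x))) = (if j then cis (pi * f x) else cis (- (pi * g x)))"
      if "x \<in> topspace D \<inter> (if i then A else B) \<inter> (if j then A else B)" for i j x
      using that hA[of x] hB[of x] by (cases i; cases j) auto
  qed auto
  moreover have "h ` topspace D = sphere 0 1"
  proof
    show "h ` topspace D \<subseteq> sphere 0 1" by (auto simp: h_def)
    show "sphere 0 1 \<subseteq> h ` topspace D"
    proof
      fix z :: complex assume "z \<in> sphere 0 1"
      then obtain t where t: "0 \<le> t" "t \<le> 1" "z = cis (pi * t) \<or> z = cis (- (pi * t))"
        using cis_arcs_cover_circle[of z] by auto
      obtain x where x: "x \<in> A" "f x = t" using f(3) t(1,2) by (metis atLeastAtMost_iff imageE)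
      obtain y where y: "y \<in> B" "g y = t" using g(3) t(1,2) by (metis atLeastAtMost_iff imageE)
      have "z = h x \<or> z = h y" using hA[OF x(1)] hB[OF y(1)] x y t(3) by auto
      then show "z \<in> h ` topspace D" using x(1) y(1) cover by blast
    qed
  qed
  moreover have "inj_on h (topspace D)"
  proof (rule inj_onI)
    have f01: "0 \<le> f x" "f x \<le> 1" if "x \<in> A" for x using f(3) that by (metis atLeastAtMost_iff imageI)+
    have g01: "0 \<le> g x" "g x \<le> 1" if "x \<in> B" for x using g(3) that by (metis atLeastAtMost_iff imageI)+
    have mixed: "x = y" if x: "x \<in> A" and y: "y \<in> B" and e: "h x = h y" for x y
    proof -
      have "f x = g y \<and> (f x = 0 \<or> f x = 1)"
        using cis_upper_lower(2)[OF f01[OF x] g01[OF y]] e hA[OF x] hB[OF y] by metis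
      then have "(f x = f a \<and> g y = g a) \<or> (f x = f b \<and> g y = g b)" using f(4,5) g(4,5) by auto
      then show ?thesis using inj_onD[OF f(2)] inj_onD[OF g(2)] x y ends_in by metis
    qed
    have same: "x = y" if x: "x \<in> B" and y: "y \<in> B" and e: "h x = h y" for x y
    proof -
      have "cnj (h x) = cnj (h y)" using e by simp
      then have "cis (pi * g x) = cis (pi * g y)" using hB[OF x] hB[OF y] by (simp add: cis_cnj)
      then show ?thesis using cis_upper_lower(1)[OF g01[OF x] g01[OF y]] inj_onD[OF g(2)] x y by blast
    qed
    fix x y assume xy: "x \<in> topspace D" "y \<in> topspace D" and e: "h x = h y"
    have "x = y" if "x \<in> A" "y \<in> A"
      using cis_upper_lower(1)[OF f01[OF that(1)] f01[OF that(2)]] e hA that inj_onD[OF f(2)] by metis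
    moreover have "x \<in> A \<or> x \<in> B" "y \<in> A \<or> y \<in> B" using xy cover by blast+
    ultimately show "x = y" using mixed[of x y] mixed[of y x] same e by metis
  qed
  ultimately have "homeomorphic_map D (top_of_set (sphere (0::complex) 1)) h"
    using compact by (intro continuous_imp_homeomorphic_map)
      (auto simp: continuous_map_in_subtopology Hausdorff_space_subtopology)
  then show ?thesis by (rule homeomorphic_map_imp_homeomorphic_space)
qed

section \<open>Cut pairs of the circle\<close>

lemma connected_circle_minus_point:
  fixes p :: complex
  assumes p: "p \<in> sphere 0 1"
  shows "connected (sphere 0 1 - {p})"
proof -
  have p1: "norm p = 1" "p \<noteq> 0" using p by auto
  have "sphere 0 1 - {p} = (\<lambda>t. p * cis t) ` {0<..<2 * pi}"
  proof (intro equalityI subsetI)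
    fix z assume z: "z \<in> sphere 0 1 - {p}"
    define t where "t = Arg2pi (z / p)"
    have "norm (z / p) = 1" using z p1 by (simp add: norm_divide)
    then have e: "z / p = cis t" using Arg2pi_eq[of "z / p"] unfolding t_def by (simp add: cis_conv_exp)
    have "t \<noteq> 0" using e z p1 by auto
    then have "t \<in> {0<..<2 * pi}" using Arg2pi_ge_0[of "z / p"] Arg2pi_lt_2pi[of "z / p"] by (auto simp: t_def)
    moreover have "z = p * cis t" using e p1 by (simp add: field_simps)
    ultimately show "z \<in> (\<lambda>t. p * cis t) ` {0<..<2 * pi}" by blast
  next
    fix z assume "z \<in> (\<lambda>t. p * cis t) ` {0<..<2 * pi}"
    then obtain t where t: "0 < t" "t < 2 * pi" "z = p * cis t" by auto
    have "cis t \<noteq> 1"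
    proof
      assume "cis t = 1"
      then have "cos t = 1" by (simp add: complex_eq_iff)
      then obtain n :: int where n: "t = n * 2 * pi" by (auto simp: cos_one_2pi_int)
      have "0 < n" "n < 1" using t(1,2) n by (auto simp: zero_less_mult_iff)
      then show False by linarith
    qed
    then show "z \<in> sphere 0 1 - {p}" using t(3) p1 by (auto simp: norm_mult)
  qed
  then show ?thesis by (auto intro!: connected_continuous_image continuous_intros)
qed

text \<open>The expression \<open>Im ((z - p) * cnj (q - p))\<close> vanishes on the line through \<open>p\<close> and \<open>q\<close>, which meets the
  circle in no other points: a point \<open>p + s * (q - p)\<close> of norm 1 has \<open>s * (s - 1) = 0\<close>.\<close>
lemma chord_side_zero:
  fixes p q z :: complex
  assumes n: "norm p = 1" "norm q = 1" "norm z = 1" and pq: "p \<noteq> q"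
    and z: "Im ((z - p) * cnj (q - p)) = 0"
  shows "z = p \<or> z = q"
proof -
  define w where "w = (z - p) / (q - p)"
  have "Im w = Im ((z - p) * cnj (q - p)) / (norm (q - p))\<^sup>2"
    unfolding w_def by (simp add: complex_div_cnj[of "z - p"] del: complex_cnj_diff)
  then have "w = of_real (Re w)" using z by (simp add: complex_eq_iff)
  then obtain s :: real where s: "w = of_real s" by blast
  have zs: "z = p + of_real s * (q - p)" using s pq unfolding w_def by (simp add: field_simps)
  have "Re p ^ 2 + Im p ^ 2 = 1" "Re q ^ 2 + Im q ^ 2 = 1" "Re z ^ 2 + Im z ^ 2 = 1"
    using n by (auto simp: cmod_def)
  moreover have "Re z = Re p + s * (Re q - Re p)" "Im z = Im p + s * (Im q - Im p)" using zs by auto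
  ultimately have "s * (s - 1) * ((Re q - Re p)\<^sup>2 + (Im q - Im p)\<^sup>2) = 0" by algebra
  moreover have "(Re q - Re p)\<^sup>2 + (Im q - Im p)\<^sup>2 \<noteq> 0" using pq by (auto simp: complex_eq_iff sum_power2_eq_zero_iff)
  ultimately have "s = 0 \<or> s = 1" by auto
  then show ?thesis using zs by auto
qed

text \<open>The two points of the circle in the directions orthogonal to the chord. With \<open>d\<close> the length of
  the chord and \<open>t = Im (p * cnj q)\<close>, the expression has the values \<open>d - t\<close> and \<open>- d - t\<close> there.\<close>
lemma chord_has_two_sides:
  fixes p q :: complex
  assumes n: "norm p = 1" "norm q = 1" and pq: "p \<noteq> q"
  obtains y0 y1 where "norm y0 = 1" "norm y1 = 1"
    "Im ((y0 - p) * cnj (q - p)) > 0" "Im ((y1 - p) * cnj (q - p)) < 0"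
proof -
  define d where "d = norm (q - p)"
  have d: "d > 0" using pq by (simp add: d_def)
  define y where "y = \<i> * (q - p) / of_real d"
  have ny: "norm y = 1" using d by (simp add: y_def norm_mult norm_divide d_def)
  have P: "Re p ^ 2 + Im p ^ 2 = 1" "Re q ^ 2 + Im q ^ 2 = 1" using n by (auto simp: cmod_def)
  define r where "r = Re p * Re q + Im p * Im q"
  define t where "t = Im p * Re q - Re p * Im q"
  have d2: "d\<^sup>2 = 2 - 2 * r"
    using P unfolding d_def cmod_power2 r_def by (simp add: power2_eq_square algebra_simps)
  have r1: "r < 1" using d2 zero_less_power[OF d, of 2] by linarith
  have t2: "t\<^sup>2 = (1 - r) * (1 + r)"
    using P unfolding t_def r_def by algebra
  have "t\<^sup>2 < d\<^sup>2" unfolding d2 t2 using r1 mult_strict_left_mono[of "1 + r" 2 "1 - r"] by (simp add: algebra_simps)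
  then have td: "\<bar>t\<bar> < d" using d abs_le_square_iff[of d t] abs_of_pos[OF d] by linarith
  have ydn: "y * cnj (q - p) = of_real d * \<i>"
  proof -
    have "y * cnj (q - p) = \<i> * ((q - p) * cnj (q - p)) / of_real d" by (simp add: y_def)
    also have "(q - p) * cnj (q - p) = of_real (d\<^sup>2)" unfolding d_def by (rule complex_norm_square[symmetric])
    finally show ?thesis using d by (simp add: power2_eq_square)
  qed
  have pIm: "Im (p * cnj (q - p)) = t" by (simp add: t_def algebra_simps)
  have "Im ((y - p) * cnj (q - p)) = d - t" "Im ((- y - p) * cnj (q - p)) = - d - t"
    unfolding left_diff_distrib minus_mult_left[symmetric] ydn using pIm by auto
  then show thesis using that[of y "- y"] ny td by auto
qed

text \<open>The side of a chord, pulled back to \<open>D\<close>, is a continuous real function that vanishes only at the two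
  points of the pair and takes both signs. So no connected set in the complement contains points with
  different signs, and two such points form a crossing pair.\<close>
theorem circle_imp_crossed_cut_pairs:
  fixes D :: "'p topology"
  assumes circle: "D homeomorphic_space top_of_set (sphere (0::complex) 1)"
  shows "connected_space D" "\<nexists>x. cut_point D x" "\<exists>P. cut_pair D P"
    "\<And>P. cut_pair D P \<Longrightarrow> \<exists>Q. cut_pair D Q \<and> crosses D Q P"
proof -
  obtain h k where hk: "homeomorphic_maps D (top_of_set (sphere (0::complex) 1)) h k"
    using circle unfolding homeomorphic_space_def by blast
  then have h: "continuous_map D (top_of_set (sphere 0 1)) h" and k: "continuous_map (top_of_set (sphere 0 1)) D k"
    and kh: "\<And>x. x \<in> topspace D \<Longrightarrow> k (h x) = x" and hk': "\<And>z. z \<in> sphere 0 1 \<Longrightarrow> h (k z) = z"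
    unfolding homeomorphic_maps_def by auto
  have hS: "h x \<in> sphere 0 1" if "x \<in> topspace D" for x using h that unfolding continuous_map_def by auto
  have kX: "k z \<in> topspace D" if "z \<in> sphere 0 1" for z using k that unfolding continuous_map_def by auto
  have kimg: "k ` (sphere 0 1 - h ` S) = topspace D - S" if "S \<subseteq> topspace D" for S
  proof (intro equalityI subsetI)
    fix x assume "x \<in> k ` (sphere 0 1 - h ` S)"
    then obtain z where "z \<in> sphere 0 1" "z \<notin> h ` S" "x = k z" by blast
    then show "x \<in> topspace D - S" using kX hk' by (metis DiffI imageI)
  next
    fix x assume "x \<in> topspace D - S"
    then have x: "x \<in> topspace D" "x \<notin> S" by auto
    then have "h x \<in> sphere 0 1 - h ` S" using hS kh that by (metis DiffI imageE subsetD)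
    then show "x \<in> k ` (sphere 0 1 - h ` S)" using kh[OF x(1)] by (metis imageI)
  qed
  have img: "connectedin D (k ` C)" if "connected C" "C \<subseteq> sphere 0 1" for C
    using that by (intro connectedin_continuous_map_image[OF k]) (auto simp: connectedin_subtopology)
  have "connected (sphere (0::complex) 1)" by (rule connected_sphere) simp
  then show conn: "connected_space D" using img[of "sphere 0 1"] kimg[of "{}"] by (simp add: connectedin_topspace)
  show nocut: "\<nexists>x. cut_point D x"
  proof
    assume "\<exists>x. cut_point D x"
    then obtain x where x: "x \<in> topspace D" "\<not> connectedin D (topspace D - {x})"
      unfolding cut_point_def connectedin_def by auto
    have "connectedin D (k ` (sphere 0 1 - {h x}))"
      using hS[OF x(1)] by (intro img connected_circle_minus_point) auto
    then show False using x kimg[of "{x}"] by simp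
  qed
  have pair: "cut_pair D {x0, x1} \<and> (\<exists>y0 y1. y0 \<noteq> y1 \<and> y0 \<in> topspace D \<and> y1 \<in> topspace D \<and> crosses D {y0, y1} {x0, x1})"
    if x: "x0 \<in> topspace D" "x1 \<in> topspace D" "x0 \<noteq> x1" for x0 x1
  proof -
    define p where "p = h x0"
    define q where "q = h x1"
    have pq: "norm p = 1" "norm q = 1" using hS[OF x(1)] hS[OF x(2)] by (auto simp: p_def q_def)
    have pq: "norm p = 1" "norm q = 1" "p \<noteq> q" using pq kh[OF x(1)] kh[OF x(2)] x(3) by (auto simp: p_def q_def)
    define \<phi> where "\<phi> z = Im ((z - p) * cnj (q - p))" for z
    obtain z0 z1 where z: "norm z0 = 1" "norm z1 = 1" "\<phi> z0 > 0" "\<phi> z1 < 0"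
      using chord_has_two_sides[OF pq] unfolding \<phi>_def by metis
    have zS: "z0 \<in> sphere 0 1" "z1 \<in> sphere 0 1" using z by auto
    define y0 where "y0 = k z0"
    define y1 where "y1 = k z1"
    have hy: "h y0 = z0" "h y1 = z1" using hk' zS by (auto simp: y0_def y1_def)
    have \<phi>0: "\<phi> p = 0" "\<phi> q = 0" by (simp_all add: \<phi>_def algebra_simps)
    have "y0 \<noteq> x0" "y0 \<noteq> x1" "y1 \<noteq> x0" "y1 \<noteq> x1" "y0 \<noteq> y1"
      using z(3,4) \<phi>0 hy by (auto simp: p_def q_def)
    moreover have yX: "y0 \<in> topspace D" "y1 \<in> topspace D" using kX zS by (auto simp: y0_def y1_def)
    ultimately have y: "y0 \<in> topspace D - {x0, x1}" "y1 \<in> topspace D - {x0, x1}" "y0 \<noteq> y1" by auto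
    let ?Y = "subtopology D (topspace D - {x0, x1})"
    have "continuous_map D euclidean h" using h by (simp add: continuous_map_in_subtopology)
    moreover have "continuous_map euclidean euclideanreal \<phi>"
      unfolding \<phi>_def by (auto intro!: continuous_intros)
    ultimately have cont: "continuous_map D euclideanreal (\<phi> \<circ> h)" by (rule continuous_map_compose)
    have sep: False if C: "connectedin ?Y C" "y0 \<in> C" "y1 \<in> C" for C
    proof -
      have "connectedin D C" "C \<subseteq> topspace D - {x0, x1}" using C(1) by (auto simp: connectedin_subtopology)
      then have "connected ((\<phi> \<circ> h) ` C)" using connectedin_continuous_map_image[OF cont] by auto
      then have "{\<phi> z1..\<phi> z0} \<subseteq> (\<phi> \<circ> h) ` C"
        using C(2,3) hy connected_contains_Icc by (metis comp_apply imageI)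
      moreover have "0 \<in> {\<phi> z1..\<phi> z0}" using z(3,4) by simp
      ultimately have "0 \<in> (\<phi> \<circ> h) ` C" by blast
      then obtain c where c: "c \<in> C" "\<phi> (h c) = 0" by auto
      then have cX: "c \<in> topspace D - {x0, x1}" using \<open>C \<subseteq> topspace D - {x0, x1}\<close> by blast
      then have "h c = p \<or> h c = q"
        using chord_side_zero[OF pq(1,2) _ pq(3), of "h c"] c(2) hS[of c] unfolding \<phi>_def by auto
      then have "c = x0 \<or> c = x1" using kh x cX unfolding p_def q_def by (metis DiffD1)
      then show False using cX by blast
    qed
    have tY: "topspace ?Y = topspace D - {x0, x1}" by auto
    have "\<not> connected_space ?Y"
    proof
      assume "connected_space ?Y"
      then have "connectedin ?Y (topspace ?Y)" by (simp only: connectedin_topspace)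
      then show False by (rule sep) (simp_all only: tY y)
    qed
    then have 1: "cut_pair D {x0, x1}" unfolding cut_pair_def using x nocut by blast
    have in0: "y0 \<in> connected_component_of_set ?Y y0" "y1 \<in> connected_component_of_set ?Y y1"
      using y tY by (simp_all add: connected_component_of_refl)
    have "connected_component_of_set ?Y y0 \<noteq> connected_component_of_set ?Y y1"
      using sep[OF connectedin_connected_component_of] in0 by metis
    moreover have "connected_component_of_set ?Y y0 \<in> connected_components_of ?Y"
      "connected_component_of_set ?Y y1 \<in> connected_components_of ?Y"
      using y tY by (simp_all add: connected_component_in_connected_components_of)
    ultimately have "crosses D {y0, y1} {x0, x1}"
      unfolding crosses_def using in0
      by (intro exI[of _ y0] exI[of _ y1] conjI refl
          bexI[of _ "connected_component_of_set ?Y y0"] bexI[of _ "connected_component_of_set ?Y y1"])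
    then show ?thesis using 1 y(3) yX by blast
  qed
  show "\<exists>P. cut_pair D P"
  proof -
    have "k 1 \<noteq> k (-1)" using hk'[of 1] hk'[of "-1"] by auto
    then show ?thesis using pair[of "k 1" "k (-1)"] kX[of 1] kX[of "-1"] by auto
  qed
  show "\<exists>Q. cut_pair D Q \<and> crosses D Q P" if "cut_pair D P" for P
  proof -
    obtain x0 x1 where x: "P = {x0, x1}" "x0 \<in> topspace D" "x1 \<in> topspace D" "x0 \<noteq> x1"
      using \<open>cut_pair D P\<close> unfolding cut_pair_def by blast
    then show ?thesis using pair[OF x(2-4)] pair by metis
  qed
qed

section \<open>Reduced words and Gromov products\<close>

definition flip :: "'a \<times> bool \<Rightarrow> 'a \<times> bool" where "flip l = (fst l, \<not> snd l)"

definition inv_word :: "('a \<times> bool) list \<Rightarrow> ('a \<times> bool) list" where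
  "inv_word u = rev (map flip u)"

lemma flip_flip [simp]: "flip (flip l) = l" by (simp add: flip_def)

lemma flip_neq [simp]: "flip l \<noteq> l" "l \<noteq> flip l" by (auto simp: flip_def prod_eq_iff)

lemma flip_eq_iff [simp]: "flip k = flip l \<longleftrightarrow> k = l" by (auto simp: flip_def prod_eq_iff)

lemma inv_word_simps [simp]:
  "inv_word [] = []" "inv_word (l # u) = inv_word u @ [flip l]" "inv_word (u @ v) = inv_word v @ inv_word u"
  "inv_word (inv_word u) = u" "length (inv_word u) = length u" "inv_word u = [] \<longleftrightarrow> u = []"
  by (auto simp: inv_word_def rev_map o_def)

lemma reduced_word_flip: "reduced_word u \<longleftrightarrow> successively (\<lambda>k l. l \<noteq> flip k) u"
proof -
  have "(\<lambda>k l. \<not> (fst k = fst l \<and> snd k \<noteq> snd l)) = (\<lambda>k l :: 'a \<times> bool. l \<noteq> flip k)"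
    by (auto simp: fun_eq_iff flip_def prod_eq_iff)
  then show ?thesis unfolding reduced_word_def by (rule arg_cong)
qed

lemma reduced_word_append:
  "reduced_word (u @ v) \<longleftrightarrow> reduced_word u \<and> reduced_word v \<and> (u = [] \<or> v = [] \<or> hd v \<noteq> flip (last u))"
  by (auto simp: reduced_word_flip successively_append_iff)

lemma reduced_word_Nil [simp]: "reduced_word []" by (simp add: reduced_word_def)

lemma reduced_word_single [simp]: "reduced_word [l]" by (simp add: reduced_word_def)

lemma reduced_word_Cons: "reduced_word (l # u) \<longleftrightarrow> reduced_word u \<and> (u = [] \<or> hd u \<noteq> flip l)"
  using reduced_word_append[of "[l]" u] by auto

lemma reduced_word_inv [simp]: "reduced_word (inv_word u) \<longleftrightarrow> reduced_word u"
proof -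
  have "reduced_word (inv_word u)" if "reduced_word u" for u :: "('a \<times> bool) list"
    using that
  proof (induction u)
    case (Cons l u)
    then have "reduced_word (inv_word u)" by (simp add: reduced_word_Cons)
    moreover have "u = [] \<or> last (inv_word u) = flip (hd u)" by (cases u) (auto simp: inv_word_def)
    ultimately show ?case using Cons.prems by (auto simp: reduced_word_append reduced_word_Cons)
  qed simp
  from this[of u] this[of "inv_word u"] show ?thesis by auto
qed

text \<open>The word \<open>c\<close> is what cancels in the product of \<open>u\<close> and \<open>v\<close>.\<close>
lemma cancel_at_junction:
  assumes "reduced_word u" "reduced_word v"
  obtains a b c where "u = a @ c" "v = inv_word c @ b" "reduced_word (a @ b)"
  using assms
proof (induction u arbitrary: v thesis rule: rev_induct)
  case (snoc l u)
  show ?case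
  proof (cases "v = [] \<or> hd v \<noteq> flip l")
    case True
    then have "reduced_word ((u @ [l]) @ v)" using snoc.prems(2,3)
      unfolding reduced_word_append[of "u @ [l]" v] by auto
    then show ?thesis using snoc.prems(1)[of "u @ [l]" "[]" v] by simp
  next
    case False
    then obtain v' where v: "v = flip l # v'" by (cases v) auto
    have "reduced_word u" "reduced_word v'" using snoc.prems(2,3) v by (auto simp: reduced_word_append reduced_word_Cons)
    then obtain a b c where "u = a @ c" "v' = inv_word c @ b" "reduced_word (a @ b)" using snoc.IH by metis
    then show ?thesis using snoc.prems(1)[of a "c @ [l]" b] v by simp
  qed
qed (use that in fastforce)

lemma split_common_prefix:
  obtains p a b where "u = p @ a" "v = p @ b" "a = [] \<or> b = [] \<or> hd a \<noteq> hd b"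
proof -
  have "\<exists>p a b. u = p @ a \<and> v = p @ b \<and> (a = [] \<or> b = [] \<or> hd a \<noteq> hd b)"
  proof (induction u arbitrary: v)
    case (Cons x u)
    show ?case
    proof (cases "v = [] \<or> hd v \<noteq> x")
      case True
      then show ?thesis by (intro exI[of _ "[]"] exI[of _ "x # u"] exI[of _ v]) auto
    next
      case False
      then obtain v' where v: "v = x # v'" by (cases v) auto
      obtain p a b where "u = p @ a" "v' = p @ b" "a = [] \<or> b = [] \<or> hd a \<noteq> hd b" using Cons by meson
      then show ?thesis using v by (intro exI[of _ "x # p"] exI[of _ a] exI[of _ b]) auto
    qed
  qed auto
  then show thesis using that by blast
qed

locale based_free_group = group F for F :: "('a, 'b) monoid_scheme" (structure) +
  fixes X :: "'a set"
  assumes basis: "free_basis F X" and finX: "finite X"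
begin

abbreviation "val \<equiv> word_value F"
abbreviation "len \<equiv> word_length F X"
abbreviation "gp \<equiv> gromov_product F X"

lemma words_append [simp]: "u @ v \<in> words X \<longleftrightarrow> u \<in> words X \<and> v \<in> words X"
  by (auto simp: words_def)

lemma words_Cons [simp]: "l # u \<in> words X \<longleftrightarrow> fst l \<in> X \<and> u \<in> words X"
  by (cases l) (auto simp: words_def)

lemma words_Nil [simp]: "[] \<in> words X" by (auto simp: words_def)

lemma words_inv [simp]: "inv_word u \<in> words X \<longleftrightarrow> u \<in> words X"
  by (induction u) (auto simp: flip_def)

lemma letter_closed [simp]: "fst l \<in> X \<Longrightarrow> letter_value F l \<in> carrier F"
  using basis by (auto simp: letter_value_def free_basis_def)

lemma letter_flip: "fst l \<in> X \<Longrightarrow> letter_value F (flip l) = inv (letter_value F l)"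
  using basis by (auto simp: letter_value_def flip_def free_basis_def)

lemma val_Nil [simp]: "val [] = \<one>" by (simp add: word_value_def)

lemma val_Cons [simp]: "val (l # u) = letter_value F l \<otimes> val u" by (simp add: word_value_def)

lemma val_closed [simp]: "u \<in> words X \<Longrightarrow> val u \<in> carrier F"
  by (induction u) auto

lemma val_append [simp]: "\<lbrakk>u \<in> words X; v \<in> words X\<rbrakk> \<Longrightarrow> val (u @ v) = val u \<otimes> val v"
  by (induction u) (auto simp: m_assoc)

lemma val_inv [simp]: "u \<in> words X \<Longrightarrow> val (inv_word u) = inv (val u)"
proof (induction u)
  case (Cons l u)
  then have "val (inv_word (l # u)) = val (inv_word u) \<otimes> val [flip l]"
    by (simp add: flip_def)
  also have "\<dots> = inv (val u) \<otimes> inv (letter_value F l)" using Cons by (simp add: letter_flip)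
  finally show ?case using Cons by (simp add: inv_mult_group)
qed simp

lemma reduce_word:
  assumes "u \<in> words X"
  shows "\<exists>v\<in>words X. reduced_word v \<and> val v = val u \<and> length v \<le> length u"
  using assms
proof (induction u)
  case (Cons l u)
  then obtain v where v: "v \<in> words X" "reduced_word v" "val v = val u" "length v \<le> length u" by auto
  show ?case
  proof (cases "v = [] \<or> hd v \<noteq> flip l")
    case True
    then show ?thesis using v Cons.prems by (intro bexI[of _ "l # v"]) (auto simp: reduced_word_Cons)
  next
    case False
    then obtain v' where v': "v = flip l # v'" by (cases v) auto
    have "val (l # u) = letter_value F l \<otimes> (inv (letter_value F l) \<otimes> val v')"
      using v v' Cons.prems by (simp add: letter_flip flip_def[of l, THEN arg_cong, of fst, simplified])
    also have "\<dots> = val v'" using v v' Cons.prems by (simp add: m_assoc[symmetric])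
    finally show ?thesis using v v' by (intro bexI[of _ v']) (auto simp: reduced_word_Cons)
  qed
qed auto

definition rep :: "'a \<Rightarrow> ('a \<times> bool) list" where
  "rep g = (THE u. u \<in> words X \<and> reduced_word u \<and> val u = g)"

lemma rep_ex1: "g \<in> carrier F \<Longrightarrow> \<exists>!u. u \<in> words X \<and> reduced_word u \<and> val u = g"
  using basis by (simp add: free_basis_def)

lemma rep [simp]:
  assumes "g \<in> carrier F"
  shows "rep g \<in> words X" "reduced_word (rep g)" "val (rep g) = g"
  using theI'[OF rep_ex1[OF assms]] unfolding rep_def by auto

lemma rep_val [simp]: "\<lbrakk>u \<in> words X; reduced_word u\<rbrakk> \<Longrightarrow> rep (val u) = u"
  using rep_ex1[of "val u"] rep[of "val u"] val_closed by blast

lemma len_rep: "g \<in> carrier F \<Longrightarrow> len g = length (rep g)"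
  unfolding word_length_def
proof (rule Least_equality)
  assume g: "g \<in> carrier F"
  show "\<exists>u\<in>words X. length u = length (rep g) \<and> val u = g" using g by (intro bexI[of _ "rep g"]) auto
  fix n assume "\<exists>u\<in>words X. length u = n \<and> val u = g"
  then obtain u where u: "u \<in> words X" "length u = n" "val u = g" by blast
  obtain v where "v \<in> words X" "reduced_word v" "val v = val u" "length v \<le> length u" using reduce_word[OF u(1)] by blast
  then show "length (rep g) \<le> n" using u rep_val by metis
qed

lemma len_val_le: "u \<in> words X \<Longrightarrow> len (val u) \<le> length u"
  using reduce_word[of u] rep_val len_rep val_closed by metis

lemma len_val: "\<lbrakk>u \<in> words X; reduced_word u\<rbrakk> \<Longrightarrow> len (val u) = length u"
  by (simp add: len_rep)

lemma len_one [simp]: "len \<one> = 0"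
  using len_val[of "[]"] by simp

lemma len_mult: "\<lbrakk>g \<in> carrier F; h \<in> carrier F\<rbrakk> \<Longrightarrow> len (g \<otimes> h) \<le> len g + len h"
  using len_val_le[of "rep g @ rep h"] by (simp add: len_rep)

lemma rep_inv: "g \<in> carrier F \<Longrightarrow> rep (inv g) = inv_word (rep g)"
  using rep_val[of "inv_word (rep g)"] by simp

lemma len_inv [simp]: "g \<in> carrier F \<Longrightarrow> len (inv g) = len g"
  by (simp add: len_rep rep_inv)

lemma finite_ball: "finite {g \<in> carrier F. len g \<le> N}"
proof -
  have "{g \<in> carrier F. len g \<le> N} \<subseteq> val ` {u. set u \<subseteq> X \<times> UNIV \<and> length u \<le> N}"
  proof
    fix g assume "g \<in> {g \<in> carrier F. len g \<le> N}"
    then have g: "g \<in> carrier F" "length (rep g) \<le> N" by (auto simp: len_rep)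
    moreover have "set (rep g) \<subseteq> X \<times> UNIV" using rep(1)[OF g(1)] by (auto simp: words_def lists_eq_set)
    ultimately show "g \<in> val ` {u. set u \<subseteq> X \<times> UNIV \<and> length u \<le> N}"
      using rep(3)[OF g(1)] by (metis (mono_tags, lifting) imageI mem_Collect_eq)
  qed
  moreover have "finite {u. set u \<subseteq> X \<times> (UNIV :: bool set) \<and> length u \<le> N}"
    using finX by (intro finite_lists_length_le) auto
  ultimately show ?thesis using finite_surj by blast
qed

text \<open>After the common prefix is cancelled, the first letters of the remainders differ, so no further
  cancellation takes place.\<close>
lemma reduced_quotient:
  assumes g: "g \<in> carrier F" "h \<in> carrier F"
    and e: "rep g = p @ a" "rep h = p @ b" "a = [] \<or> b = [] \<or> hd a \<noteq> hd b"
  shows "rep (inv g \<otimes> h) = inv_word a @ b" "gp g h = real (length p)"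
proof -
  have w: "p \<in> words X" "a \<in> words X" "b \<in> words X" using rep(1)[OF g(1)] rep(1)[OF g(2)] e by auto
  have r: "reduced_word a" "reduced_word b" using rep(2)[OF g(1)] rep(2)[OF g(2)] e by (auto simp: reduced_word_append)
  have "a = [] \<or> last (inv_word a) = flip (hd a)" by (cases a) auto
  then have red: "reduced_word (inv_word a @ b)" using r e(3) by (auto simp: reduced_word_append)
  have gh: "g = val p \<otimes> val a" "h = val p \<otimes> val b" using rep(3)[OF g(1)] rep(3)[OF g(2)] e w by auto
  have "inv g \<otimes> h = inv (val a) \<otimes> (inv (val p) \<otimes> (val p \<otimes> val b))"
    using gh w by (simp add: inv_mult_group m_assoc)
  also have "\<dots> = inv (val a) \<otimes> val b" using w by (simp add: m_assoc[symmetric])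
  also have "\<dots> = val (inv_word a @ b)" using w by simp
  finally show 1: "rep (inv g \<otimes> h) = inv_word a @ b" using red w by (metis rep_val words_append words_inv)
  then have "len (inv g \<otimes> h) = length a + length b" using g by (simp add: len_rep)
  then show "gp g h = real (length p)" using g e by (simp add: gromov_product_def len_rep)
qed

lemma gp_ge_iff:
  assumes g: "g \<in> carrier F" "h \<in> carrier F"
  shows "real n \<le> gp g h \<longleftrightarrow> n \<le> len g \<and> n \<le> len h \<and> take n (rep g) = take n (rep h)"
proof -
  obtain p a b where e: "rep g = p @ a" "rep h = p @ b" "a = [] \<or> b = [] \<or> hd a \<noteq> hd b"
    using split_common_prefix by metis
  have l: "len g = length p + length a" "len h = length p + length b" using g e by (auto simp: len_rep)
  show ?thesis
    unfolding reduced_quotient(2)[OF g e] l e of_nat_le_iff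
  proof (intro iffI)
    assume n: "n \<le> length p + length a \<and> n \<le> length p + length b \<and> take n (p @ a) = take n (p @ b)"
    show "n \<le> length p"
    proof (rule ccontr)
      assume "\<not> n \<le> length p"
      then obtain m where m: "n = length p + Suc m" by (metis add_Suc_right less_imp_Suc_add linorder_not_less)
      then have ab: "a \<noteq> []" "b \<noteq> []" using n by auto
      have "take (Suc m) a = take (Suc m) b" using n m by simp
      then have "hd a = hd b" using ab by (cases a; cases b) auto
      then show False using ab e(3) by blast
    qed
  qed auto
qed

lemma gp_nat: "\<lbrakk>g \<in> carrier F; h \<in> carrier F\<rbrakk> \<Longrightarrow> \<exists>m::nat. gp g h = real m"
  using split_common_prefix[of "rep g" "rep h"] reduced_quotient(2)[of g h] by metis

lemma gp_sym: "\<lbrakk>g \<in> carrier F; h \<in> carrier F\<rbrakk> \<Longrightarrow> gp g h = gp h g"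
proof -
  assume g: "g \<in> carrier F" "h \<in> carrier F"
  have "inv g \<otimes> h = inv (inv h \<otimes> g)" using g by (simp add: inv_mult_group)
  then show ?thesis using g by (simp add: gromov_product_def)
qed

lemma gp_perturb:
  assumes "g \<in> carrier F" "h \<in> carrier F" "x \<in> carrier F"
  shows "gp (g \<otimes> x) h \<ge> gp g h - len x"
proof -
  have "g = (g \<otimes> x) \<otimes> inv x" using assms by (simp add: m_assoc)
  then have "len g \<le> len (g \<otimes> x) + len x" using len_mult[of "g \<otimes> x" "inv x"] assms by simp
  moreover have "inv (g \<otimes> x) \<otimes> h = inv x \<otimes> (inv g \<otimes> h)" using assms by (simp add: inv_mult_group m_assoc)
  then have "len (inv (g \<otimes> x) \<otimes> h) \<le> len x + len (inv g \<otimes> h)"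
    using len_mult[of "inv x" "inv g \<otimes> h"] assms by simp
  ultimately show ?thesis unfolding gromov_product_def by (simp add: field_simps)
qed

text \<open>Each vertex on the geodesic from \<open>\<one>\<close> to \<open>v [^] i\<close> lies on the path that spells the word of \<open>v\<close> \<open>i\<close> times,
  hence within distance \<open>len v\<close> of some power of \<open>v\<close>.\<close>
lemma prefix_of_power:
  assumes v: "v \<in> carrier F" and c: "rep (v [^] (i::nat)) = c @ b"
  shows "\<exists>k\<le>i. \<exists>s\<in>carrier F. val c = v [^] k \<otimes> s \<and> len s \<le> len v"
  using c
proof (induction i arbitrary: c b)
  case 0
  have "rep \<one> = []" using rep_val[of "[]"] by simp
  then show ?case using 0 v by auto
next
  case (Suc i)
  have vi: "v [^] i \<in> carrier F" using v by simp
  obtain a y d where e: "rep v = a @ d" "rep (v [^] i) = inv_word d @ y" "reduced_word (a @ y)"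
    using cancel_at_junction[OF rep(2)[OF v] rep(2)[OF vi]] by metis
  have w: "a \<in> words X" "d \<in> words X" "y \<in> words X" using rep(1)[OF v] rep(1)[OF vi] e by auto
  have ved: "v = val a \<otimes> val d" "v [^] i = inv (val d) \<otimes> val y" using rep(3)[OF v] rep(3)[OF vi] e w by auto
  have va: "val a = v \<otimes> inv (val d)" using ved(1) w v by (simp add: m_assoc)
  have "v [^] Suc i = v \<otimes> v [^] i" using v nat_pow_Suc2 by blast
  also have "\<dots> = (val a \<otimes> val d) \<otimes> (inv (val d) \<otimes> val y)" using ved by metis
  also have "\<dots> = val a \<otimes> ((val d \<otimes> inv (val d)) \<otimes> val y)"
    using w by (simp only: m_assoc m_closed inv_closed val_closed)
  also have "\<dots> = val (a @ y)" using w by simp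
  finally have "rep (v [^] Suc i) = a @ y" using w e(3) by (metis rep_val words_append)
  then have "a @ y = c @ b" using Suc.prems by simp
  then consider us where "a = c @ us" | us where "c = a @ us" "y = us @ b"
    by (auto simp: append_eq_append_conv2)
  then show ?case
  proof cases
    case 1
    have cw: "c \<in> words X" using w 1 by simp
    have "len (val c) \<le> len v" using len_val_le[OF cw] e(1) 1 v by (simp add: len_rep)
    then show ?thesis using cw v by (intro exI[of _ 0] conjI bexI[of _ "val c"]) auto
  next
    case 2
    have uw: "us \<in> words X" using w 2 by simp
    have "rep (v [^] i) = (inv_word d @ us) @ b" using e 2 by simp
    then obtain k s where k: "k \<le> i" "s \<in> carrier F" "val (inv_word d @ us) = v [^] k \<otimes> s" "len s \<le> len v"
      using Suc.IH by blast
    have "val c = v \<otimes> inv (val d) \<otimes> val us" using 2 va w uw by simp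
    also have "\<dots> = v \<otimes> val (inv_word d @ us)" using w uw v by (simp add: m_assoc)
    also have "\<dots> = v [^] Suc k \<otimes> s" using k v nat_pow_Suc2[OF v] by (simp add: m_assoc)
    finally show ?thesis using k by (intro exI[of _ "Suc k"]) auto
  qed
qed

text \<open>The Gromov product is the distance from \<open>\<one>\<close> to the geodesic between the two points, and each vertex of
  this geodesic is close to some \<open>g \<otimes> v [^] k\<close> by \<open>prefix_of_power\<close>. This single estimate controls both the
  convergence of \<open>g \<otimes> v [^] i\<close> and the position of the line through these points.\<close>
lemma gp_along_powers:
  assumes g: "g \<in> carrier F" and v: "v \<in> carrier F"
  shows "\<exists>k\<le>i. gp g (g \<otimes> v [^] (i::nat)) \<ge> real (len (g \<otimes> v [^] k)) - real (len v)"
proof -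
  have vi: "v [^] i \<in> carrier F" using v by simp
  obtain c a b where e: "rep (inv g) = c @ a" "rep (v [^] i) = c @ b" "a = [] \<or> b = [] \<or> hd a \<noteq> hd b"
    using split_common_prefix by metis
  have w: "c \<in> words X" "a \<in> words X" "b \<in> words X" using rep(1)[of "inv g"] g rep(1)[OF vi] e by auto
  have "reduced_word a" using rep(2)[of "inv g"] g e by (simp add: reduced_word_append)
  then have la: "len (val a) = length a" using w len_val by simp
  have lg: "len g = length c + length a" using e(1) g len_rep[of "inv g"] by simp
  have lv: "len (v [^] i) = length c + length b" using e(2) vi by (simp add: len_rep)
  have "rep (inv (inv g) \<otimes> v [^] i) = inv_word a @ b" using reduced_quotient(1)[OF _ vi e] g by simp
  then have "len (g \<otimes> v [^] i) = length a + length b" using g vi by (simp add: len_rep)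
  moreover have "inv g \<otimes> (g \<otimes> v [^] i) = v [^] i" using g vi by (simp add: m_assoc[symmetric])
  ultimately have gp: "gp g (g \<otimes> v [^] i) = real (length a)" unfolding gromov_product_def by (simp add: lg lv)
  obtain k s where k: "k \<le> i" "s \<in> carrier F" "val c = v [^] k \<otimes> s" "len s \<le> len v"
    using prefix_of_power[OF v e(2)] by blast
  have "inv g = val c \<otimes> val a" using rep(3)[of "inv g"] g e w by simp
  then have "g = inv (val c \<otimes> val a)" using g by (metis inv_inv)
  then have "g \<otimes> val c = inv (val a) \<otimes> (inv (val c) \<otimes> val c)" using w by (simp add: inv_mult_group m_assoc)
  then have gc: "g \<otimes> val c = inv (val a)" using w by simp
  have "g \<otimes> v [^] k = (g \<otimes> val c) \<otimes> inv s" using k g v by (simp add: m_assoc)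
  then have "len (g \<otimes> v [^] k) \<le> len (g \<otimes> val c) + len (inv s)"
    using len_mult[of "g \<otimes> val c" "inv s"] m_closed[OF g val_closed[OF w(1)]] k(2) inv_closed[OF k(2)] by metis
  then have "len (g \<otimes> v [^] k) \<le> length a + len v" using gc la w k by simp
  then show ?thesis using k(1) gp by (intro exI[of _ k]) auto
qed

lemma reduced_word_power:
  assumes "reduced_word (r @ r)"
  shows "reduced_word (concat (replicate m r))"
proof (induction m)
  case (Suc m)
  have "m = 0 \<or> r = [] \<or> hd (concat (replicate m r)) = hd r" by (cases m; cases r) auto
  then show ?case using Suc assms by (cases "m = 0") (auto simp: reduced_word_append)
qed simp

text \<open>A shortest conjugate \<open>u\<close> of \<open>v\<close> is cyclically reduced, since otherwise conjugating by its last letter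
  would shorten it. Then the powers of its word are reduced as they stand.\<close>
lemma torsion_free:
  assumes v: "v \<in> carrier F" "v [^] (m::nat) = \<one>" "m > 0"
  shows "v = \<one>"
proof -
  define P where "P u \<longleftrightarrow> (\<exists>x\<in>carrier F. u = x \<otimes> v \<otimes> inv x)" for u
  have "P v" unfolding P_def using v(1) by (intro bexI[of _ \<one>]) auto
  then obtain u where u: "P u" and mn: "\<And>u'. P u' \<Longrightarrow> len u \<le> len u'"
    using ex_has_least_nat[of P v len] by blast
  obtain x where x: "x \<in> carrier F" "u = x \<otimes> v \<otimes> inv x" using u P_def by blast
  have uc: "u \<in> carrier F" using x v by simp
  have upow: "u [^] k = x \<otimes> v [^] k \<otimes> inv x" for k :: nat
  proof (induction k)
    case (Suc k)
    have "u [^] Suc k = (x \<otimes> v [^] k \<otimes> inv x) \<otimes> (x \<otimes> v \<otimes> inv x)" using Suc x by simp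
    also have "\<dots> = x \<otimes> v [^] k \<otimes> ((inv x \<otimes> x) \<otimes> (v \<otimes> inv x))" using x(1) v(1) by (simp only: m_assoc m_closed inv_closed nat_pow_closed)
    also have "\<dots> = x \<otimes> v [^] Suc k \<otimes> inv x" using x(1) v(1) by (simp add: m_assoc)
    finally show ?case .
  qed (use x in auto)
  have um: "u [^] m = \<one>" using upow v x by simp
  define r where "r = rep u"
  have rw: "r \<in> words X" "reduced_word r" "val r = u" using uc by (auto simp: r_def)
  have "reduced_word (r @ r)"
  proof (rule ccontr)
    assume n: "\<not> reduced_word (r @ r)"
    then have ne: "r \<noteq> []" "hd r = flip (last r)" using rw(2) by (auto simp: reduced_word_append)
    then obtain l r' where l: "r = l # r'" by (cases r) auto
    have "r' \<noteq> []" using ne l by auto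
    then obtain r'' l' where l': "r' = r'' @ [l']" by (metis rev_exhaust)
    have ll: "l = flip l'" "r = l # r'' @ [l']" using ne l l' by auto
    then have lX: "fst l' \<in> X" "r'' \<in> words X" using rw(1) by (auto simp: flip_def)
    define y where "y = letter_value F l'"
    have y: "y \<in> carrier F" using lX y_def by simp
    have "u = inv y \<otimes> val r'' \<otimes> y"
      using rw(3) ll lX y by (simp add: letter_flip y_def m_assoc)
    then have "val r'' = y \<otimes> u \<otimes> inv y" using y lX by (simp add: m_assoc[symmetric]) (simp add: m_assoc)
    also have "\<dots> = (y \<otimes> x) \<otimes> v \<otimes> inv (y \<otimes> x)" using y x v by (simp add: inv_mult_group m_assoc)
    finally have "P (val r'')" unfolding P_def using y x by blast
    then have "len u \<le> len (val r'')" using mn by blast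
    also have "\<dots> \<le> length r''" using len_val_le lX by blast
    finally show False using uc ll(2) by (simp add: len_rep r_def[symmetric])
  qed
  then have red: "reduced_word (concat (replicate m r))" by (rule reduced_word_power)
  have cw: "concat (replicate k r) \<in> words X \<and> val (concat (replicate k r)) = u [^] k" for k
  proof (induction k)
    case (Suc k)
    then show ?case using rw uc nat_pow_Suc2[OF uc] by simp
  qed simp
  have "concat (replicate m r) = []" using rep_val[OF _ red] cw[of m] um rep_val[of "[]"] by simp
  then have "r = []" using v(3) by auto
  then have "u = \<one>" using rw(3) by simp
  then have "x \<otimes> v \<otimes> inv x = \<one>" using x by simp
  then have "v = inv x \<otimes> \<one> \<otimes> x" using x(1) v(1) by (metis inv_solve_right' inv_closed m_assoc m_closed one_closed r_one inv_inv l_inv l_one r_inv)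
  then show ?thesis using x(1) by simp
qed

end

section \<open>The boundary as the space of infinite reduced words\<close>

context based_free_group
begin

abbreviation "boundary \<equiv> boundary_points F X"
abbreviation "asymptotic \<equiv> gromov_asymptotic F X"
abbreviation "gseq \<equiv> gromov_sequences F X"

lemma asymptotic_iff: "asymptotic s t \<longleftrightarrow> (\<forall>n::nat. \<exists>M. \<forall>i\<ge>M. \<forall>j\<ge>M. real n \<le> gp (s i) (t j))"
proof
  assume a: "asymptotic s t"
  show "\<forall>n::nat. \<exists>M. \<forall>i\<ge>M. \<forall>j\<ge>M. real n \<le> gp (s i) (t j)"
  proof
    fix n :: nat
    have "\<forall>\<^sub>F x in sequentially \<times>\<^sub>F sequentially. real n \<le> (case x of (i, j) \<Rightarrow> gp (s i) (t j))"
      using a unfolding gromov_asymptotic_def filterlim_at_top by blast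
    then show "\<exists>M. \<forall>i\<ge>M. \<forall>j\<ge>M. real n \<le> gp (s i) (t j)" unfolding eventually_prod_sequentially by auto
  qed
next
  assume r: "\<forall>n::nat. \<exists>M. \<forall>i\<ge>M. \<forall>j\<ge>M. real n \<le> gp (s i) (t j)"
  show "asymptotic s t"
    unfolding gromov_asymptotic_def filterlim_at_top eventually_prod_sequentially
  proof
    fix Z :: real
    obtain n :: nat where "Z \<le> real n" using real_arch_simple by blast
    moreover obtain M where "\<forall>i\<ge>M. \<forall>j\<ge>M. real n \<le> gp (s i) (t j)" using r by blast
    ultimately show "\<exists>N. \<forall>m\<ge>N. \<forall>n\<ge>N. Z \<le> (case (n, m) of (i, j) \<Rightarrow> gp (s i) (t j))"
      by (intro exI[of _ M]) (auto intro: order_trans)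
  qed
qed

lemma gseqD: "s \<in> gseq \<Longrightarrow> s i \<in> carrier F" "s \<in> gseq \<Longrightarrow> asymptotic s s"
  by (auto simp: gromov_sequences_def)

lemma gseqI: "\<lbrakk>\<And>i. s i \<in> carrier F; asymptotic s s\<rbrakk> \<Longrightarrow> s \<in> gseq"
  by (auto simp: gromov_sequences_def)

text \<open>The terms of a convergent sequence eventually share each finite prefix. These prefixes describe the end.\<close>
definition eventual_prefix :: "(nat \<Rightarrow> 'a) \<Rightarrow> nat \<Rightarrow> ('a \<times> bool) list \<Rightarrow> bool" where
  "eventual_prefix s n c \<longleftrightarrow> (\<exists>M. \<forall>i\<ge>M. n \<le> len (s i) \<and> take n (rep (s i)) = c)"

definition limit_prefix :: "(nat \<Rightarrow> 'a) \<Rightarrow> nat \<Rightarrow> ('a \<times> bool) list" where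
  "limit_prefix s n = (SOME c. eventual_prefix s n c)"

lemma eventual_prefix_unique: "\<lbrakk>eventual_prefix s n c; eventual_prefix s n c'\<rbrakk> \<Longrightarrow> c = c'"
  unfolding eventual_prefix_def by (metis nat_le_linear)

lemma limit_prefix_eventual:
  assumes s: "s \<in> gseq"
  shows "eventual_prefix s n (limit_prefix s n)"
proof -
  obtain M where M: "\<forall>i\<ge>M. \<forall>j\<ge>M. real n \<le> gp (s i) (s j)" using gseqD(2)[OF s] unfolding asymptotic_iff by blast
  have "n \<le> len (s i) \<and> take n (rep (s i)) = take n (rep (s M))" if "i \<ge> M" for i
    using M that gp_ge_iff[OF gseqD(1)[OF s, of i] gseqD(1)[OF s, of M], of n] by auto
  then have "eventual_prefix s n (take n (rep (s M)))" unfolding eventual_prefix_def by blast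
  then show ?thesis unfolding limit_prefix_def by (rule someI)
qed

lemma limit_prefix_eq: "\<lbrakk>s \<in> gseq; eventual_prefix s n c\<rbrakk> \<Longrightarrow> limit_prefix s n = c"
  using limit_prefix_eventual eventual_prefix_unique by blast

lemma asymptotic_of_prefixes:
  assumes c: "\<And>i. s i \<in> carrier F" "\<And>i. t i \<in> carrier F" "\<And>n. \<exists>c. eventual_prefix s n c \<and> eventual_prefix t n c"
  shows "asymptotic s t"
  unfolding asymptotic_iff
proof
  fix n
  obtain c where c': "eventual_prefix s n c" "eventual_prefix t n c" using c(3) by blast
  obtain M where M: "\<forall>i\<ge>M. n \<le> len (s i) \<and> take n (rep (s i)) = c" using c'(1) eventual_prefix_def by blast
  obtain N where N: "\<forall>i\<ge>N. n \<le> len (t i) \<and> take n (rep (t i)) = c" using c'(2) eventual_prefix_def by blast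
  have "real n \<le> gp (s i) (t j)" if "i \<ge> max M N" "j \<ge> max M N" for i j
    unfolding gp_ge_iff[OF c(1,2)] using M N that by auto
  then show "\<exists>M. \<forall>i\<ge>M. \<forall>j\<ge>M. real n \<le> gp (s i) (t j)" by blast
qed

lemma limit_prefix_eq_of_gp:
  assumes s: "s \<in> gseq" and t: "t \<in> gseq"
    and M: "\<And>i j. \<lbrakk>i \<ge> M; j \<ge> M\<rbrakk> \<Longrightarrow> real n \<le> gp (s i) (t j)"
  shows "limit_prefix s n = limit_prefix t n"
proof -
  have *: "n \<le> len (s i) \<and> n \<le> len (t j) \<and> take n (rep (s i)) = take n (rep (t j))" if "i \<ge> M" "j \<ge> M" for i j
    using M[OF that] gp_ge_iff[OF gseqD(1)[OF s] gseqD(1)[OF t]] by blast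
  have "eventual_prefix s n (take n (rep (t M)))" unfolding eventual_prefix_def using * by blast
  moreover have "eventual_prefix t n (take n (rep (s M)))" unfolding eventual_prefix_def using * by (metis order_refl)
  ultimately show "limit_prefix s n = limit_prefix t n" using *[of M M] limit_prefix_eq s t by auto
qed

lemma asymptotic_iff_prefixes:
  assumes s: "s \<in> gseq" and t: "t \<in> gseq"
  shows "asymptotic s t \<longleftrightarrow> (\<forall>n. limit_prefix s n = limit_prefix t n)"
proof
  assume "asymptotic s t"
  then show "\<forall>n. limit_prefix s n = limit_prefix t n" unfolding asymptotic_iff using limit_prefix_eq_of_gp[OF s t] by meson
next
  assume "\<forall>n. limit_prefix s n = limit_prefix t n"
  then show "asymptotic s t" using limit_prefix_eventual[OF s] limit_prefix_eventual[OF t] gseqD(1) s t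
    by (intro asymptotic_of_prefixes) metis+
qed

lemma limit_prefix_props:
  assumes s: "s \<in> gseq"
  shows "length (limit_prefix s n) = n" "limit_prefix s n \<in> words X" "reduced_word (limit_prefix s n)"
    "n \<le> m \<Longrightarrow> limit_prefix s n = take n (limit_prefix s m)"
proof -
  have *: "\<exists>i. n \<le> len (s i) \<and> take n (rep (s i)) = limit_prefix s n \<and> m \<le> len (s i) \<and> take m (rep (s i)) = limit_prefix s m" for n m
  proof -
    obtain M where M: "\<forall>i\<ge>M. n \<le> len (s i) \<and> take n (rep (s i)) = limit_prefix s n" using limit_prefix_eventual[OF s] eventual_prefix_def by blast
    obtain N where N: "\<forall>i\<ge>N. m \<le> len (s i) \<and> take m (rep (s i)) = limit_prefix s m" using limit_prefix_eventual[OF s] eventual_prefix_def by blast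
    show ?thesis using M N by (intro exI[of _ "max M N"]) auto
  qed
  obtain i where i: "n \<le> len (s i)" "take n (rep (s i)) = limit_prefix s n" using *[of n n] by blast
  note si = gseqD(1)[OF s, of i]
  show "length (limit_prefix s n) = n" using i si by (metis len_rep length_take min.absorb2)
  have "rep (s i) = limit_prefix s n @ drop n (rep (s i))" using i by (metis append_take_drop_id)
  then show "limit_prefix s n \<in> words X" "reduced_word (limit_prefix s n)"
    using rep(1,2)[OF si] by (metis words_append, metis reduced_word_append)
  show "limit_prefix s n = take n (limit_prefix s m)" if "n \<le> m" using *[of n m] that by (metis min.absorb1 take_take)
qed

lemma endpoint_eq_iff:
  assumes s: "s \<in> gseq" and t: "t \<in> gseq"
  shows "endpoint F X s = endpoint F X t \<longleftrightarrow> (\<forall>n. limit_prefix s n = limit_prefix t n)"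
proof
  assume "endpoint F X s = endpoint F X t"
  moreover have "t \<in> endpoint F X t" using t gseqD(2) by (auto simp: endpoint_def)
  ultimately have "asymptotic s t" by (auto simp: endpoint_def)
  then show "\<forall>n. limit_prefix s n = limit_prefix t n" using asymptotic_iff_prefixes s t by blast
qed (auto simp: endpoint_def asymptotic_iff_prefixes s t)

text \<open>The first \<open>n\<close> letters of the infinite reduced word of a boundary point; every representing sequence
  yields the same letters.\<close>
definition prefix_of :: "(nat \<Rightarrow> 'a) set \<Rightarrow> nat \<Rightarrow> ('a \<times> bool) list" where
  "prefix_of p n = limit_prefix (SOME s. s \<in> p) n"

lemma boundary_member:
  assumes p: "p \<in> boundary" and s: "s \<in> p"
  shows "s \<in> gseq" "p = endpoint F X s" "limit_prefix s n = prefix_of p n"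
proof -
  have *: "s \<in> gseq \<and> p = endpoint F X s" if "s \<in> p" for s
  proof -
    obtain t where t: "t \<in> gseq" "p = endpoint F X t" using p boundary_points_def by blast
    then have "s \<in> gseq" "asymptotic t s" using that by (auto simp: endpoint_def)
    then show ?thesis using t endpoint_eq_iff asymptotic_iff_prefixes by auto
  qed
  show 1: "s \<in> gseq" "p = endpoint F X s" using * s by auto
  have "(SOME s. s \<in> p) \<in> p" using s by (metis some_in_eq empty_iff)
  then show "limit_prefix s n = prefix_of p n" using * s endpoint_eq_iff unfolding prefix_of_def by metis
qed

lemma endpoint_boundary: "s \<in> gseq \<Longrightarrow> endpoint F X s \<in> boundary" "s \<in> gseq \<Longrightarrow> s \<in> endpoint F X s"
  using gseqD(2) by (auto simp: boundary_points_def endpoint_def)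

lemma end_prefix_endpoint: "s \<in> gseq \<Longrightarrow> prefix_of (endpoint F X s) n = limit_prefix s n"
  using boundary_member(3) endpoint_boundary by metis

lemma boundary_nonempty: "p \<in> boundary \<Longrightarrow> \<exists>s. s \<in> p \<and> s \<in> gseq"
  using endpoint_boundary(2) unfolding boundary_points_def by blast

lemma boundary_eqI: "\<lbrakk>p \<in> boundary; q \<in> boundary; \<And>n. prefix_of p n = prefix_of q n\<rbrakk> \<Longrightarrow> p = q"
  using boundary_nonempty boundary_member endpoint_eq_iff by metis

lemma end_prefix_props:
  assumes p: "p \<in> boundary"
  shows "length (prefix_of p n) = n" "prefix_of p n \<in> words X" "reduced_word (prefix_of p n)"
    "n \<le> m \<Longrightarrow> prefix_of p n = take n (prefix_of p m)"
  using boundary_nonempty[OF p] boundary_member(3)[OF p] limit_prefix_props by metis+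

text \<open>Gromov products are integers, so a lower limit of at least \<open>n\<close> means that the products are eventually
  at least \<open>n\<close>.\<close>
lemma nbhd_imp_end_prefix:
  assumes p: "p \<in> boundary" and q: "q \<in> boundary_nbhd F X p (real n)"
  shows "q \<in> boundary \<and> prefix_of q n = prefix_of p n"
proof -
  obtain s t where st: "s \<in> p" "t \<in> q" "q \<in> boundary"
    and L: "ereal (real n) \<le> Liminf (sequentially \<times>\<^sub>F sequentially) (\<lambda>(i, j). ereal (gp (s i) (t j)))"
    using q unfolding boundary_nbhd_def by blast
  note s = boundary_member[OF p st(1)] and t = boundary_member[OF st(3,2)]
  have "\<forall>\<^sub>F x in sequentially \<times>\<^sub>F sequentially. ereal (real n - 1/2) < (case x of (i, j) \<Rightarrow> ereal (gp (s i) (t j)))"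
    using L unfolding le_Liminf_iff by simp
  then obtain M where M: "\<And>i j. i \<ge> M \<Longrightarrow> j \<ge> M \<Longrightarrow> real n - 1/2 < gp (s i) (t j)"
    unfolding eventually_prod_sequentially by auto
  have "real n \<le> gp (s i) (t j)" if "i \<ge> M" "j \<ge> M" for i j
  proof -
    obtain m :: nat where m: "gp (s i) (t j) = real m"
      using gp_nat[OF gseqD(1)[OF s(1)] gseqD(1)[OF t(1)]] by blast
    then have "real n < real (m + 1)" using M[OF that] by simp
    then show ?thesis using m by simp
  qed
  then have "limit_prefix s n = limit_prefix t n" using limit_prefix_eq_of_gp[OF s(1) t(1)] by blast
  then show ?thesis using s(3) t(3) st(3) by metis
qed

lemma end_prefix_imp_nbhd:
  assumes p: "p \<in> boundary" and q: "q \<in> boundary" and e: "prefix_of q n = prefix_of p n"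
  shows "q \<in> boundary_nbhd F X p (real n)"
proof -
  obtain s t where st: "s \<in> p" "t \<in> q" using boundary_nonempty p q by blast
  note s = boundary_member[OF p st(1)] and t = boundary_member[OF q st(2)]
  obtain M where M: "\<forall>i\<ge>M. n \<le> len (s i) \<and> take n (rep (s i)) = prefix_of p n"
    using limit_prefix_eventual[OF s(1), of n] s(3) unfolding eventual_prefix_def by metis
  obtain N where N: "\<forall>i\<ge>N. n \<le> len (t i) \<and> take n (rep (t i)) = prefix_of p n"
    using limit_prefix_eventual[OF t(1), of n] t(3) e unfolding eventual_prefix_def by metis
  have "real n \<le> gp (s i) (t j)" if "i \<ge> max M N" "j \<ge> max M N" for i j
    unfolding gp_ge_iff[OF gseqD(1)[OF s(1)] gseqD(1)[OF t(1)]] using M N that by auto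
  then have "\<forall>\<^sub>F x in sequentially \<times>\<^sub>F sequentially. ereal (real n) \<le> (case x of (i, j) \<Rightarrow> ereal (gp (s i) (t j)))"
    unfolding eventually_prod_sequentially by (intro exI[of _ "max M N"]) auto
  then have "ereal (real n) \<le> Liminf (sequentially \<times>\<^sub>F sequentially) (\<lambda>(i, j). ereal (gp (s i) (t j)))"
    by (rule Liminf_bounded)
  then show ?thesis unfolding boundary_nbhd_def using st q by blast
qed

lemma openin_boundary_iff:
  "openin (gromov_boundary F X) U \<longleftrightarrow>
    U \<subseteq> boundary \<and> (\<forall>p\<in>U. \<exists>n. \<forall>q\<in>boundary. prefix_of q n = prefix_of p n \<longrightarrow> q \<in> U)"
proof -
  have "(\<exists>r. boundary_nbhd F X p r \<subseteq> U) \<longleftrightarrow> (\<exists>n. \<forall>q\<in>boundary. prefix_of q n = prefix_of p n \<longrightarrow> q \<in> U)"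
    if p: "p \<in> boundary" for p
  proof
    assume "\<exists>r. boundary_nbhd F X p r \<subseteq> U"
    then obtain r where r: "boundary_nbhd F X p r \<subseteq> U" by blast
    obtain n :: nat where "r \<le> real n" using real_arch_simple by blast
    then have "boundary_nbhd F X p (real n) \<subseteq> U" using r boundary_nbhd_antimono by blast
    then show "\<exists>n. \<forall>q\<in>boundary. prefix_of q n = prefix_of p n \<longrightarrow> q \<in> U" using end_prefix_imp_nbhd[OF p] by blast
  next
    assume "\<exists>n. \<forall>q\<in>boundary. prefix_of q n = prefix_of p n \<longrightarrow> q \<in> U"
    then obtain n where "\<forall>q\<in>boundary. prefix_of q n = prefix_of p n \<longrightarrow> q \<in> U" by blast
    then have "boundary_nbhd F X p (real n) \<subseteq> U" using nbhd_imp_end_prefix[OF p] by blast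
    then show "\<exists>r. boundary_nbhd F X p r \<subseteq> U" by blast
  qed
  then show ?thesis unfolding openin_gromov_boundary by blast
qed

definition shadow :: "('a \<times> bool) list \<Rightarrow> (nat \<Rightarrow> 'a) set set" where
  "shadow c = {p \<in> boundary. prefix_of p (length c) = c}"

lemma shadow_end_prefix: "p \<in> boundary \<Longrightarrow> shadow (prefix_of p n) = {q \<in> boundary. prefix_of q n = prefix_of p n}"
  by (simp add: shadow_def end_prefix_props(1))

lemma openin_shadow: "openin (gromov_boundary F X) (shadow c)"
  unfolding openin_boundary_iff shadow_def by (auto intro!: exI[of _ "length c"])

lemma closedin_shadow: "closedin (gromov_boundary F X) (shadow c)"
  unfolding closedin_def topspace_gromov_boundary openin_boundary_iff shadow_def
  by (auto intro!: exI[of _ "length c"])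

lemma shadow_base:
  assumes "openin (gromov_boundary F X) U" "p \<in> U"
  shows "\<exists>n. p \<in> shadow (prefix_of p n) \<and> shadow (prefix_of p n) \<subseteq> U"
proof -
  have p: "p \<in> boundary" using assms by (auto simp: openin_boundary_iff)
  obtain n where "\<forall>q\<in>boundary. prefix_of q n = prefix_of p n \<longrightarrow> q \<in> U" using assms by (auto simp: openin_boundary_iff)
  then show ?thesis using p by (intro exI[of _ n]) (auto simp: shadow_end_prefix)
qed

lemma boundary_point_of_prefixes:
  assumes len: "\<And>n. length (c n) = n" and w: "\<And>n. c n \<in> words X" "\<And>n. reduced_word (c n)"
    and step: "\<And>n. c n = take n (c (Suc n))"
  obtains p where "p \<in> boundary" "\<And>n. prefix_of p n = c n"
proof -
  have tk: "c n = take n (c (n + k))" for n k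
  proof (induction k)
    case (Suc k)
    have "c n = take n (take (n + k) (c (Suc (n + k))))" using Suc step[of "n + k"] by argo
    also have "\<dots> = take n (c (n + Suc k))" by (simp add: min_def)
    finally show ?case .
  qed (use len in simp)
  define s where "s n = val (c n)" for n
  have sc: "s n \<in> carrier F" for n using w by (simp add: s_def)
  have st: "eventual_prefix s n (c n)" for n
    unfolding eventual_prefix_def
  proof (intro exI[of _ n] allI impI)
    fix i assume "n \<le> i"
    then have "c n = take n (c i)" using tk[of n "i - n"] by simp
    then show "n \<le> len (s i) \<and> take n (rep (s i)) = c n"
      using \<open>n \<le> i\<close> w len len_val[of "c i"] by (simp add: s_def)
  qed
  have "asymptotic s s" using st sc by (intro asymptotic_of_prefixes) auto
  then have sg: "s \<in> gseq" using sc gseqI by blast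
  then have "prefix_of (endpoint F X s) n = c n" for n using end_prefix_endpoint limit_prefix_eq st by metis
  then show thesis using that endpoint_boundary(1)[OF sg] by blast
qed

lemma Hausdorff_boundary: "Hausdorff_space (gromov_boundary F X)"
  unfolding Hausdorff_space_def topspace_gromov_boundary
proof (intro allI impI)
  fix p q assume "p \<in> boundary \<and> q \<in> boundary \<and> p \<noteq> q"
  then obtain n where n: "p \<in> boundary" "q \<in> boundary" "prefix_of p n \<noteq> prefix_of q n" using boundary_eqI by blast
  then have "disjnt (shadow (prefix_of p n)) (shadow (prefix_of q n))"
    by (auto simp: shadow_end_prefix disjnt_def)
  moreover have "p \<in> shadow (prefix_of p n)" "q \<in> shadow (prefix_of q n)" using n by (auto simp: shadow_end_prefix)
  ultimately show "\<exists>U V. openin (gromov_boundary F X) U \<and> openin (gromov_boundary F X) V \<and> p \<in> U \<and> q \<in> V \<and> disjnt U V"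
    using openin_shadow by blast
qed

lemma shadow_split:
  assumes "c \<in> words X"
  shows "shadow c \<subseteq> (\<Union>l\<in>X \<times> UNIV. shadow (c @ [l]))"
proof
  fix p assume p: "p \<in> shadow c"
  then have pb: "p \<in> boundary" and pc: "prefix_of p (length c) = c" by (auto simp: shadow_def)
  define d where "d = prefix_of p (Suc (length c))"
  have ld: "length d = Suc (length c)" using end_prefix_props(1)[OF pb] by (simp add: d_def)
  have "c = take (length c) d" using end_prefix_props(4)[OF pb, of "length c" "Suc (length c)"] pc by (simp add: d_def)
  then have "c = butlast d" using ld by (simp add: butlast_conv_take)
  moreover have "d \<noteq> []" using ld by auto
  ultimately obtain l where d: "d = c @ [l]" by (metis append_butlast_last_id)
  have "d \<in> words X" using end_prefix_props(2)[OF pb] d_def by blast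
  then have "fst l \<in> X" using d by simp
  moreover have "p \<in> shadow (c @ [l])" using pb d d_def by (simp add: shadow_def)
  ultimately show "p \<in> (\<Union>l\<in>X \<times> UNIV. shadow (c @ [l]))" by (cases l) auto
qed

text \<open>Koenig's lemma: if the whole boundary had no finite subcover, then neither would the shadow of some
  one-letter word, and so on. The resulting infinite word is a boundary point, and a member of the cover
  around it contains one of these shadows.\<close>
lemma compact_boundary: "compact_space (gromov_boundary F X)"
  unfolding compact_space_def compactin_def topspace_gromov_boundary
proof (intro conjI order_refl allI impI, elim conjE)
  fix \<U> assume op: "\<forall>U\<in>\<U>. openin (gromov_boundary F X) U" and cov: "boundary \<subseteq> \<Union>\<U>"
  define fc where "fc S \<longleftrightarrow> (\<exists>\<F>. finite \<F> \<and> \<F> \<subseteq> \<U> \<and> S \<subseteq> \<Union>\<F>)" for S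
  have fc_sub: "fc S" if "fc T" "S \<subseteq> T" for S T using that unfolding fc_def by blast
  have fc_UN: "fc (\<Union>i\<in>I. S i)" if "finite I" "\<And>i. i \<in> I \<Longrightarrow> fc (S i)" for I and S :: "'a \<times> bool \<Rightarrow> _"
    using that
  proof (induction I rule: finite_induct)
    case empty
    then show ?case unfolding fc_def by (intro exI[of _ "{}"]) auto
  next
    case (insert i I)
    then obtain \<F> \<G> where "finite \<F>" "\<F> \<subseteq> \<U>" "S i \<subseteq> \<Union>\<F>" "finite \<G>" "\<G> \<subseteq> \<U>" "(\<Union>i\<in>I. S i) \<subseteq> \<Union>\<G>"
      unfolding fc_def by (metis insertI1 insertI2)
    then show ?case unfolding fc_def by (intro exI[of _ "\<F> \<union> \<G>"]) auto
  qed
  have "fc boundary"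
  proof (rule ccontr)
    assume nb: "\<not> fc boundary"
    \<comment> \<open>A word whose shadow has no finite subcover.\<close>
    let ?bad = "\<lambda>n c. length c = n \<and> c \<in> words X \<and> \<not> fc (shadow c)"
    have "shadow [] = boundary" using end_prefix_props(1) by (auto simp: shadow_def)
    then have "?bad 0 []" using nb by simp
    moreover have "\<exists>d. ?bad (Suc n) d \<and> c = take n d" if c: "?bad n c" for n c
    proof (rule ccontr)
      assume no: "\<nexists>d. ?bad (Suc n) d \<and> c = take n d"
      have "fc (shadow (c @ [l]))" if l: "l \<in> X \<times> UNIV" for l
      proof (rule ccontr)
        assume "\<not> fc (shadow (c @ [l]))"
        then have "?bad (Suc n) (c @ [l]) \<and> c = take n (c @ [l])" using c l by auto
        then show False using no by blast
      qed
      then have "fc (\<Union>l\<in>X \<times> UNIV. shadow (c @ [l]))" using finX by (intro fc_UN) auto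
      then show False using shadow_split c fc_sub by blast
    qed
    ultimately obtain c where c: "\<And>n. ?bad n (c n)" "\<And>n. c n = take n (c (Suc n))"
      using dependent_nat_choice[of ?bad "\<lambda>n c d. c = take n d"] by metis
    have "reduced_word (c n)" for n
    proof -
      have "shadow (c n) \<noteq> {}" using c(1)[of n] unfolding fc_def by (metis empty_subsetI finite.emptyI)
      then obtain p where "p \<in> boundary" "prefix_of p (length (c n)) = c n" by (auto simp: shadow_def)
      then show ?thesis using end_prefix_props(3) by metis
    qed
    then obtain p where p: "p \<in> boundary" "\<And>n. prefix_of p n = c n"
      using boundary_point_of_prefixes[of c] c by metis
    obtain U where U: "U \<in> \<U>" "p \<in> U" using cov p(1) by blast
    then obtain n where "shadow (c n) \<subseteq> U" using shadow_base[of U p] op p(2) by metis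
    then have "fc (shadow (c n))" unfolding fc_def using U by (intro exI[of _ "{U}"]) auto
    then show False using c(1) by blast
  qed
  then show "\<exists>\<F>. finite \<F> \<and> \<F> \<subseteq> \<U> \<and> boundary \<subseteq> \<Union>\<F>" unfolding fc_def .
qed

lemma separable_boundary:
  obtains E where "countable E" "E \<subseteq> boundary" "gromov_boundary F X closure_of E = boundary"
proof -
  define E where "E = (\<lambda>c. SOME p. p \<in> shadow c) ` {c \<in> words X. shadow c \<noteq> {}}"
  have ch: "(SOME p. p \<in> shadow c) \<in> shadow c" if "shadow c \<noteq> {}" for c using that by (simp add: some_in_eq)
  have "countable (words X)" using finX unfolding words_def by (intro countable_lists countable_finite) auto
  then have "countable E" unfolding E_def by (intro countable_image) (auto intro: countable_subset)
  moreover have "E \<subseteq> boundary" unfolding E_def using ch by (auto simp: shadow_def)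
  moreover have "gromov_boundary F X closure_of E = boundary"
  proof
    show "gromov_boundary F X closure_of E \<subseteq> boundary" using closure_of_subset_topspace[of "gromov_boundary F X" E] by (simp add: topspace_gromov_boundary)
    show "boundary \<subseteq> gromov_boundary F X closure_of E"
    proof
      fix p assume p: "p \<in> boundary"
      have "\<exists>y. y \<in> E \<and> y \<in> T" if T: "p \<in> T" "openin (gromov_boundary F X) T" for T
      proof -
        obtain n where n: "p \<in> shadow (prefix_of p n)" "shadow (prefix_of p n) \<subseteq> T" using shadow_base T by blast
        then have "(SOME q. q \<in> shadow (prefix_of p n)) \<in> E" unfolding E_def using end_prefix_props(2)[OF p] by blast
        moreover have "(SOME q. q \<in> shadow (prefix_of p n)) \<in> T" using ch n by blast
        ultimately show ?thesis by blast
      qed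
      then show "p \<in> gromov_boundary F X closure_of E" using p by (simp add: in_closure_of topspace_gromov_boundary)
    qed
  qed
  ultimately show thesis using that by blast
qed

end

section \<open>Rays and lines of powers\<close>

context based_free_group
begin

lemma gp_perturb2:
  assumes "g \<in> carrier F" "h \<in> carrier F" "x \<in> carrier F" "y \<in> carrier F"
  shows "gp (g \<otimes> x) (h \<otimes> y) \<ge> gp g h - len x - len y"
proof -
  have "gp (g \<otimes> x) (h \<otimes> y) \<ge> gp g (h \<otimes> y) - len x" using gp_perturb assms by simp
  moreover have "gp g (h \<otimes> y) \<ge> gp g h - len y"
    using gp_perturb[of h g y] gp_sym[of g "h \<otimes> y"] gp_sym[of g h] assms by simp
  ultimately show ?thesis by linarith
qed

text \<open>Passing to later terms and moving them by a bounded distance changes Gromov products by a bounded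
  amount.\<close>
lemma bounded_perturbation:
  assumes s: "s \<in> gseq" and x: "\<And>n. x n \<in> carrier F" "\<And>n. len (x n) \<le> C"
    and f: "\<And>n. f n \<ge> n" and t: "\<And>n. t n = s (f n) \<otimes> x n"
  shows "t \<in> gseq" "endpoint F X t = endpoint F X s"
proof -
  have sc: "s i \<in> carrier F" for i using gseqD(1)[OF s] .
  then have tc: "t i \<in> carrier F" for i using x t by simp
  have s_gp: "\<exists>M. \<forall>i\<ge>M. \<forall>j\<ge>M. real n \<le> gp (s i) (s j)" for n
    using gseqD(2)[OF s] unfolding asymptotic_iff by blast
  have "asymptotic t t"
    unfolding asymptotic_iff
  proof
    fix n
    obtain M where M: "\<forall>i\<ge>M. \<forall>j\<ge>M. real (n + 2 * C) \<le> gp (s i) (s j)" using s_gp by blast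
    have "real n \<le> gp (t i) (t j)" if "i \<ge> M" "j \<ge> M" for i j
    proof -
      have "f i \<ge> M" "f j \<ge> M" using f[of i] f[of j] that by auto
      then have "real (n + 2 * C) \<le> gp (s (f i)) (s (f j))" using M by blast
      moreover have "gp (t i) (t j) \<ge> gp (s (f i)) (s (f j)) - len (x i) - len (x j)"
        unfolding t using sc x by (intro gp_perturb2)
      ultimately show ?thesis using x(2)[of i] x(2)[of j] by simp
    qed
    then show "\<exists>M. \<forall>i\<ge>M. \<forall>j\<ge>M. real n \<le> gp (t i) (t j)" by blast
  qed
  then show tg: "t \<in> gseq" using tc gseqI by blast
  have "limit_prefix s n = limit_prefix t n" for n
  proof -
    obtain M where M: "\<forall>i\<ge>M. \<forall>j\<ge>M. real (n + C) \<le> gp (s i) (s j)" using s_gp by blast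
    have "real n \<le> gp (s i) (t j)" if "i \<ge> M" "j \<ge> M" for i j
    proof -
      have "f j \<ge> M" using f[of j] that by auto
      then have "real (n + C) \<le> gp (s i) (s (f j))" using M that by blast
      moreover have "gp (s i \<otimes> \<one>) (t j) \<ge> gp (s i) (s (f j)) - len \<one> - len (x j)"
        unfolding t using sc x by (intro gp_perturb2) auto
      ultimately show ?thesis using x(2)[of j] sc[of i] by simp
    qed
    then show ?thesis using limit_prefix_eq_of_gp[OF s tg] by blast
  qed
  then show "endpoint F X t = endpoint F X s" using endpoint_eq_iff s tg by metis
qed

lemma pow_inj:
  assumes v: "v \<in> carrier F" "v \<noteq> \<one>" and e: "v [^] (i::int) = v [^] (j::int)"
  shows "i = j"
proof (rule ccontr)
  assume "i \<noteq> j"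
  have *: False if "i < j" "v [^] i = v [^] j" for i j :: int
  proof -
    have "v [^] (j - i) = \<one>" using that v by (simp add: int_pow_diff)
    then have "v [^] nat (j - i) = \<one>" using that by (metis pow_nat diff_ge_0_iff_ge less_imp_le)
    then show False using torsion_free[OF v(1), of "nat (j - i)"] v(2) that by simp
  qed
  show False using *[of i j] *[of j i] e \<open>i \<noteq> j\<close> by (metis linorder_neqE)
qed

lemma powers_escape:
  assumes g: "g \<in> carrier F" and v: "v \<in> carrier F" "v \<noteq> \<one>"
  shows "\<exists>M. \<forall>k\<ge>M. N \<le> len (g \<otimes> v [^] (k::nat))"
proof -
  let ?S = "{k::nat. len (g \<otimes> v [^] k) \<le> N}"
  have inj: "inj_on (\<lambda>k. g \<otimes> v [^] k) ?S"
  proof (rule inj_onI)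
    fix i j :: nat assume "g \<otimes> v [^] i = g \<otimes> v [^] j"
    then have "v [^] i = v [^] j" using g v by simp
    then have "v [^] int i = v [^] int j" by (simp add: int_pow_int)
    then have "int i = int j" by (rule pow_inj[OF v])
    then show "i = j" by simp
  qed
  have "(\<lambda>k. g \<otimes> v [^] k) ` ?S \<subseteq> {h \<in> carrier F. len h \<le> N}" using g v by auto
  then have "finite ?S" using inj_on_finite[OF inj _ finite_ball] by blast
  then obtain M where "\<forall>k\<in>?S. k < M" using finite_nat_set_iff_bounded by blast
  then show ?thesis by (intro exI[of _ M]) (metis leD linear mem_Collect_eq)
qed

definition ray_end :: "'a \<Rightarrow> 'a \<Rightarrow> (nat \<Rightarrow> 'a) set" where
  "ray_end g v = endpoint F X (\<lambda>n. g \<otimes> v [^] (n::nat))"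

lemma ray_gseq:
  assumes g: "g \<in> carrier F" and v: "v \<in> carrier F" "v \<noteq> \<one>"
  shows "(\<lambda>n. g \<otimes> v [^] (n::nat)) \<in> gseq"
proof (rule gseqI)
  show "g \<otimes> v [^] i \<in> carrier F" for i :: nat using g v by simp
  show "asymptotic (\<lambda>n. g \<otimes> v [^] n) (\<lambda>n. g \<otimes> v [^] n)"
    unfolding asymptotic_iff
  proof
    fix n
    obtain M where M: "\<And>k. k \<ge> M \<Longrightarrow> n + len v \<le> len (g \<otimes> v [^] (k::nat))" using powers_escape[OF g v] by blast
    have *: "real n \<le> gp (g \<otimes> v [^] i) (g \<otimes> v [^] j)" if "M \<le> i" "i \<le> j" for i j :: nat
    proof -
      have "g \<otimes> v [^] i \<otimes> v [^] (j - i) = g \<otimes> v [^] j" using g v that by (simp add: m_assoc nat_pow_mult)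
      then obtain k :: nat where k: "gp (g \<otimes> v [^] i) (g \<otimes> v [^] j) \<ge> real (len (g \<otimes> v [^] i \<otimes> v [^] k)) - real (len v)"
        using gp_along_powers[of "g \<otimes> v [^] i" v "j - i"] g v by auto
      have "g \<otimes> v [^] i \<otimes> v [^] k = g \<otimes> v [^] (i + k)" using g v by (simp add: m_assoc nat_pow_mult)
      then have "n + len v \<le> len (g \<otimes> v [^] i \<otimes> v [^] k)" using M[of "i + k"] that by simp
      then show ?thesis using k by linarith
    qed
    have "real n \<le> gp (g \<otimes> v [^] i) (g \<otimes> v [^] j)" if "i \<ge> M" "j \<ge> M" for i j :: nat
      using *[of i j] *[of j i] that gp_sym[of "g \<otimes> v [^] i" "g \<otimes> v [^] j"] g v by (metis m_closed nat_pow_closed nle_le)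
    then show "\<exists>M. \<forall>i\<ge>M. \<forall>j\<ge>M. real n \<le> gp (g \<otimes> v [^] (i::nat)) (g \<otimes> v [^] (j::nat))" by blast
  qed
qed

lemma ray_end_boundary: "\<lbrakk>g \<in> carrier F; v \<in> carrier F; v \<noteq> \<one>\<rbrakk> \<Longrightarrow> ray_end g v \<in> boundary"
  unfolding ray_end_def by (intro endpoint_boundary ray_gseq)

lemma ray_end_shift_nat:
  assumes g: "g \<in> carrier F" and v: "v \<in> carrier F" "v \<noteq> \<one>"
  shows "ray_end (g \<otimes> v [^] (k::nat)) v = ray_end g v"
  unfolding ray_end_def
  by (rule bounded_perturbation(2)[OF ray_gseq[OF g v], of "\<lambda>_. \<one>" 0 "\<lambda>n. n + k"])
     (use g v in \<open>auto simp: m_assoc nat_pow_mult add.commute\<close>)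

lemma ray_end_shift:
  assumes g: "g \<in> carrier F" and v: "v \<in> carrier F" "v \<noteq> \<one>"
  shows "ray_end (g \<otimes> v [^] (k::int)) v = ray_end g v"
proof (cases k)
  case (nonneg n)
  then show ?thesis using ray_end_shift_nat[OF g v] by (simp add: int_pow_int)
next
  case (neg n)
  define h where "h = g \<otimes> v [^] k"
  have hc: "h \<in> carrier F" using g v by (simp add: h_def)
  have "v [^] k \<otimes> v [^] int (Suc n) = \<one>" using neg v int_pow_mult[of v k "int (Suc n)"] by simp
  then have "h \<otimes> v [^] Suc n = g" using g v by (simp add: h_def m_assoc int_pow_int del: nat_pow_Suc of_nat_Suc)
  then show ?thesis using ray_end_shift_nat[OF hc v, of "Suc n"] by (simp add: h_def)
qed

lemma ray_end_power:
  assumes g: "g \<in> carrier F" and v: "v \<in> carrier F" "v \<noteq> \<one>" and a: "a > 0"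
  shows "ray_end g (v [^] (a::nat)) = ray_end g v"
  unfolding ray_end_def
  by (rule bounded_perturbation(2)[OF ray_gseq[OF g v], of "\<lambda>_. \<one>" 0 "\<lambda>n. a * n"])
     (use g v a in \<open>auto simp: nat_pow_pow\<close>)

lemma attracting_conjugate:
  assumes g: "g \<in> carrier F" and v: "v \<in> carrier F" "v \<noteq> \<one>"
  shows "attracting_point F X (g \<otimes> v \<otimes> inv g) = ray_end g v"
proof -
  have pow: "(g \<otimes> v \<otimes> inv g) [^] n = g \<otimes> v [^] n \<otimes> inv g" for n :: nat
  proof (induction n)
    case (Suc n)
    then have "(g \<otimes> v \<otimes> inv g) [^] Suc n = (g \<otimes> v [^] n \<otimes> inv g) \<otimes> (g \<otimes> v \<otimes> inv g)" by simp
    also have "\<dots> = g \<otimes> v [^] n \<otimes> ((inv g \<otimes> g) \<otimes> (v \<otimes> inv g))" using g v(1) by (simp only: m_assoc m_closed inv_closed nat_pow_closed)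
    also have "\<dots> = g \<otimes> v [^] Suc n \<otimes> inv g" using g v(1) by (simp add: m_assoc)
    finally show ?case .
  qed (use g in auto)
  show ?thesis
    unfolding attracting_point_def ray_end_def
    by (rule bounded_perturbation(2)[OF ray_gseq[OF g v], of "\<lambda>_. inv g" "len g" "\<lambda>n. n"]) (use g pow in auto)
qed

lemma attracting_ray_end:
  assumes v: "v \<in> carrier F" "v \<noteq> \<one>"
  shows "attracting_point F X v = ray_end \<one> v"
  using attracting_conjugate[OF one_closed v] v by simp

lemma inv_neq_one: "\<lbrakk>v \<in> carrier F; v \<noteq> \<one>\<rbrakk> \<Longrightarrow> inv v \<noteq> \<one>"
  using inv_inv inv_one by metis

lemma pow_neq_one: "\<lbrakk>v \<in> carrier F; v \<noteq> \<one>; m > 0\<rbrakk> \<Longrightarrow> v [^] (m::nat) \<noteq> \<one>"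
  using torsion_free by blast

lemma attracting_power:
  assumes v: "v \<in> carrier F" "v \<noteq> \<one>" and m: "m > 0"
  shows "attracting_point F X (v [^] (m::nat)) = attracting_point F X v"
  using attracting_ray_end[OF v] attracting_ray_end[OF nat_pow_closed[OF v(1)] pow_neq_one[OF v m]]
    ray_end_power[OF one_closed v m] by simp

text \<open>By \<open>gp_along_powers\<close> the geodesics between points of the two rays stay at distance at least
  \<open>len h - len v\<close> from \<open>\<one>\<close>, since \<open>h\<close> is a shortest element of its coset.\<close>
lemma opposite_rays_fellow_travel:
  assumes h: "h \<in> carrier F" and v: "v \<in> carrier F" "v \<noteq> \<one>"
    and mn: "\<And>k::int. len h \<le> len (h \<otimes> v [^] k)" and N: "N + len v \<le> len h"
  shows "prefix_of (ray_end h v) N = prefix_of (ray_end h (inv v)) N"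
proof -
  have v': "inv v \<in> carrier F" "inv v \<noteq> \<one>" using v inv_neq_one by auto
  have *: "real N \<le> gp (h \<otimes> v [^] i) (h \<otimes> inv v [^] j)" for i j :: nat
  proof -
    define g where "g = h \<otimes> inv v [^] j"
    have gc: "g \<in> carrier F" using h v by (simp add: g_def)
    have inj: "inv v [^] j = v [^] (- int j)" using v by (simp add: int_pow_neg_int nat_pow_inv)
    have gk: "g \<otimes> v [^] k = h \<otimes> v [^] (int k - int j)" for k :: nat
    proof -
      have "g \<otimes> v [^] k = h \<otimes> (v [^] (- int j) \<otimes> v [^] int k)" using h v by (simp add: g_def inj m_assoc int_pow_int)
      also have "\<dots> = h \<otimes> v [^] (- int j + int k)" using v int_pow_mult by metis
      finally show ?thesis by (simp add: add.commute)
    qed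
    have "h \<otimes> v [^] i = g \<otimes> v [^] (i + j)" unfolding gk by (simp add: int_pow_int)
    then obtain k :: nat where "gp g (h \<otimes> v [^] i) \<ge> real (len (g \<otimes> v [^] k)) - real (len v)"
      using gp_along_powers[OF gc v(1)] by metis
    moreover have "len h \<le> len (g \<otimes> v [^] k)" unfolding gk by (rule mn)
    ultimately have "real N \<le> gp g (h \<otimes> v [^] i)" using N by linarith
    then show ?thesis using gp_sym[of g "h \<otimes> v [^] i"] gc h v by (simp add: g_def)
  qed
  have "limit_prefix (\<lambda>n. h \<otimes> v [^] n) N = limit_prefix (\<lambda>n. h \<otimes> inv v [^] n) N"
    by (rule limit_prefix_eq_of_gp[OF ray_gseq[OF h v] ray_gseq[OF h v']]) (rule *)
  then show ?thesis unfolding ray_end_def using end_prefix_endpoint ray_gseq h v v' by simp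
qed

text \<open>A line does not change if \<open>g\<close> is replaced by the shortest element \<open>h\<close> of its coset of the group of
  powers of \<open>v\<close>. By the preceding lemma the ends of the line agree up to level \<open>N\<close> unless \<open>h\<close> lies in a
  finite ball.\<close>
lemma finitely_many_split_lines:
  assumes v: "v \<in> carrier F" "v \<noteq> \<one>"
  shows "finite {(ray_end g v, ray_end g (inv v)) | g. g \<in> carrier F \<and> prefix_of (ray_end g v) N \<noteq> prefix_of (ray_end g (inv v)) N}"
proof -
  have v': "inv v \<in> carrier F" "inv v \<noteq> \<one>" using v inv_neq_one by auto
  have "{(ray_end g v, ray_end g (inv v)) | g. g \<in> carrier F \<and> prefix_of (ray_end g v) N \<noteq> prefix_of (ray_end g (inv v)) N}
    \<subseteq> (\<lambda>h. (ray_end h v, ray_end h (inv v))) ` {h \<in> carrier F. len h \<le> N + len v}"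
  proof safe
    fix g assume g: "g \<in> carrier F" and ne: "prefix_of (ray_end g v) N \<noteq> prefix_of (ray_end g (inv v)) N"
    obtain k0 :: int where k0: "\<And>k::int. len (g \<otimes> v [^] k0) \<le> len (g \<otimes> v [^] k)"
      using ex_has_least_nat[of "\<lambda>_. True" "0::int" "\<lambda>k. len (g \<otimes> v [^] k)"] by blast
    define h where "h = g \<otimes> v [^] k0"
    have h: "h \<in> carrier F" using g v by (simp add: h_def)
    have e1: "ray_end h v = ray_end g v" unfolding h_def by (rule ray_end_shift[OF g v])
    have "v [^] k0 = inv v [^] (- k0)" using v by (simp add: int_pow_inv int_pow_neg)
    then have e2: "ray_end h (inv v) = ray_end g (inv v)" unfolding h_def using ray_end_shift[OF g v'] by metis
    have "len h \<le> len (h \<otimes> v [^] k)" for k :: int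
      using k0[of "k0 + k"] g v by (simp add: h_def m_assoc int_pow_mult)
    then have "\<not> N + len v \<le> len h" using opposite_rays_fellow_travel[OF h v] ne e1 e2 by metis
    then show "(ray_end g v, ray_end g (inv v)) \<in> (\<lambda>h. (ray_end h v, ray_end h (inv v))) ` {h \<in> carrier F. len h \<le> N + len v}"
      using h e1 e2 by (intro image_eqI[of _ _ h]) auto
  qed
  then show ?thesis using finite_ball finite_surj by blast
qed

lemma prefix_near_power:
  assumes v: "v \<in> carrier F" "v \<noteq> \<one>"
  shows "\<exists>k::nat. \<exists>s\<in>carrier F. val (prefix_of (attracting_point F X v) n) = v [^] k \<otimes> s \<and> len s \<le> len v"
proof -
  have gs: "(\<lambda>n. v [^] (n::nat)) \<in> gseq" using ray_gseq[OF one_closed v] v by simp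
  then obtain M :: nat where "n \<le> len (v [^] M) \<and> take n (rep (v [^] M)) = limit_prefix (\<lambda>n. v [^] (n::nat)) n"
    using limit_prefix_eventual[OF gs, of n] unfolding eventual_prefix_def by blast
  then have "rep (v [^] M) = prefix_of (attracting_point F X v) n @ drop n (rep (v [^] M))"
    using end_prefix_endpoint[OF gs] unfolding attracting_point_def by (metis append_take_drop_id)
  then show ?thesis using prefix_of_power[OF v(1)] by blast
qed

text \<open>Both sequences of powers follow the geodesic to the common end: its \<open>n\<close>-th vertex has the form
  \<open>w [^] k \<otimes> s\<close> and also \<open>v [^] k' \<otimes> s'\<close> with \<open>s\<close> and \<open>s'\<close> in a finite ball. Two different vertices have the same
  \<open>s\<close> and \<open>s'\<close>, and their quotient is a power of both.\<close>
lemma common_power: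
  assumes w: "w \<in> carrier F" "w \<noteq> \<one>" and v: "v \<in> carrier F" "v \<noteq> \<one>"
    and e: "attracting_point F X w = attracting_point F X v"
  shows "\<exists>m>0. \<exists>k::int. w [^] (m::nat) = v [^] k"
proof -
  define p where "p = attracting_point F X w"
  have pb: "p \<in> boundary" unfolding p_def using attracting_ray_end[OF w] ray_end_boundary[OF one_closed w] by simp
  have "\<forall>n. \<exists>k s. s \<in> carrier F \<and> val (prefix_of p n) = w [^] (k::nat) \<otimes> s \<and> len s \<le> len w"
    using prefix_near_power[OF w] p_def by blast
  then obtain kw sw where W: "\<And>n. sw n \<in> carrier F \<and> val (prefix_of p n) = w [^] (kw n::nat) \<otimes> sw n \<and> len (sw n) \<le> len w" by metis
  have "\<forall>n. \<exists>k s. s \<in> carrier F \<and> val (prefix_of p n) = v [^] (k::nat) \<otimes> s \<and> len s \<le> len v"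
    using prefix_near_power[OF v] p_def e by metis
  then obtain kv sv where V: "\<And>n. sv n \<in> carrier F \<and> val (prefix_of p n) = v [^] (kv n::nat) \<otimes> sv n \<and> len (sv n) \<le> len v" by metis
  have "range (\<lambda>n. (sw n, sv n)) \<subseteq> {g \<in> carrier F. len g \<le> len w} \<times> {g \<in> carrier F. len g \<le> len v}" using W V by auto
  then have "finite (range (\<lambda>n. (sw n, sv n)))" using finite_ball by (meson finite_SigmaI finite_subset)
  then obtain n0 where "\<not> finite {n \<in> UNIV. (sw n, sv n) = (sw n0, sv n0)}"
    using pigeonhole_infinite[of "UNIV :: nat set" "\<lambda>n. (sw n, sv n)"] by auto
  then have "\<not> {n. (sw n, sv n) = (sw n0, sv n0)} \<subseteq> {n0}" by (auto dest: finite_subset)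
  then obtain n where n: "n \<noteq> n0" "sw n = sw n0" "sv n = sv n0" by auto
  have quot: "val (prefix_of p n) \<otimes> inv (val (prefix_of p n0)) = u [^] (int k - int k0)"
    if "u \<in> carrier F" "s \<in> carrier F" "val (prefix_of p n) = u [^] k \<otimes> s" "val (prefix_of p n0) = u [^] k0 \<otimes> s" for u s and k k0 :: nat
  proof -
    have "val (prefix_of p n) \<otimes> inv (val (prefix_of p n0)) = u [^] k \<otimes> (s \<otimes> inv s) \<otimes> inv (u [^] k0)"
      using that by (simp add: inv_mult_group m_assoc del: r_inv Units_r_inv)
    also have "\<dots> = u [^] k \<otimes> inv (u [^] k0)" using that by simp
    finally show ?thesis using that(1) by (simp add: int_pow_diff int_pow_int)
  qed
  have qw: "val (prefix_of p n) \<otimes> inv (val (prefix_of p n0)) = w [^] (int (kw n) - int (kw n0))"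
    using W[of n] W[of n0] n by (intro quot[of _ "sw n0"]) (auto simp: w)
  have qv: "val (prefix_of p n) \<otimes> inv (val (prefix_of p n0)) = v [^] (int (kv n) - int (kv n0))"
    using V[of n] V[of n0] n by (intro quot[of _ "sv n0"]) (auto simp: v)
  define i where "i = int (kw n) - int (kw n0)"
  define j where "j = int (kv n) - int (kv n0)"
  have ij: "w [^] i = v [^] j" using qw qv by (simp add: i_def j_def)
  have "i \<noteq> 0"
  proof
    assume "i = 0"
    then have "val (prefix_of p n) = val (prefix_of p n0)" using W[of n] W[of n0] n by (simp add: i_def)
    then have "prefix_of p n = prefix_of p n0" using rep_val end_prefix_props(2,3)[OF pb] by metis
    then show False using end_prefix_props(1)[OF pb] n(1) by metis
  qed
  then consider "i > 0" | "i < 0" by linarith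
  then show ?thesis
  proof cases
    case 1
    then have "w [^] nat i = v [^] j" using ij by (simp add: pow_nat)
    then show ?thesis using 1 by (intro exI[of _ "nat i"]) auto
  next
    case 2
    have "w [^] (- i) = v [^] (- j)" using ij w v by (simp add: int_pow_neg)
    then have "w [^] nat (- i) = v [^] (- j)" using 2 by (simp add: pow_nat)
    then show ?thesis using 2 by (intro exI[of _ "nat (- i)"]) auto
  qed
qed

text \<open>A power of \<open>w\<close> equals a power of \<open>v\<close>. If the exponents had different signs, then the attracting point
  of each would be the repelling point of the other, and all four points would coincide.\<close>
lemma attracting_determines_repelling:
  assumes w: "w \<in> carrier F" "w \<noteq> \<one>" and v: "v \<in> carrier F" "v \<noteq> \<one>"
    and e: "attracting_point F X w = attracting_point F X v"
  shows "repelling_point F X w = repelling_point F X v"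
proof -
  obtain m :: nat and k :: int where mk: "m > 0" "w [^] m = v [^] k" using common_power[OF assms] by blast
  have v': "inv v \<in> carrier F" "inv v \<noteq> \<one>" using v inv_neq_one by auto
  have w': "inv w \<in> carrier F" "inv w \<noteq> \<one>" using w inv_neq_one by auto
  have rw: "repelling_point F X w = attracting_point F X (inv (v [^] k))"
    unfolding repelling_point_def using attracting_power[OF w' mk(1)] mk(2) w by (simp add: nat_pow_inv)
  have aw: "attracting_point F X w = attracting_point F X (v [^] k)" using attracting_power[OF w mk(1)] mk(2) by simp
  have "k \<noteq> 0" using mk pow_neq_one[OF w mk(1)] by auto
  then consider "k > 0" | "k < 0" by linarith
  then show ?thesis
  proof cases
    case 1
    then have "v [^] k = v [^] nat k" by (simp add: pow_nat)
    then have "inv (v [^] k) = inv v [^] nat k" using v by (simp add: nat_pow_inv)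
    then show ?thesis using rw attracting_power[OF v', of "nat k"] 1 by (simp add: repelling_point_def)
  next
    case 2
    have "inv (v [^] k) = v [^] (- k)" using v by (simp add: int_pow_neg)
    also have "\<dots> = v [^] nat (- k)" using 2 by (simp add: pow_nat)
    finally have i: "inv (v [^] k) = v [^] nat (- k)" .
    then have "v [^] k = inv (v [^] nat (- k))" using v by (metis inv_inv int_pow_closed)
    then have "v [^] k = inv v [^] nat (- k)" using v by (simp add: nat_pow_inv)
    then have "attracting_point F X w = repelling_point F X v"
      using aw attracting_power[OF v', of "nat (- k)"] 2 by (simp add: repelling_point_def)
    moreover have "repelling_point F X w = attracting_point F X v"
      using rw i attracting_power[OF v, of "nat (- k)"] 2 by simp
    ultimately show ?thesis using e by simp
  qed
qed

end

section \<open>The decomposition space\<close>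

locale line_pattern = based_free_group +
  fixes W :: "'a set"
  assumes finW: "finite W" and W: "v \<in> W \<Longrightarrow> v \<in> carrier F" and W1: "\<one> \<notin> W"
begin

abbreviation "ident \<equiv> identified F X W"
abbreviation "proj \<equiv> decomposition_map F X W"

lemma identified_sym: "ident p q \<Longrightarrow> ident q p"
proof -
  assume "ident p q"
  then obtain w v where w: "w \<in> carrier F" "v \<in> W" "conjugate_subgroups F (generate F {w}) (generate F {v})"
    "p = attracting_point F X w" "q = repelling_point F X w" unfolding identified_def by blast
  have "generate F {inv w} = generate F {w}"
  proof -
    have "inv w [^] k = w [^] (- k)" "w [^] k = inv w [^] (- k)" for k :: int
      using w(1) by (simp_all add: int_pow_inv int_pow_neg)
    then have "(\<exists>k::int. x = inv w [^] k) \<longleftrightarrow> (\<exists>k::int. x = w [^] k)" for x by metis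
    then show ?thesis using w(1) by (simp add: generate_pow)
  qed
  moreover have "repelling_point F X (inv w) = attracting_point F X w" using w(1) by (simp add: repelling_point_def)
  ultimately show "ident q p" unfolding identified_def using w
    by (intro bexI[of _ "inv w"]) (auto simp: repelling_point_def)
qed

text \<open>What matters about the exponent is its sign: it decides which end of a translate of the line of \<open>v\<close>
  attracts \<open>w\<close>.\<close>
lemma generator_of_conjugate:
  assumes w: "w \<in> carrier F" and v: "v \<in> W" and c: "conjugate_subgroups F (generate F {w}) (generate F {v})"
  obtains g a where "g \<in> carrier F" "a \<noteq> 0" "w = g \<otimes> v [^] (a::int) \<otimes> inv g" "w \<noteq> \<one>"
proof -
  have vc: "v \<in> carrier F" "v \<noteq> \<one>" using W W1 v by auto
  obtain h where h: "h \<in> carrier F" "generate F {v} = (\<lambda>x. h \<otimes> x \<otimes> inv h) ` generate F {w}"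
    using c unfolding conjugate_subgroups_def by blast
  have "w \<in> generate F {w}" by (rule generate.incl) simp
  then have "h \<otimes> w \<otimes> inv h \<in> generate F {v}" using h by blast
  then obtain a :: int where a: "h \<otimes> w \<otimes> inv h = v [^] a" using generate_pow[OF vc(1)] by auto
  have w1: "w \<noteq> \<one>"
  proof
    assume "w = \<one>"
    then have "generate F {v} = {\<one>}" using h generate_one by simp
    then show False using generate.incl[of v "{v}" F] vc(2) by blast
  qed
  have we: "w = inv h \<otimes> v [^] a \<otimes> inv (inv h)"
  proof -
    have "inv h \<otimes> v [^] a \<otimes> inv (inv h) = (inv h \<otimes> h) \<otimes> w \<otimes> (inv h \<otimes> h)"
      unfolding a[symmetric] using h(1) w by (simp add: m_assoc del: l_inv Units_l_inv)
    then show ?thesis using h(1) w by simp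
  qed
  have "a \<noteq> 0" using we w1 h(1) by auto
  then show thesis using that[of "inv h" a] we w1 h(1) by simp
qed

lemma identified_rays:
  assumes "ident p q"
  shows "\<exists>v\<in>W. \<exists>g\<in>carrier F. (p = ray_end g v \<and> q = ray_end g (inv v)) \<or> (p = ray_end g (inv v) \<and> q = ray_end g v)"
proof -
  obtain w v where w: "w \<in> carrier F" "v \<in> W" "conjugate_subgroups F (generate F {w}) (generate F {v})"
    "p = attracting_point F X w" "q = repelling_point F X w" using assms unfolding identified_def by blast
  have v: "v \<in> carrier F" "v \<noteq> \<one>" using W W1 w(2) by auto
  have v': "inv v \<in> carrier F" "inv v \<noteq> \<one>" using v inv_neq_one by auto
  obtain g a where g: "g \<in> carrier F" "a \<noteq> 0" "w = g \<otimes> v [^] (a::int) \<otimes> inv g"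
    using generator_of_conjugate[OF w(1-3)] by metis
  have *: "attracting_point F X (g \<otimes> u [^] n \<otimes> inv g) = ray_end g u"
    if u: "u \<in> carrier F" "u \<noteq> \<one>" "n > 0" for u and n :: nat
    using attracting_conjugate[OF g(1), of "u [^] n"] ray_end_power[OF g(1) u] pow_neq_one[OF u] u by simp
  have iw: "inv w = g \<otimes> inv (v [^] a) \<otimes> inv g" using g(1,3) v by (simp add: inv_mult_group m_assoc)
  have pq: "(p = ray_end g u \<and> q = ray_end g (inv u))" if u: "u \<in> carrier F" "u \<noteq> \<one>" "v [^] a = u [^] n" "n > 0" for u and n :: nat
  proof -
    have "inv (v [^] a) = inv u [^] n" using u by (simp add: nat_pow_inv)
    then show ?thesis using *[OF u(1,2,4)] *[OF _ inv_neq_one[OF u(1,2)] u(4)] w(4,5) g(3) iw u(1,3)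
      by (simp add: repelling_point_def)
  qed
  show ?thesis
  proof (cases "a > 0")
    case True
    then have "v [^] a = v [^] nat a" by (simp add: pow_nat)
    then show ?thesis using pq[OF v, of "nat a"] True w(2) g(1) by auto
  next
    case False
    have "v [^] a = inv v [^] (- a)" using v by (simp add: int_pow_inv int_pow_neg)
    also have "\<dots> = inv v [^] nat (- a)" using False by (simp add: pow_nat)
    finally have "p = ray_end g (inv v) \<and> q = ray_end g v" using pq[OF v', of "nat (- a)"] False g(2) v by simp
    then show ?thesis using w(2) g(1) by blast
  qed
qed

lemma identified_unique:
  assumes "ident p q" "ident p q'"
  shows "q = q'"
proof -
  have *: "\<exists>w. w \<in> carrier F \<and> w \<noteq> \<one> \<and> p = attracting_point F X w \<and> q = repelling_point F X w" if "ident p q" for q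
    using that generator_of_conjugate unfolding identified_def by metis
  obtain w where w: "w \<in> carrier F" "w \<noteq> \<one>" "p = attracting_point F X w" "q = repelling_point F X w" using *[OF assms(1)] by blast
  obtain w' where w': "w' \<in> carrier F" "w' \<noteq> \<one>" "p = attracting_point F X w'" "q' = repelling_point F X w'" using *[OF assms(2)] by blast
  show ?thesis using attracting_determines_repelling[OF w(1,2) w'(1,2)] w w' by simp
qed

lemma equivclp_identified: "equivclp ident p q \<longleftrightarrow> p = q \<or> ident p q"
proof
  assume "equivclp ident p q"
  then show "p = q \<or> ident p q"
  proof (induction rule: equivclp_induct)
    case (step y z)
    then have "ident y z" using identified_sym by blast
    then show ?case using step.IH identified_sym identified_unique by metis
  qed simp
qed auto

lemma proj_eq_iff:
  assumes "p \<in> boundary" "q \<in> boundary"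
  shows "proj p = proj q \<longleftrightarrow> p = q \<or> ident p q"
proof -
  have "proj p = proj q \<longleftrightarrow> equivclp ident p q"
  proof
    assume "proj p = proj q"
    moreover have "q \<in> proj q" using assms(2) by (simp add: decomposition_map_def)
    ultimately have "q \<in> proj p" by simp
    then show "equivclp ident p q" by (simp add: decomposition_map_def)
  next
    assume "equivclp ident p q"
    then have "equivclp ident p x \<longleftrightarrow> equivclp ident q x" for x
      using equivclp_sym equivclp_trans by metis
    then show "proj p = proj q" by (simp add: decomposition_map_def)
  qed
  then show ?thesis using equivclp_identified by simp
qed

text \<open>Two identified points on different sides of a shadow are the ends of a line that splits before the
  length of the defining word.\<close>
lemma finitely_many_crossings:
  "finite {p \<in> shadow c. \<exists>q\<in>boundary - shadow c. proj p = proj q}"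
proof -
  define N where "N = length c"
  define L where "L v = {(ray_end g v, ray_end g (inv v)) | g. g \<in> carrier F \<and> prefix_of (ray_end g v) N \<noteq> prefix_of (ray_end g (inv v)) N}" for v
  have fin: "finite (L v)" if "v \<in> W" for v
    unfolding L_def using finitely_many_split_lines[of v N] W W1 that by metis
  have "{p \<in> shadow c. \<exists>q\<in>boundary - shadow c. proj p = proj q} \<subseteq> (\<Union>v\<in>W. fst ` L v \<union> snd ` L v)"
  proof
    fix p assume "p \<in> {p \<in> shadow c. \<exists>q\<in>boundary - shadow c. proj p = proj q}"
    then obtain q where p: "p \<in> shadow c" and q: "q \<in> boundary" "q \<notin> shadow c" "proj p = proj q" by blast
    have pb: "p \<in> boundary" using p by (simp add: shadow_def)
    have "ident p q" using proj_eq_iff[OF pb q(1)] p q by auto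
    moreover have ne: "prefix_of p N \<noteq> prefix_of q N" using p q(1,2) by (auto simp: shadow_def N_def)
    ultimately obtain v g where vg: "v \<in> W" "g \<in> carrier F"
      "(p = ray_end g v \<and> q = ray_end g (inv v)) \<or> (p = ray_end g (inv v) \<and> q = ray_end g v)" using identified_rays by blast
    then have "(p, q) \<in> L v \<or> (q, p) \<in> L v" unfolding L_def using ne by auto
    then have "p \<in> fst ` L v \<union> snd ` L v" by (metis UnI1 UnI2 fst_conv image_eqI snd_conv)
    then show "p \<in> (\<Union>v\<in>W. fst ` L v \<union> snd ` L v)" using vg(1) by blast
  qed
  moreover have "finite (\<Union>v\<in>W. fst ` L v \<union> snd ` L v)" using fin finW by blast
  ultimately show ?thesis by (rule finite_subset)
qed

abbreviation "D \<equiv> decomposition_space F X W"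

lemma closed_proj: "closed_map (gromov_boundary F X) D proj"
proof (rule clopen_crossing_closed_map[OF quotient_map_decomposition_map, where \<C> = "range shadow"])
  show "t1_space (gromov_boundary F X)" using Hausdorff_boundary Hausdorff_imp_t1_space by blast
  show "\<exists>C\<in>range shadow. z \<in> C \<and> C \<subseteq> U" if "openin (gromov_boundary F X) U" "z \<in> U" for z U
    using shadow_base[OF that] by blast
qed (use openin_shadow finitely_many_crossings in \<open>auto simp: topspace_gromov_boundary\<close>)

lemma compact_decomposition: "compact_space D"
  and Hausdorff_decomposition: "Hausdorff_space D"
  using closed_quotient_Hausdorff[OF quotient_map_decomposition_map closed_proj compact_boundary Hausdorff_boundary] .

lemma locally_connected_decomposition:
  assumes "connected_space D"
  shows "locally_connected_space D"
proof (rule crossing_quotient_locally_connected[OF quotient_map_decomposition_map closed_proj compact_boundary, where \<C> = "range shadow"])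
  show "t1_space (gromov_boundary F X)" "t1_space D"
    using Hausdorff_boundary Hausdorff_decomposition Hausdorff_imp_t1_space by blast+
  show "\<exists>C\<in>range shadow. z \<in> C \<and> C \<subseteq> U" if "openin (gromov_boundary F X) U" "z \<in> U" for z U
    using shadow_base[OF that] by blast
qed (use assms openin_shadow closedin_shadow finitely_many_crossings in \<open>auto simp: topspace_gromov_boundary\<close>)

lemma separable_decomposition: "\<exists>E. countable E \<and> D closure_of E = topspace D"
proof -
  obtain E where E: "countable E" "E \<subseteq> boundary" "gromov_boundary F X closure_of E = boundary"
    using separable_boundary by blast
  have cont: "continuous_map (gromov_boundary F X) D proj" and surj: "proj ` boundary = topspace D"
    using quotient_imp_continuous_map[OF quotient_map_decomposition_map]
      quotient_imp_surjective_map[OF quotient_map_decomposition_map] by (simp_all add: topspace_gromov_boundary)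
  have "proj ` (gromov_boundary F X closure_of E) \<subseteq> D closure_of (proj ` E)"
    by (rule continuous_map_image_closure_subset[OF cont])
  then have "D closure_of (proj ` E) = topspace D" using E(3) surj closure_of_subset_topspace by (metis subset_antisym)
  then show ?thesis using E(1) by blast
qed

end

text \<open>The trivial subgroup is contained in the cyclic subgroup of a generator, so it is not maximal.\<close>
lemma (in based_free_group) multiword_nontrivial:
  assumes "card X > 1" and "multiword F W"
  shows "\<one> \<notin> W"
proof
  assume "\<one> \<in> W"
  then have mx: "maximal_cyclic_subgroup F {\<one>}" using assms(2) generate_one unfolding multiword_def by auto
  obtain x where x: "x \<in> X" using assms(1) by (metis card.empty ex_in_conv not_less_zero)
  have xc: "x \<in> carrier F" using x basis by (auto simp: free_basis_def)
  have xv: "val [(x, True)] = x" using xc by (simp add: letter_value_def)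
  have "\<one> \<in> generate F {x}" by (rule generate.one)
  then have "{\<one>} = generate F {x}" using mx xc unfolding maximal_cyclic_subgroup_def by blast
  then have "x = \<one>" using generate.incl[of x "{x}" F] by blast
  then have "val [(x, True)] = val []" using xv by simp
  moreover have "rep (val [(x, True)]) = [(x, True)]" using x by (intro rep_val) auto
  moreover have "rep (val []) = []" by (intro rep_val) auto
  ultimately show False by simp
qed

theorem proposition4p6:
  fixes F :: "('a, 'b) monoid_scheme" and X :: "'a set" and n :: nat and W :: "'a set"
  assumes "group F"
    and "free_basis F X" and "finite X" and "card X = n" and "n > 1"
    and "multiword F W"
  shows "decomposition_space F X W homeomorphic_space top_of_set (sphere (0::complex) 1)
    \<longleftrightarrow>
      connected_space (decomposition_space F X W) \<and>
      (\<nexists>x. cut_point (decomposition_space F X W) x) \<and>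
      (\<exists>P. cut_pair (decomposition_space F X W) P) \<and>
      (\<forall>P. cut_pair (decomposition_space F X W) P \<longrightarrow>
         (\<exists>Q. cut_pair (decomposition_space F X W) Q \<and> crosses (decomposition_space F X W) Q P))"
    (is "?circle \<longleftrightarrow> ?conditions")
proof
  assume ?circle
  then show ?conditions using circle_imp_crossed_cut_pairs by blast
next
  assume c: ?conditions
  interpret based_free_group F X using assms(1-3) by (simp add: based_free_group_def based_free_group_axioms_def)
  have "\<one>\<^bsub>F\<^esub> \<notin> W" using multiword_nontrivial assms(4-6) by simp
  then interpret line_pattern F X W
    using assms(6) by unfold_locales (auto simp: multiword_def)
  obtain E where "countable E" "D closure_of E = topspace D" using separable_decomposition by blast
  then show ?circle
    using circle_of_crossed_cut_pairs[OF compact_decomposition Hausdorff_decomposition locally_connected_decomposition]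
      c by blast
qed

end
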